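(* Let $(X_t)_{t\ge 0}$ be a stochastic process on $\mathbb{T}=\mathbb{R}/2\pi\mathbb{Z}$ with stationary independent increments whose increment distributions are $D_t=\beta_t\delta+(1-\beta_t)\gamma_t$, satisfying the standing assumptions on the process listed in the context, and suppose that $\gamma_t$ is symmetric, i.e. $\gamma_t(y)=\gamma_t(-y)$ for all $y$. If there exists a time $t_0>0$ such that the Fourier coefficients $\{\hat\gamma_{t_0}(k)\}_{k\ge0}$ are all distinct and nonzero, then the family $$\mathcal{F}_1=\{\mathbf{1}_{\Omega}\mid \Omega\subseteq\mathbb{T}\text{ open},\ \mathrm{Lebesgue}_1(\partial\Omega)=0\}$$ is reconstructible up to reflections by $X_t$.
   Context: Standing assumptions on the process: there is a family of probability distributions $(D_t)_{t\ge0}$ on $\mathbb{T}$ such that (1) $X_{t_2}-X_{t_1}\sim D_{t_2-t_1}$ for every $t_2\ge t_1\ge 0$; (2) for all $0\le t_1\le\dots\le t_n$, the increments $X_{t_2}-X_{t_1},\dots,X_{t_n}-X_{t_{n-1}}$ are independent; (3) $D_{t+s}=D_t\star D_s$ for all $s,t\ge0$, where $\star$ is convolution. Moreover $D_t$ is either continuous (given by a density) or a mixture of an atom at $0$ and such a distribution: $D_t(x)=\beta_t\delta(x)+(1-\beta_t)\gamma_t(x)$, where $\delta$ is the Dirac distribution at $0$, $\gamma_t$ is a probability density function on $\mathbb{T}$, $\beta_t\in[0,1]$, and $\gamma_t\in L^2(\mathbb{T})$ for all $t>0$. The function $\beta_t$ is not identically $1$ (the process is not constant). The symmetry hypothesis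 on $\gamma_t$ is for all $t>0$. Fourier coefficients: for $g:\mathbb{T}\to\mathbb{C}$ and $k\in\mathbb{Z}$, $\hat g(k)=\int_{\mathbb{T}}g(x)e^{-ikx}\,dx$. Reconstructibility up to reflections: a family $\mathcal{F}$ of real functions on $\mathbb{T}$ is reconstructible up to reflections by $X_t$ if there is a function $A:\mathbb{R}^{\mathbb{R}^+}\to\mathbb{R}^{\mathbb{T}}$ (with $\mathbb{R}^+=[0,\infty)$) such that for every $f\in\mathcal{F}$, with probability $1$ there exists a (random) shift $\theta\in\mathbb{T}$ such that either $A\big((f(X_t))_{t\ge0}\big)(x)=f(x+\theta)$ for almost all $x$, or $A\big((f(X_t))_{t\ge0}\big)(x)=f(-x+\theta)$ for almost all $x$. *)

theory Defs
  imports "HOL-Probability.Probability"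
begin

definition circle_rel :: "real \<Rightarrow> real \<Rightarrow> bool" where
  "circle_rel x y \<longleftrightarrow> (\<exists>k::int. x - y = 2 * pi * of_int k)"

lemma equivp_circle_rel: "equivp circle_rel"
proof (rule equivpI)
  show "reflp circle_rel"
    by (auto simp: reflp_def circle_rel_def intro: exI[of _ 0])
  show "symp circle_rel"
  proof (rule sympI)
    fix x y assume "circle_rel x y"
    then obtain k :: int where "x - y = 2 * pi * of_int k"
      by (auto simp: circle_rel_def)
    then have "y - x = 2 * pi * of_int (- k)" by simp
    then show "circle_rel y x" unfolding circle_rel_def by blast
  qed
  show "transp circle_rel"
  proof (rule transpI)
    fix x y z assume "circle_rel x y" "circle_rel y z"
    then obtain k l :: int where "x - y = 2 * pi * of_int k" "y - z = 2 * pi * of_int l"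
      by (auto simp: circle_rel_def)
    then have "x - z = 2 * pi * of_int (k + l)" by (simp add: algebra_simps)
    then show "circle_rel x z" unfolding circle_rel_def by blast
  qed
qed

quotient_type circle = real / circle_rel
  morphisms rep_circle to_circle
  by (rule equivp_circle_rel)

instantiation circle :: ab_group_add
begin

lift_definition zero_circle :: circle is "0::real" .

lift_definition plus_circle :: "circle \<Rightarrow> circle \<Rightarrow> circle" is "(+)"
proof -
  fix a b c d assume "circle_rel a b" "circle_rel c d"
  then obtain k l :: int where "a - b = 2 * pi * of_int k" "c - d = 2 * pi * of_int l"
    by (auto simp: circle_rel_def)
  then have "(a + c) - (b + d) = 2 * pi * of_int (k + l)" by (simp add: algebra_simps)
  then show "circle_rel (a + c) (b + d)" unfolding circle_rel_def by blast
qed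

lift_definition uminus_circle :: "circle \<Rightarrow> circle" is uminus
proof -
  fix a b assume "circle_rel a b"
  then obtain k :: int where "a - b = 2 * pi * of_int k"
    by (auto simp: circle_rel_def)
  then have "(- a) - (- b) = 2 * pi * of_int (- k)" by simp
  then show "circle_rel (- a) (- b)" unfolding circle_rel_def by blast
qed

lift_definition minus_circle :: "circle \<Rightarrow> circle \<Rightarrow> circle" is "(-)"
proof -
  fix a b c d assume "circle_rel a b" "circle_rel c d"
  then obtain k l :: int where "a - b = 2 * pi * of_int k" "c - d = 2 * pi * of_int l"
    by (auto simp: circle_rel_def)
  then have "(a - c) - (b - d) = 2 * pi * of_int (k - l)" by (simp add: algebra_simps)
  then show "circle_rel (a - c) (b - d)" unfolding circle_rel_def by blast
qed

instance
  by standard (transfer; use equivp_circle_rel in \<open>simp add: equivp_reflp algebra_simps\<close>)+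

end

instantiation circle :: topological_space
begin

definition open_circle :: "circle set \<Rightarrow> bool" where
  "open_circle U \<longleftrightarrow> open (to_circle -` U)"

instance
proof
  show "open (UNIV :: circle set)"
    by (simp add: open_circle_def)
  show "open (S \<inter> T)" if "open S" "open T" for S T :: "circle set"
    using that by (auto simp: open_circle_def vimage_Int)
  show "open (\<Union>K)" if "\<forall>S\<in>K. open S" for K :: "circle set set"
    using that by (auto simp: open_circle_def vimage_Union)
qed

end

lemma continuous_to_circle: "continuous_on UNIV to_circle"
  by (simp add: continuous_on_open_vimage open_circle_def)

lemma measurable_to_circle: "to_circle \<in> borel \<rightarrow>\<^sub>M borel"
  using continuous_to_circle by (rule borel_measurable_continuous_onI)

text \<open>Not normalised: the total mass is \<open>2 * pi\<close>.\<close>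

definition circle_lebesgue :: "circle measure" where
  "circle_lebesgue = distr (restrict_space lborel {0..<2 * pi}) borel to_circle"

lemma sets_circle_lebesgue: "sets circle_lebesgue = sets borel"
  by (simp add: circle_lebesgue_def)

lemma emeasure_circle_lebesgue:
  assumes "A \<in> sets borel"
  shows "emeasure circle_lebesgue A = emeasure lborel (to_circle -` A \<inter> {0..<2 * pi})"
proof -
  have "to_circle \<in> restrict_space lborel {0..<2 * pi} \<rightarrow>\<^sub>M borel"
    using measurable_to_circle by (intro measurable_restrict_space1) simp
  then show ?thesis
    using assms
    by (simp add: circle_lebesgue_def emeasure_distr emeasure_restrict_space space_restrict_space)
qed

lift_definition circle_char :: "int \<Rightarrow> circle \<Rightarrow> complex" is "\<lambda>k x. cis (of_int k * x)"
proof -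
  fix k :: int and x y assume "circle_rel x y"
  then obtain l :: int where "x - y = 2 * pi * of_int l"
    by (auto simp: circle_rel_def)
  then have "of_int k * x = of_int k * y + 2 * pi * of_int (k * l)"
    by (simp add: algebra_simps flip: distrib_left)
  moreover have "cis (2 * pi * of_int (k * l)) = 1"
    by (rule cis_multiple_2pi) simp
  ultimately show "cis (of_int k * x) = cis (of_int k * y)"
    by (simp flip: cis_mult)
qed

definition fourier_coeff :: "(circle \<Rightarrow> complex) \<Rightarrow> int \<Rightarrow> complex" where
  "fourier_coeff g k = (LINT x|circle_lebesgue. g x * circle_char (- k) x)"

text \<open>The library's convolution of measures is restricted to Euclidean spaces.\<close>

definition circle_convolution :: "circle measure \<Rightarrow> circle measure \<Rightarrow> circle measure" where
  "circle_convolution \<mu> \<nu> = distr (\<mu> \<Otimes>\<^sub>M \<nu>) borel (\<lambda>(x, y). x + y)"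

definition circle_pdf :: "(circle \<Rightarrow> real) \<Rightarrow> bool" where
  "circle_pdf g \<longleftrightarrow> g \<in> borel_measurable borel \<and> (\<forall>x. 0 \<le> g x) \<and>
     (\<integral>\<^sup>+ x. ennreal (g x) \<partial>circle_lebesgue) = 1"

text \<open>
  The law of \<open>X 0\<close> is arbitrary, and \<open>X 0\<close> need not be independent of the increments.
  Only the values \<open>X t\<close> with \<open>t \<ge> 0\<close> matter.
\<close>

locale circle_process = prob_space M for M :: "'a measure" +
  fixes X :: "real \<Rightarrow> 'a \<Rightarrow> circle"
    and D :: "real \<Rightarrow> circle measure"
    and \<beta> :: "real \<Rightarrow> real"
    and \<gamma> :: "real \<Rightarrow> circle \<Rightarrow> real"
  assumes random_variable_X: "t \<ge> 0 \<Longrightarrow> random_variable borel (X t)"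
    and prob_space_D: "t \<ge> 0 \<Longrightarrow> prob_space (D t)"
    and sets_D: "t \<ge> 0 \<Longrightarrow> sets (D t) = sets borel"
    and stationary_increments:
      "0 \<le> s \<Longrightarrow> s \<le> t \<Longrightarrow> distr M borel (\<lambda>\<omega>. X t \<omega> - X s \<omega>) = D (t - s)"
    and independent_increments:
      "\<And>(n::nat) \<tau>. (\<And>i. i \<in> {1..n} \<Longrightarrow> 0 \<le> \<tau> i) \<Longrightarrow> mono_on {1..n} \<tau> \<Longrightarrow>
         indep_vars (\<lambda>_. borel) (\<lambda>i \<omega>. X (\<tau> (Suc i)) \<omega> - X (\<tau> i) \<omega>) {1..<n}"
    and convolution_D: "0 \<le> s \<Longrightarrow> 0 \<le> t \<Longrightarrow> D (t + s) = circle_convolution (D t) (D s)"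
    and \<beta>_range: "t \<ge> 0 \<Longrightarrow> \<beta> t \<in> {0..1}"
    and pdf_\<gamma>: "t \<ge> 0 \<Longrightarrow> circle_pdf (\<gamma> t)"
    and mixture_D: "t \<ge> 0 \<Longrightarrow> A \<in> sets borel \<Longrightarrow>
         emeasure (D t) A = ennreal (\<beta> t) * emeasure (return borel 0) A +
           ennreal (1 - \<beta> t) * emeasure (density circle_lebesgue (\<lambda>x. ennreal (\<gamma> t x))) A"
    and L2_\<gamma>: "t > 0 \<Longrightarrow> integrable circle_lebesgue (\<lambda>x. (\<gamma> t x)\<^sup>2)"
    and not_constant: "\<exists>t\<ge>0. \<beta> t \<noteq> 1"

text \<open>
  The restriction to \<open>{0..}\<close> makes the reconstruction map depend on the path at nonnegative
  times only; no measurability of the map is required.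
\<close>

definition reconstructible_up_to_reflections ::
  "'a measure \<Rightarrow> (real \<Rightarrow> 'a \<Rightarrow> circle) \<Rightarrow> (circle \<Rightarrow> real) set \<Rightarrow> bool" where
  "reconstructible_up_to_reflections M X F \<longleftrightarrow>
     (\<exists>A :: (real \<Rightarrow> real) \<Rightarrow> circle \<Rightarrow> real. \<forall>f\<in>F. AE \<omega> in M. \<exists>\<theta>.
        (AE x in circle_lebesgue. A (\<lambda>t\<in>{0..}. f (X t \<omega>)) x = f (x + \<theta>)) \<or>
        (AE x in circle_lebesgue. A (\<lambda>t\<in>{0..}. f (X t \<omega>)) x = f (- x + \<theta>)))"

definition open_indicators :: "(circle \<Rightarrow> real) set" where
  "open_indicators =
     {indicator \<Omega> |\<Omega>. open \<Omega> \<and> emeasure circle_lebesgue (frontier \<Omega>) = 0}"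

end

theory Submission
  imports Defs
begin

text \<open>
  Let \<open>T\<close> be convolution with \<open>D t\<^sub>0\<close>. It is self-adjoint with eigenvalues \<open>\<phi> k\<close>, \<open>k \<ge> 0\<close>, which are
  distinct since \<open>\<beta> t\<^sub>0 \<noteq> 1\<close>. Almost surely, averages of products \<open>f (X (n t\<^sub>0)) f (X ((n + m\<^sub>1) t\<^sub>0)) \<dots>\<close>
  converge to \<open>\<integral> f T\<^bsup>m\<^sub>1\<^esup> (f T\<^bsup>m\<^sub>2\<^esup> (f \<dots>))\<close>: for characters this is a martingale argument, and an open set
  with null boundary is squeezed between trigonometric polynomials. Approximating the eigenprojections by
  polynomials in \<open>T\<close>, these limits determine the sums of \<open>f^(- j\<^sub>1) f^(j\<^sub>1 - j\<^sub>2) \<dots> f^(j\<^sub>r)\<close> over all sign choices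
  \<open>j\<^sub>i = \<plusminus> l\<^sub>i\<close>. Taking all \<open>l\<^sub>i\<close> near a large \<open>N\<close> with \<open>f^(N) \<noteq> 0\<close>, a sign change costs a factor \<open>f^(\<plusminus> 2 N + \<dots>)\<close>,
  which vanishes in the limit, so the real parts of all products \<open>\<Prod> f^(k\<^sub>i)\<close> with \<open>\<Sum> k\<^sub>i = 0\<close> are determined.
  Hence the phases of \<open>f^\<close> are determined up to a character of the integers and complex conjugation, that
  is, \<open>f\<close> is determined up to a shift and a reflection. If \<open>f^\<close> has finite support, then the indicator
  function \<open>f\<close> is almost everywhere constant, as \<open>f\<^sup>2 = f\<close>.
  The reconstruction map picks any indicator function of the family whose statistics match those of the path.
\<close>

text \<open>Since \<phi> is even, \<open>T\<close> cannot separate the frequencies l and -l; this is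
  the source of the sums over signs and of the reflection ambiguity. Products with index sum zero
  are the natural invariants: a shift leaves them fixed, a reflection conjugates them. Their real
  parts alone leave a choice of conjugation for each product separately; that one choice serves all
  products follows by concatenating two index lists. \<open>X 0\<close> has an arbitrary law and may
  depend on the increments, so the sampled path need not be stationary and the ergodic theorem does
  not apply directly. Orthogonality of martingale differences takes its place. Genericity is a
  property of the path alone, given by countably many words of characters; from a generic path the
  passage to f is deterministic. That \<beta> differs from 1 at the given time, while it is known to
  do so only at some time, comes from divisibility: each law is a convolution power of laws at small
  times, and by symmetry its coefficients at positive times are squares of reals.\<close>

abbreviation \<mu> :: "circle measure" where "\<mu> \<equiv> circle_lebesgue"

section \<open>The circle and its Lebesgue measure\<close>

lemma circle_char_add: "circle_char k (x + y) = circle_char k x * circle_char k y"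
  by transfer (simp add: cis_mult algebra_simps)

lemma circle_char_add_index: "circle_char (k + l) x = circle_char k x * circle_char l x"
  by transfer (simp add: cis_mult algebra_simps)

lemma circle_char_0 [simp]: "circle_char 0 x = 1"
  by transfer simp

lemma circle_char_at_0 [simp]: "circle_char k 0 = 1"
  by transfer simp

lemma norm_circle_char [simp]: "norm (circle_char k x) = 1"
  by transfer simp

lemma circle_char_uminus: "circle_char k (- x) = cnj (circle_char k x)"
  by transfer (simp add: cis_cnj)

lemma circle_char_uminus_index: "circle_char (- k) x = cnj (circle_char k x)"
  by transfer (simp add: cis_cnj)

lemma circle_char_to_circle: "circle_char k (to_circle x) = cis (of_int k * x)"
  by transfer simp

lemma circle_char_mult_cnj [simp]: "circle_char k x * cnj (circle_char k x) = 1"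
  by (simp flip: circle_char_uminus_index circle_char_add_index)

lemma continuous_circle_char: "continuous_on UNIV (circle_char k)"
proof -
  have "open (circle_char k -` B)" if "open B" for B
  proof -
    have "to_circle -` (circle_char k -` B) = (\<lambda>x. cis (of_int k * x)) -` B"
      by (auto simp: circle_char_to_circle)
    moreover have "open ((\<lambda>x. cis (of_int k * x)) -` B)"
      using that by (intro open_vimage) (auto intro!: continuous_intros)
    ultimately show ?thesis by (simp add: open_circle_def)
  qed
  then show ?thesis by (simp add: continuous_on_open_vimage)
qed

lemma measurable_circle_char [measurable]: "circle_char k \<in> borel_measurable borel"
  using continuous_circle_char by (rule borel_measurable_continuous_onI)

lemma circle_char_1_inj: "circle_char 1 x = circle_char 1 y \<Longrightarrow> x = y"
proof (transfer, unfold circle_rel_def)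
  fix x y :: real assume "cis (of_int 1 * x) = cis (of_int 1 * y)"
  then have "exp (\<i> * of_real x) = exp (\<i> * of_real y)" by (simp add: cis_conv_exp)
  then obtain n :: int where "\<i> * of_real x = \<i> * of_real y + of_int (2 * n) * (complex_of_real pi * \<i>)"
    by (auto simp: exp_eq)
  then have "\<i> * complex_of_real x = \<i> * of_real (y + 2 * pi * n)" by (simp add: algebra_simps)
  then have "x = y + 2 * pi * n" by (simp only: mult_cancel_left of_real_eq_iff) simp
  then show "\<exists>k::int. x - y = 2 * pi * of_int k" by auto
qed

lemma to_circle_add: "to_circle (x + y) = to_circle x + to_circle y"
  by (simp add: plus_circle.abs_eq)

lemma to_circle_uminus: "to_circle (- x) = - to_circle x"
  by (simp add: uminus_circle.abs_eq)

lemma to_circle_eq_iff: "to_circle x = to_circle y \<longleftrightarrow> (\<exists>k::int. x = y + 2 * pi * of_int k)"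
  using circle.abs_eq_iff[of x y] by (auto simp: circle_rel_def algebra_simps)

lemma to_circle_periodic [simp]: "to_circle (x + 2 * pi) = to_circle x" "to_circle (x - 2 * pi) = to_circle x"
  by (auto simp: to_circle_eq_iff intro: exI[of _ 1] exI[of _ "-1"])

lemma ex_to_circle: "\<exists>r. to_circle r = x \<and> 0 \<le> r \<and> r < 2 * pi"
proof -
  obtain s where s: "x = to_circle s" by (metis Quotient_abs_rep Quotient_circle)
  define r where "r = s - 2 * pi * of_int \<lfloor>s / (2 * pi)\<rfloor>"
  have "0 \<le> r"
    using mult_left_mono[OF of_int_floor_le[of "s / (2 * pi)"], of "2 * pi"] by (simp add: r_def)
  moreover have "r < 2 * pi"
    using mult_strict_left_mono[OF floor_correct[THEN conjunct2, of "s / (2 * pi)"], of "2 * pi"]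
    by (simp add: r_def algebra_simps)
  moreover have "to_circle r = x"
    unfolding s to_circle_eq_iff r_def by (rule exI[of _ "- \<lfloor>s / (2 * pi)\<rfloor>"]) simp
  ultimately show ?thesis by auto
qed

text \<open>A section of the quotient map. It turns out to be Borel, so measurability of addition
  and negation on the circle is inherited from the real line.\<close>

definition circle_arg :: "circle \<Rightarrow> real" where
  "circle_arg x = (SOME r. to_circle r = x \<and> 0 \<le> r \<and> r < 2 * pi)"

lemma circle_arg: "to_circle (circle_arg x) = x" "0 \<le> circle_arg x" "circle_arg x < 2 * pi"
  using someI_ex[OF ex_to_circle[of x]] by (auto simp: circle_arg_def)

lemma circle_arg_to_circle:
  assumes "0 \<le> r" "r < 2 * pi"
  shows "circle_arg (to_circle r) = r"
proof -
  have "to_circle (circle_arg (to_circle r)) = to_circle r" by (rule circle_arg)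
  then obtain k :: int where k: "circle_arg (to_circle r) = r + 2 * pi * of_int k"
    by (auto simp: to_circle_eq_iff)
  with assms circle_arg(2,3)[of "to_circle r"] have *: "2 * pi * of_int k < 2 * pi * 1" "2 * pi * (-1) < 2 * pi * of_int k"
    by linarith+
  from *(1) have "k < 1" by (subst (asm) mult_less_cancel_left_pos) auto
  moreover from *(2) have "of_int k > (-1::real)" by (subst (asm) mult_less_cancel_left_pos) auto
  ultimately show ?thesis using k by simp
qed

text \<open>The only jump is at 0, where the value drops from near 2 pi to 0; as the lower value is
  attained, the function is lower semicontinuous. For c \<ge> 0 the superlevel set lifts to the
  translates of the open interval from c to 2 pi.\<close>

lemma measurable_circle_arg [measurable]: "circle_arg \<in> borel_measurable borel"
proof (rule borel_measurableI_greater)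
  fix c
  have *: "open {x. c < circle_arg x}" if "0 \<le> c"
  proof -
    have "to_circle -` {x. c < circle_arg x} = (\<Union>k::int. {c + 2 * pi * of_int k <..< 2 * pi + 2 * pi * of_int k})"
    proof (intro equalityI subsetI; simp)
      fix s assume c: "c < circle_arg (to_circle s)"
      have "to_circle s = to_circle (circle_arg (to_circle s))" by (simp add: circle_arg)
      then obtain k :: int where "s = circle_arg (to_circle s) + 2 * pi * of_int k"
        by (auto simp: to_circle_eq_iff)
      then show "\<exists>k::int. c + 2 * pi * of_int k < s \<and> s < 2 * pi + 2 * pi * of_int k"
        using c circle_arg[of "to_circle s"] by (intro exI[of _ k]) linarith
    next
      fix s assume "\<exists>k::int. c + 2 * pi * of_int k < s \<and> s < 2 * pi + 2 * pi * of_int k"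
      then obtain k :: int where s: "c + 2 * pi * of_int k < s" "s < 2 * pi + 2 * pi * of_int k" by blast
      have "to_circle s = to_circle (s - 2 * pi * of_int k)"
        by (auto simp: to_circle_eq_iff intro!: exI[of _ k])
      then show "c < circle_arg (to_circle s)"
        using circle_arg_to_circle[of "s - 2 * pi * of_int k"] s that by simp
    qed
    then show ?thesis by (simp add: open_circle_def open_UN)
  qed
  show "{x \<in> space borel. c < circle_arg x} \<in> sets borel"
  proof (cases "0 \<le> c")
    case True then show ?thesis using *[OF True] by simp
  next
    case False
    then have "{x \<in> space borel. c < circle_arg x} = UNIV"
      by (auto simp: not_le intro: less_le_trans[OF _ circle_arg(2)])
    then show ?thesis by simp
  qed
qed

declare measurable_to_circle [measurable]

lemma measurable_circle_plus [measurable (raw)]: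
  fixes f g :: "'b \<Rightarrow> circle"
  assumes [measurable]: "f \<in> M \<rightarrow>\<^sub>M borel" "g \<in> M \<rightarrow>\<^sub>M borel"
  shows "(\<lambda>x. f x + g x) \<in> M \<rightarrow>\<^sub>M borel"
proof -
  have "(\<lambda>x. f x + g x) = (\<lambda>x. to_circle (circle_arg (f x) + circle_arg (g x)))"
    by (simp add: to_circle_add circle_arg)
  then show ?thesis by simp
qed

lemma measurable_circle_uminus [measurable (raw)]:
  fixes f :: "'b \<Rightarrow> circle"
  assumes [measurable]: "f \<in> M \<rightarrow>\<^sub>M borel"
  shows "(\<lambda>x. - f x) \<in> M \<rightarrow>\<^sub>M borel"
proof -
  have "(\<lambda>x. - f x) = (\<lambda>x. to_circle (- circle_arg (f x)))"
    by (simp add: to_circle_uminus circle_arg)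
  then show ?thesis by simp
qed

lemma measurable_circle_diff [measurable (raw)]:
  fixes f g :: "'b \<Rightarrow> circle"
  assumes [measurable]: "f \<in> M \<rightarrow>\<^sub>M borel" "g \<in> M \<rightarrow>\<^sub>M borel"
  shows "(\<lambda>x. f x - g x) \<in> M \<rightarrow>\<^sub>M borel"
  using measurable_circle_plus[of f M "\<lambda>x. - g x"] by simp

lemma emeasure_lborel_translate:
  assumes "A \<in> sets borel"
  shows "emeasure lborel ((\<lambda>x. x + c) -` A) = emeasure lborel (A :: real set)"
proof -
  have "emeasure lborel A = emeasure (distr lborel borel ((+) c)) A"
    by (simp add: lborel_distr_plus)
  also have "\<dots> = emeasure lborel ((+) c -` A)"
    using assms by (subst emeasure_distr) auto
  also have "(+) c -` A = (\<lambda>x. x + c) -` A" by (auto simp: add.commute)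
  finally show ?thesis by simp
qed

lemma emeasure_lborel_uminus:
  assumes "A \<in> sets borel"
  shows "emeasure lborel (uminus -` A) = emeasure lborel (A :: real set)"
proof -
  have "emeasure lborel A = emeasure (distr lborel borel uminus) A"
    by (simp add: lborel_distr_uminus)
  also have "\<dots> = emeasure lborel (uminus -` A)"
    using assms by (subst emeasure_distr) auto
  finally show ?thesis by simp
qed

text \<open>The part of the window beyond 2 pi is moved back by one period onto the missing part
  below c.\<close>

lemma emeasure_periodic_window:
  fixes E :: "real set"
  assumes [measurable]: "E \<in> sets borel" and per: "\<And>x. x + 2 * pi \<in> E \<longleftrightarrow> x \<in> E"
    and c: "0 \<le> c" "c \<le> 2 * pi"
  shows "emeasure lborel (E \<inter> {c..<c + 2 * pi}) = emeasure lborel (E \<inter> {0..<2 * pi})"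
proof -
  have "emeasure lborel (E \<inter> {2 * pi..<c + 2 * pi}) =
      emeasure lborel ((\<lambda>x. x + 2 * pi) -` (E \<inter> {2 * pi..<c + 2 * pi}))"
    by (subst emeasure_lborel_translate) auto
  also have "(\<lambda>x. x + 2 * pi) -` (E \<inter> {2 * pi..<c + 2 * pi}) = E \<inter> {0..<c}"
    by (auto simp: per)
  finally have 1: "emeasure lborel (E \<inter> {2 * pi..<c + 2 * pi}) = emeasure lborel (E \<inter> {0..<c})" .
  have "E \<inter> {c..<c + 2 * pi} = (E \<inter> {c..<2 * pi}) \<union> (E \<inter> {2 * pi..<c + 2 * pi})"
    using c by auto
  then have "emeasure lborel (E \<inter> {c..<c + 2 * pi}) =
      emeasure lborel (E \<inter> {c..<2 * pi}) + emeasure lborel (E \<inter> {2 * pi..<c + 2 * pi})"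
    by (simp add: plus_emeasure) (subst plus_emeasure; auto)
  also have "\<dots> = emeasure lborel (E \<inter> {0..<c} \<union> E \<inter> {c..<2 * pi})"
    unfolding 1 by (subst plus_emeasure[symmetric]) (auto simp: add.commute)
  also have "E \<inter> {0..<c} \<union> E \<inter> {c..<2 * pi} = E \<inter> {0..<2 * pi}" using c by auto
  finally show ?thesis .
qed

lemma space_circle_lebesgue [simp]: "space \<mu> = UNIV"
  by (simp add: circle_lebesgue_def)

declare sets_circle_lebesgue [simp, measurable_cong]

lemma distr_circle_lebesgue_plus: "distr \<mu> borel (\<lambda>x. x + \<theta>) = \<mu>"
proof (rule measure_eqI)
  fix A assume "A \<in> sets (distr \<mu> borel (\<lambda>x. x + \<theta>))"
  then have A [measurable]: "A \<in> sets borel" by simp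
  define c where "c = circle_arg \<theta>"
  have c: "0 \<le> c" "c \<le> 2 * pi" "to_circle c = \<theta>" using circle_arg[of \<theta>] by (auto simp: c_def)
  have E [measurable]: "to_circle -` A \<in> sets borel"
    using measurable_sets[OF measurable_to_circle A] by simp
  have "emeasure (distr \<mu> borel (\<lambda>x. x + \<theta>)) A = emeasure \<mu> ((\<lambda>x. x + \<theta>) -` A)"
    by (subst emeasure_distr) auto
  also have "\<dots> = emeasure lborel (to_circle -` ((\<lambda>x. x + \<theta>) -` A) \<inter> {0..<2 * pi})"
  proof (rule emeasure_circle_lebesgue)
    have "(\<lambda>x. x + \<theta>) -` A \<inter> space borel \<in> sets borel" by measurable
    then show "(\<lambda>x. x + \<theta>) -` A \<in> sets borel" by simp
  qed
  also have "to_circle -` ((\<lambda>x. x + \<theta>) -` A) \<inter> {0..<2 * pi} = (\<lambda>x. x + c) -` (to_circle -` A \<inter> {c..<c + 2 * pi})"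
    by (auto simp: to_circle_add c)
  also have "emeasure lborel \<dots> = emeasure lborel (to_circle -` A \<inter> {c..<c + 2 * pi})"
    by (rule emeasure_lborel_translate) auto
  also have "\<dots> = emeasure lborel (to_circle -` A \<inter> {0..<2 * pi})"
    using c by (intro emeasure_periodic_window) auto
  also have "\<dots> = emeasure \<mu> A" by (simp add: emeasure_circle_lebesgue)
  finally show "emeasure (distr \<mu> borel (\<lambda>x. x + \<theta>)) A = emeasure \<mu> A" .
qed simp

lemma distr_circle_lebesgue_uminus: "distr \<mu> borel uminus = \<mu>"
proof (rule measure_eqI)
  fix A :: "circle set" assume "A \<in> sets (distr \<mu> borel uminus)"
  then have A [measurable]: "A \<in> sets borel" by simp
  define E where "E = to_circle -` A"
  have E [measurable]: "E \<in> sets borel"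
    using measurable_sets[OF measurable_to_circle A] by (simp add: E_def)
  have per: "x + 2 * pi \<in> E \<longleftrightarrow> x \<in> E" for x by (simp add: E_def)
  have "emeasure (distr \<mu> borel uminus) A = emeasure \<mu> (uminus -` A)"
    by (subst emeasure_distr) auto
  also have "\<dots> = emeasure lborel (to_circle -` (uminus -` A) \<inter> {0..<2 * pi})"
  proof (rule emeasure_circle_lebesgue)
    have "uminus -` A \<inter> space borel \<in> sets borel" by measurable
    then show "uminus -` A \<in> sets borel" by simp
  qed
  also have "to_circle -` (uminus -` A) \<inter> {0..<2 * pi} = uminus -` (E \<inter> {-(2 * pi)<..0})"
    by (auto simp: to_circle_uminus E_def)
  also have "emeasure lborel \<dots> = emeasure lborel (E \<inter> {-(2 * pi)<..0})"
    by (rule emeasure_lborel_uminus) auto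
  \<comment> \<open>Reflection turns the half-open window around; after a shift by one period it
    differs from the standard window only in its two endpoints.\<close>
  also have "E \<inter> {-(2 * pi)<..0} = (\<lambda>x. x + 2 * pi) -` (E \<inter> {0<..2 * pi})"
    by (auto simp: per)
  also have "emeasure lborel \<dots> = emeasure lborel (E \<inter> {0<..2 * pi})"
    by (rule emeasure_lborel_translate) auto
  also have "\<dots> = emeasure lborel (E \<inter> {0..<2 * pi})"
  proof (rule emeasure_eq_AE)
    have "AE x in lborel. x \<noteq> 0 \<and> x \<noteq> 2 * pi"
      using AE_lborel_singleton[of 0] AE_lborel_singleton[of "2 * pi"] by eventually_elim auto
    then show "AE x in lborel. x \<in> E \<inter> {0<..2 * pi} \<longleftrightarrow> x \<in> E \<inter> {0..<2 * pi}"
      by eventually_elim auto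
  qed auto
  also have "\<dots> = emeasure \<mu> A" by (simp add: emeasure_circle_lebesgue E_def)
  finally show "emeasure (distr \<mu> borel uminus) A = emeasure \<mu> A" .
qed simp

lemma emeasure_circle_lebesgue_UNIV: "emeasure \<mu> UNIV = ennreal (2 * pi)"
  by (simp add: emeasure_circle_lebesgue)

lemma measure_circle_lebesgue_UNIV [simp]: "measure \<mu> UNIV = 2 * pi"
  by (simp add: measure_def emeasure_circle_lebesgue_UNIV)

interpretation circle_lebesgue: finite_measure circle_lebesgue
  by standard (simp add: emeasure_circle_lebesgue_UNIV)

section \<open>Fourier coefficients and trigonometric polynomials\<close>

text \<open>Bounds are required at every point, not almost everywhere: the functions are evaluated
  along individual paths and integrated against step laws that may have atoms.\<close>

definition bborel :: "(circle \<Rightarrow> complex) set" where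
  "bborel = {u \<in> borel_measurable borel. \<exists>B. \<forall>x. norm (u x) \<le> B}"

lemma bborelI: "u \<in> borel_measurable borel \<Longrightarrow> (\<And>x. norm (u x) \<le> B) \<Longrightarrow> u \<in> bborel"
  by (auto simp: bborel_def)

lemma bborel_measurable: "u \<in> bborel \<Longrightarrow> u \<in> borel_measurable borel"
  by (simp add: bborel_def)

lemma bborelE:
  assumes "u \<in> bborel"
  obtains B where "0 \<le> B" "\<And>x. norm (u x) \<le> B" "u \<in> borel_measurable borel"
proof -
  obtain B where "\<And>x. norm (u x) \<le> B" using assms by (auto simp: bborel_def)
  moreover from this have "0 \<le> B" using norm_ge_zero order_trans by blast
  ultimately show ?thesis using that assms by (auto simp: bborel_def)
qed

named_theorems bb_intros

lemma bb_const [bb_intros]: "(\<lambda>_. c) \<in> bborel"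
  by (auto intro: bborelI)

lemma bb_char [bb_intros]: "circle_char k \<in> bborel"
  by (rule bborelI[where B=1]) auto

lemma bb_add [bb_intros]:
  assumes "u \<in> bborel" "v \<in> bborel"
  shows "(\<lambda>x. u x + v x) \<in> bborel"
proof -
  obtain B where B: "\<And>x. norm (u x) \<le> B" "u \<in> borel_measurable borel" using assms by (metis bborelE)
  obtain C where C: "\<And>x. norm (v x) \<le> C" "v \<in> borel_measurable borel" using assms by (metis bborelE)
  show ?thesis
    using B C by (intro bborelI[where B="B + C"]) (auto intro: norm_triangle_mono)
qed

lemma bb_mult [bb_intros]:
  assumes "u \<in> bborel" "v \<in> bborel"
  shows "(\<lambda>x. u x * v x) \<in> bborel"
proof -
  obtain B where B: "\<And>x. norm (u x) \<le> B" "u \<in> borel_measurable borel" "0 \<le> B"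
    using assms by (metis bborelE)
  obtain C where C: "\<And>x. norm (v x) \<le> C" "v \<in> borel_measurable borel" using assms by (metis bborelE)
  show ?thesis
    using B C by (intro bborelI[where B="B * C"]) (auto simp: norm_mult intro: mult_mono)
qed

lemma bb_cnj [bb_intros]: "u \<in> bborel \<Longrightarrow> (\<lambda>x. cnj (u x)) \<in> bborel"
  by (auto simp: bborel_def intro!: borel_measurable_continuous_on[of cnj] continuous_intros)

lemma bb_uminus [bb_intros]: "u \<in> bborel \<Longrightarrow> (\<lambda>x. - u x) \<in> bborel"
  by (auto simp: bborel_def)

lemma bb_diff [bb_intros]:
  "u \<in> bborel \<Longrightarrow> v \<in> bborel \<Longrightarrow> (\<lambda>x. u x - v x) \<in> bborel"
  using bb_add[of u "\<lambda>x. - v x"] bb_uminus[of v] by simp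

lemma bb_sum [bb_intros]:
  "(\<And>i. i \<in> S \<Longrightarrow> u i \<in> bborel) \<Longrightarrow> (\<lambda>x. \<Sum>i\<in>S. u i x) \<in> bborel"
  by (induction S rule: infinite_finite_induct) (auto intro: bb_intros)

lemma bb_norm2 [bb_intros]: "u \<in> bborel \<Longrightarrow> (\<lambda>x. of_real ((norm (u x))\<^sup>2)) \<in> bborel"
  using bb_mult[of u "\<lambda>x. cnj (u x)"] bb_cnj[of u] by (simp only: complex_norm_square)

lemma bb_plus:
  assumes "u \<in> bborel" shows "(\<lambda>x. u (x + y)) \<in> bborel" "(\<lambda>x. u (y + x)) \<in> bborel"
proof -
  have [measurable]: "u \<in> borel_measurable borel" by (rule bborel_measurable[OF assms])
  show "(\<lambda>x. u (x + y)) \<in> bborel" "(\<lambda>x. u (y + x)) \<in> bborel"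
    using assms by (auto simp: bborel_def)
qed

lemma bb_minus_arg:
  assumes "u \<in> bborel" shows "(\<lambda>x. u (- x)) \<in> bborel"
proof -
  have [measurable]: "u \<in> borel_measurable borel" by (rule bborel_measurable[OF assms])
  show ?thesis using assms by (auto simp: bborel_def)
qed

lemma bb_norm2_integrable:
  assumes "u \<in> bborel" "finite_measure N" "sets N = sets borel"
  shows "integrable N (\<lambda>x. (norm (u x))\<^sup>2)" "integrable N (\<lambda>x. norm (u x))" "integrable N u"
proof -
  interpret finite_measure N by fact
  obtain B where B: "0 \<le> B" "\<And>x. norm (u x) \<le> B" "u \<in> borel_measurable borel"
    using bborelE[OF assms(1)] by blast
  have [measurable]: "u \<in> borel_measurable N" using B(3) assms(3) by (simp cong: measurable_cong_sets)
  show "integrable N u"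
    using B by (intro integrable_const_bound[where B=B]) auto
  then show "integrable N (\<lambda>x. norm (u x))" by simp
  have "(norm (u x))\<^sup>2 \<le> B\<^sup>2" for x using B by (intro power_mono) auto
  then show "integrable N (\<lambda>x. (norm (u x))\<^sup>2)"
    by (intro integrable_const_bound[where B="B\<^sup>2"]) auto
qed

lemma bb_integrable_circle:
  assumes "u \<in> bborel"
  shows "integrable \<mu> (\<lambda>x. (norm (u x))\<^sup>2)" "integrable \<mu> (\<lambda>x. norm (u x))"
    "integrable \<mu> u"
  using bb_norm2_integrable[OF assms circle_lebesgue.finite_measure_axioms] by auto

lemma integral_circle_plus:
  fixes u :: "circle \<Rightarrow> 'c::{banach, second_countable_topology}"
  assumes [measurable]: "u \<in> borel_measurable borel"
  shows "(LINT x|\<mu>. u (x + \<theta>)) = (LINT x|\<mu>. u x)"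
proof -
  have "(LINT x|\<mu>. u x) = (LINT x|distr \<mu> borel (\<lambda>x. x + \<theta>). u x)"
    by (simp add: distr_circle_lebesgue_plus)
  also have "\<dots> = (LINT x|\<mu>. u (x + \<theta>))"
    by (rule integral_distr) auto
  finally show ?thesis by simp
qed

lemma integral_circle_uminus:
  fixes u :: "circle \<Rightarrow> 'c::{banach, second_countable_topology}"
  assumes [measurable]: "u \<in> borel_measurable borel"
  shows "(LINT x|\<mu>. u (- x)) = (LINT x|\<mu>. u x)"
proof -
  have "(LINT x|\<mu>. u x) = (LINT x|distr \<mu> borel uminus. u x)"
    by (simp add: distr_circle_lebesgue_uminus)
  also have "\<dots> = (LINT x|\<mu>. u (- x))"
    by (rule integral_distr) auto
  finally show ?thesis by simp
qed

text \<open>For k \<noteq> 0, translation by pi / k multiplies the character by -1, so invariance of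
  the measure makes the integral its own negative.\<close>

lemma integral_circle_char: "(LINT x|\<mu>. circle_char k x) = (if k = 0 then of_real (2 * pi) else 0)"
proof (cases "k = 0")
  case True then show ?thesis by (simp add: scaleR_conv_of_real)
next
  case False
  define \<theta> where "\<theta> = to_circle (pi / of_int k)"
  have th: "circle_char k \<theta> = -1" using False by (simp add: \<theta>_def circle_char_to_circle)
  have "(LINT x|\<mu>. circle_char k x) = (LINT x|\<mu>. circle_char k (x + \<theta>))"
    by (rule integral_circle_plus[symmetric]) simp
  also have "\<dots> = - (LINT x|\<mu>. circle_char k x)"
    by (simp add: circle_char_add th)
  finally show ?thesis using False by simp
qed

text \<open>Normalised so that the characters become orthonormal and no power of 2 pi enters the
  products of coefficients below.\<close>

definition ncoeff :: "(circle \<Rightarrow> complex) \<Rightarrow> int \<Rightarrow> complex" where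
  "ncoeff u k = fourier_coeff u k / of_real (2 * pi)"

lemma ncoeff_eq: "ncoeff u k = (LINT x|\<mu>. u x * circle_char (- k) x) / of_real (2 * pi)"
  by (simp add: ncoeff_def fourier_coeff_def)

lemma ncoeff_add:
  assumes "u \<in> bborel" "v \<in> bborel"
  shows "ncoeff (\<lambda>x. u x + v x) k = ncoeff u k + ncoeff v k"
  using assms by (simp add: ncoeff_eq distrib_right bb_integrable_circle bb_intros add_divide_distrib)

lemma ncoeff_cmult: "ncoeff (\<lambda>x. c * u x) k = c * ncoeff u k"
  by (simp add: ncoeff_eq mult.assoc)

lemma ncoeff_diff:
  assumes "u \<in> bborel" "v \<in> bborel"
  shows "ncoeff (\<lambda>x. u x - v x) k = ncoeff u k - ncoeff v k"
  using assms by (simp add: ncoeff_eq left_diff_distrib bb_integrable_circle bb_intros diff_divide_distrib)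

lemma ncoeff_zero [simp]: "ncoeff (\<lambda>x. 0) k = 0"
  by (simp add: ncoeff_eq)

lemma ncoeff_sum:
  assumes "\<And>i. i \<in> S \<Longrightarrow> u i \<in> bborel"
  shows "ncoeff (\<lambda>x. \<Sum>i\<in>S. u i x) k = (\<Sum>i\<in>S. ncoeff (u i) k)"
  using assms by (induction S rule: infinite_finite_induct) (auto simp: ncoeff_add bb_intros)

lemma ncoeff_char: "ncoeff (circle_char l) k = (if k = l then 1 else 0)"
  by (simp add: ncoeff_eq integral_circle_char flip: circle_char_add_index)

lemma ncoeff_mult_char: "ncoeff (\<lambda>x. u x * circle_char l x) k = ncoeff u (k - l)"
  by (simp add: ncoeff_eq mult.assoc flip: circle_char_add_index)

lemma norm_ncoeff_le:
  assumes "u \<in> bborel"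
  shows "norm (ncoeff u k) \<le> (LINT x|\<mu>. norm (u x))"
proof -
  have "norm (LINT x|\<mu>. u x * circle_char (- k) x) \<le> (LINT x|\<mu>. norm (u x * circle_char (- k) x))"
    by (rule integral_norm_bound)
  also have "\<dots> = (LINT x|\<mu>. norm (u x))" by (simp add: norm_mult)
  finally have "norm (ncoeff u k) \<le> (LINT x|\<mu>. norm (u x)) / (2 * pi)"
    by (simp add: ncoeff_eq norm_divide divide_right_mono del: norm_of_real) (simp add: divide_right_mono)
  also have "\<dots> \<le> (LINT x|\<mu>. norm (u x)) / 1"
    using pi_gt3 by (intro divide_left_mono) auto
  finally show ?thesis by simp
qed

lemma ncoeff_uminus_index:
  assumes "\<And>x. cnj (u x) = u x"
  shows "ncoeff u (- k) = cnj (ncoeff u k)"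
proof -
  have "cnj (LINT x|\<mu>. u x * circle_char (- k) x) =
      (LINT x|\<mu>. cnj (u x * circle_char (- k) x))"
    by (rule Bochner_Integration.integral_cnj[symmetric])
  also have "\<dots> = (LINT x|\<mu>. u x * circle_char k x)"
    using assms by (simp add: circle_char_uminus_index)
  finally show ?thesis by (simp add: ncoeff_eq)
qed

lemma ncoeff_translate:
  assumes "u \<in> bborel"
  shows "ncoeff (\<lambda>x. u (x + \<theta>)) k = ncoeff u k * circle_char k \<theta>"
proof -
  have [measurable]: "u \<in> borel_measurable borel" by (rule bborel_measurable[OF assms])
  have "(LINT x|\<mu>. u (x + \<theta>) * circle_char (- k) x) =
      (LINT x|\<mu>. u (x + \<theta>) * circle_char (- k) (x + \<theta>) * circle_char k \<theta>)"
    by (rule Bochner_Integration.integral_cong)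
       (auto simp: circle_char_add circle_char_uminus_index mult.assoc mult.commute[of _ "circle_char k \<theta>"])
  also have "\<dots> = (LINT x|\<mu>. u x * circle_char (- k) x) * circle_char k \<theta>"
    by (subst integral_circle_plus[of "\<lambda>x. u x * circle_char (- k) x * circle_char k \<theta>"]) auto
  finally show ?thesis by (simp add: ncoeff_eq)
qed

lemma ncoeff_reflect:
  assumes "u \<in> bborel"
  shows "ncoeff (\<lambda>x. u (- x)) k = ncoeff u (- k)"
proof -
  have [measurable]: "u \<in> borel_measurable borel" by (rule bborel_measurable[OF assms])
  show ?thesis
    using integral_circle_uminus[of "\<lambda>x. u x * circle_char k x"]
    by (simp add: ncoeff_eq circle_char_uminus circle_char_uminus_index)
qed

section \<open>Trigonometric polynomials\<close>

inductive trig :: "(circle \<Rightarrow> complex) \<Rightarrow> bool" where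
  trig_char: "trig (\<lambda>x. c * circle_char k x)"
| trig_add: "trig p \<Longrightarrow> trig q \<Longrightarrow> trig (\<lambda>x. p x + q x)"

lemma trig_const: "trig (\<lambda>_. c)"
  using trig_char[of c 0] by simp

lemma trig_cmult: "trig p \<Longrightarrow> trig (\<lambda>x. c * p x)"
proof (induction rule: trig.induct)
  case (trig_char d k)
  then show ?case using trig.trig_char[of "c * d" k] by (simp add: mult.assoc)
next
  case (trig_add p q)
  then show ?case using trig.trig_add by (simp add: distrib_left)
qed

lemma trig_mult: "trig p \<Longrightarrow> trig q \<Longrightarrow> trig (\<lambda>x. p x * q x)"
proof (induction arbitrary: q rule: trig.induct)
  case (trig_char c k)
  from trig_char show ?case
  proof (induction rule: trig.induct)
    case (trig_char d l)
    then show ?case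
      using trig.trig_char[of "c * d" "k + l"] by (simp add: circle_char_add_index mult_ac)
  next
    case (trig_add p q)
    then show ?case using trig.trig_add by (simp add: distrib_left)
  qed
next
  case (trig_add p q r)
  then show ?case using trig.trig_add by (simp add: distrib_right)
qed

lemma trig_diff: "trig p \<Longrightarrow> trig q \<Longrightarrow> trig (\<lambda>x. p x - q x)"
  using trig_add[of p "\<lambda>x. - 1 * q x"] trig_cmult[of q "-1"] by simp

lemma bb_trig: "trig p \<Longrightarrow> p \<in> bborel"
  by (induction rule: trig.induct) (auto intro!: bb_char bb_const bb_mult bb_add)

lemma trig_expansion:
  assumes "trig p"
  shows "\<exists>S c. finite S \<and> p = (\<lambda>x. \<Sum>k\<in>S. c k * circle_char k x)"
  using assms
proof (induction rule: trig.induct)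
  case (trig_char c k)
  show ?case by (rule exI[of _ "{k}"], rule exI[of _ "\<lambda>_. c"]) auto
next
  case (trig_add p q)
  then obtain S c T d where "finite S" "p = (\<lambda>x. \<Sum>k\<in>S. c k * circle_char k x)"
    "finite T" "q = (\<lambda>x. \<Sum>k\<in>T. d k * circle_char k x)" by blast
  note pq = this
  define b where "b k = (if k \<in> S then c k else 0) + (if k \<in> T then d k else 0)" for k
  have "(\<Sum>k\<in>S \<union> T. (if k \<in> S then c k else 0) * circle_char k x) = p x" for x
    unfolding pq using pq(1,3) by (intro sum.mono_neutral_cong_right) auto
  moreover have "(\<Sum>k\<in>S \<union> T. (if k \<in> T then d k else 0) * circle_char k x) = q x" for x
    unfolding pq using pq(1,3) by (intro sum.mono_neutral_cong_right) auto
  ultimately have "(\<lambda>x. p x + q x) = (\<lambda>x. \<Sum>k\<in>S \<union> T. b k * circle_char k x)"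
    by (simp add: b_def distrib_right sum.distrib)
  with pq(1,3) show ?case by blast
qed

lemma parseval_trig:
  assumes "finite S"
  shows "(LINT x|\<mu>. (norm (\<Sum>k\<in>S. c k * circle_char k x))\<^sup>2) = 2 * pi * (\<Sum>k\<in>S. (norm (c k))\<^sup>2)"
proof -
  have "complex_of_real (LINT x|\<mu>. (norm (\<Sum>k\<in>S. c k * circle_char k x))\<^sup>2) =
      (LINT x|\<mu>. of_real ((norm (\<Sum>k\<in>S. c k * circle_char k x))\<^sup>2))"
    by (rule integral_complex_of_real[symmetric])
  also have "\<dots> = (LINT x|\<mu>. (\<Sum>k\<in>S. \<Sum>l\<in>S. c k * cnj (c l) * circle_char (k - l) x))"
  proof (intro Bochner_Integration.integral_cong refl)
    fix x
    have *: "circle_char (k - l) x = circle_char k x * cnj (circle_char l x)" for k l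
      using circle_char_add_index[of k "- l" x] by (simp add: circle_char_uminus_index)
    show "complex_of_real ((norm (\<Sum>k\<in>S. c k * circle_char k x))\<^sup>2) =
        (\<Sum>k\<in>S. \<Sum>l\<in>S. c k * cnj (c l) * circle_char (k - l) x)"
      unfolding complex_norm_square cnj_sum sum_product * by (simp add: mult_ac)
  qed
  also have "\<dots> = (\<Sum>k\<in>S. \<Sum>l\<in>S. c k * cnj (c l) * (if k - l = 0 then of_real (2 * pi) else 0))"
  proof -
    have i: "integrable \<mu> (\<lambda>x. c k * cnj (c l) * circle_char (k - l) x)" for k l
      by (intro bb_integrable_circle bb_intros)
    then have "(LINT x|\<mu>. (\<Sum>k\<in>S. \<Sum>l\<in>S. c k * cnj (c l) * circle_char (k - l) x))
      = (\<Sum>k\<in>S. \<Sum>l\<in>S. (LINT x|\<mu>. c k * cnj (c l) * circle_char (k - l) x))"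
      by (simp only: Bochner_Integration.integral_sum Bochner_Integration.integrable_sum)
    then show ?thesis by (simp only: integral_mult_right_zero integral_circle_char)
  qed
  also have "\<dots> = (\<Sum>k\<in>S. of_real (2 * pi * (norm (c k))\<^sup>2))"
  proof (rule sum.cong[OF refl])
    fix k assume "k \<in> S"
    have "(\<Sum>l\<in>S. c k * cnj (c l) * (if k - l = 0 then of_real (2 * pi) else 0)) =
      (\<Sum>l\<in>S. if k = l then c k * cnj (c l) * of_real (2 * pi) else 0)"
      by (rule sum.cong) auto
    also have "\<dots> = c k * cnj (c k) * of_real (2 * pi)"
      using assms \<open>k \<in> S\<close> by (simp only: sum.delta' if_True)
    also have "\<dots> = of_real (2 * pi * (norm (c k))\<^sup>2)"
      using complex_norm_square[of "c k"] by simp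
    finally show "(\<Sum>l\<in>S. c k * cnj (c l) * (if k - l = 0 then of_real (2 * pi) else 0)) =
      of_real (2 * pi * (norm (c k))\<^sup>2)" .
  qed
  also have "\<dots> = complex_of_real (2 * pi * (\<Sum>k\<in>S. (norm (c k))\<^sup>2))"
    by (simp only: of_real_sum sum_distrib_left)
  finally show ?thesis by (simp only: of_real_eq_iff)
qed

section \<open>Density of trigonometric polynomials\<close>

text \<open>A real linear functional on the plane is a combination of z and its conjugate, which are
  the characters 1 and -1 on the unit circle. This carries Stone-Weierstrass over to trigonometric
  polynomials.\<close>

lemma trig_real_polynomial:
  "real_polynomial_function r \<Longrightarrow> trig (\<lambda>x. of_real (r (circle_char 1 x)))"
proof (induction rule: real_polynomial_function.induct)
  case (linear r)
  have r: "r z = Re z * r 1 + Im z * r \<i>" for z :: complex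
  proof -
    have "Re z *\<^sub>R 1 + Im z *\<^sub>R \<i> = z" by (simp add: complex_eq_iff)
    then have "r z = r (Re z *\<^sub>R 1 + Im z *\<^sub>R \<i>)" by simp
    then show ?thesis using linear by (simp add: bounded_linear.linear linear_add linear_scale)
  qed
  have "of_real (r (circle_char 1 x)) =
      (of_real (r 1) / 2 + of_real (r \<i>) / (2 * \<i>)) * circle_char 1 x
      + (of_real (r 1) / 2 - of_real (r \<i>) / (2 * \<i>)) * circle_char (- 1) x" for x
    by (simp add: r[of "circle_char 1 x"] circle_char_uminus_index complex_eq_iff)
  then show ?case using trig_add[OF trig_char trig_char] by presburger
next
  case (const c)
  show ?case by (rule trig_const)
next
  case (add f g)
  then show ?case using trig_add by simp
next
  case (mult f g)
  then show ?case using trig_mult by simp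
qed

text \<open>One-sided bounds are what the sandwiching of indicators needs later; they are available
  because the indicator of an open set is an increasing limit of continuous functions.\<close>

lemma open_trig_approx_below:
  assumes U: "open (U :: circle set)"
  obtains p :: "nat \<Rightarrow> circle \<Rightarrow> real" where
    "\<And>n. trig (\<lambda>x. of_real (p n x))" "\<And>n x. p n x \<le> indicator U x" "\<And>n x. \<bar>p n x\<bar> \<le> 2"
    "\<And>x. (\<lambda>n. p n x) \<longlonglongrightarrow> indicator U x"
proof (cases "U = UNIV")
  case True
  show ?thesis by (rule that[of "\<lambda>_ _. 1"]) (auto simp: True intro: trig_const)
next
  case False
  define K where "K = circle_char 1 ` (- U)"
  have "closed (to_circle -` (- U))" using U by (simp add: open_circle_def closed_def vimage_Compl)
  then have "compact (to_circle -` (- U) \<inter> {0..2 * pi})" by (simp add: closed_Int_compact)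
  then have "compact (cis ` (to_circle -` (- U) \<inter> {0..2 * pi}))"
    by (intro compact_continuous_image continuous_intros)
  also have "cis ` (to_circle -` (- U) \<inter> {0..2 * pi}) = K"
  proof (intro equalityI subsetI)
    fix z assume "z \<in> cis ` (to_circle -` (- U) \<inter> {0..2 * pi})"
    then show "z \<in> K" by (auto simp: K_def circle_char_to_circle intro!: image_eqI[of _ _ "to_circle _"])
  next
    fix z assume "z \<in> K"
    then obtain x where x: "x \<notin> U" "z = circle_char 1 x" by (auto simp: K_def)
    then have "z = cis (circle_arg x)"
      using circle_char_to_circle[of 1 "circle_arg x"] by (simp add: circle_arg)
    with x show "z \<in> cis ` (to_circle -` (- U) \<inter> {0..2 * pi})"
      using circle_arg[of x] by (intro image_eqI[of _ _ "circle_arg x"]) auto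
  qed
  finally have K: "closed K" by (rule compact_imp_closed)
  have K_ne: "K \<noteq> {}" using False by (auto simp: K_def)
  \<comment> \<open>Distances are taken in the plane, from the image of the complement of
    \<open>U\<close> on the unit circle; cut off at 1, these functions increase to the indicator of
    \<open>U\<close>.\<close>
  define G where "G n z = min 1 (real n * infdist z K)" for n z
  have "\<exists>r. real_polynomial_function r \<and> (\<forall>z\<in>sphere 0 1. \<bar>G n z - r z\<bar> < 1 / real (Suc n))" for n
  proof -
    have "continuous_on (sphere 0 1) (G n)" unfolding G_def by (intro continuous_intros)
    then obtain r where "real_polynomial_function r" "\<And>z. z \<in> sphere 0 1 \<Longrightarrow> \<bar>G n z - r z\<bar> < 1 / real (Suc n)"
      using Stone_Weierstrass_real_polynomial_function[OF compact_sphere, of 0 1 "G n" "1 / real (Suc n)"]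
      by (metis of_nat_0_less_iff zero_less_Suc zero_less_divide_1_iff)
    then show ?thesis by blast
  qed
  then obtain r where r: "\<And>n. real_polynomial_function (r n)"
    "\<And>n z. z \<in> sphere 0 1 \<Longrightarrow> \<bar>G n z - r n z\<bar> < 1 / real (Suc n)" by metis
  \<comment> \<open>Lowering by the approximation error places \<open>p n\<close> below
    \<open>G n\<close>, which vanishes off \<open>U\<close>.\<close>
  define p where "p n x = r n (circle_char 1 x) - 1 / real (Suc n)" for n x
  have bd: "G n (circle_char 1 x) - 2 / real (Suc n) \<le> p n x" "p n x \<le> G n (circle_char 1 x)" for n x
    using r(2)[of "circle_char 1 x" n] by (auto simp: p_def abs_if split: if_splits)
  have G0: "0 \<le> G n z" "G n z \<le> 1" for n z by (auto simp: G_def infdist_nonneg)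
  have GU: "G n (circle_char 1 x) = 0" if "x \<notin> U" for n x
    using that by (simp add: G_def K_def)
  have lim: "(\<lambda>n. G n (circle_char 1 x)) \<longlonglongrightarrow> indicator U x" for x
  proof (cases "x \<in> U")
    case True
    then have "circle_char 1 x \<notin> K" by (auto simp: K_def dest: circle_char_1_inj)
    then have "infdist (circle_char 1 x) K > 0"
      using K K_ne infdist_pos_not_in_closed by blast
    then obtain N where N: "1 < real N * infdist (circle_char 1 x) K" using reals_Archimedean3 by blast
    have "G n (circle_char 1 x) = 1" if "n \<ge> N" for n
    proof -
      have "real N * infdist (circle_char 1 x) K \<le> real n * infdist (circle_char 1 x) K"
        using that by (intro mult_right_mono) (auto simp: infdist_nonneg)
      with N show ?thesis by (simp add: G_def)
    qed
    then show ?thesis using True by (auto intro!: tendsto_eventually eventually_sequentiallyI)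
  next
    case False then show ?thesis by (simp add: GU)
  qed
  show ?thesis
  proof (rule that[of p])
    show "trig (\<lambda>x. of_real (p n x))" for n
      using trig_diff[OF trig_real_polynomial[OF r(1)] trig_const] by (simp add: p_def)
    show "p n x \<le> indicator U x" for n x
      using bd[where n=n and x=x] G0[of n "circle_char 1 x"] GU[of x n] by (auto simp: indicator_def)
    have "2 / real (Suc n) \<le> 2" for n by (simp add: field_simps)
    then show "\<bar>p n x\<bar> \<le> 2" for n x
      using bd[where n=n and x=x] G0[of n "circle_char 1 x"] by (smt (verit))
    show "(\<lambda>n. p n x) \<longlonglongrightarrow> indicator U x" for x
    proof (rule tendsto_sandwich[OF _ _ _ lim])
      have "(\<lambda>n. 2 / real (Suc n)) \<longlonglongrightarrow> 0" by real_asymp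
      from tendsto_diff[OF lim this]
      show "(\<lambda>n. G n (circle_char 1 x) - 2 / real (Suc n)) \<longlonglongrightarrow> indicator U x" by simp
    qed (use bd in \<open>auto intro!: eventuallyI simp del: of_nat_Suc\<close>)
  qed
qed

section \<open>Quadratic approximation of bounded Borel functions\<close>

definition l2dist :: "(circle \<Rightarrow> complex) \<Rightarrow> (circle \<Rightarrow> complex) \<Rightarrow> real" where
  "l2dist u v = (LINT x|\<mu>. (norm (u x - v x))\<^sup>2)"

lemma norm_add_square_le: "(norm (a + b :: complex))\<^sup>2 \<le> 2 * (norm a)\<^sup>2 + 2 * (norm b)\<^sup>2"
proof -
  have "(norm (a + b))\<^sup>2 \<le> (norm a + norm b)\<^sup>2" by (intro power_mono norm_triangle_ineq) simp
  also have "\<dots> \<le> 2 * (norm a)\<^sup>2 + 2 * (norm b)\<^sup>2"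
    using sum_squares_bound[of "norm a" "norm b"] by (simp add: power2_sum)
  finally show ?thesis .
qed

lemma l2_add_le:
  assumes "u \<in> bborel" "v \<in> bborel"
  shows "(LINT x|\<mu>. (norm (u x + v x))\<^sup>2) \<le>
    2 * (LINT x|\<mu>. (norm (u x))\<^sup>2) + 2 * (LINT x|\<mu>. (norm (v x))\<^sup>2)"
proof -
  have "(LINT x|\<mu>. (norm (u x + v x))\<^sup>2) \<le>
      (LINT x|\<mu>. 2 * (norm (u x))\<^sup>2 + 2 * (norm (v x))\<^sup>2)"
    using assms by (intro integral_mono norm_add_square_le) (auto intro!: bb_integrable_circle(1) bb_intros)
  then show ?thesis using assms by (simp add: bb_integrable_circle)
qed

lemma l2dist_nonneg [simp]: "0 \<le> l2dist u v"
  by (simp add: l2dist_def)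

text \<open>\<open>l2dist\<close> is a squared distance, hence the factors 2.\<close>

lemma l2dist_triangle:
  assumes "u \<in> bborel" "v \<in> bborel" "w \<in> bborel"
  shows "l2dist u w \<le> 2 * l2dist u v + 2 * l2dist v w"
  using l2_add_le[of "\<lambda>x. u x - v x" "\<lambda>x. v x - w x"] assms by (simp add: l2dist_def bb_intros)

text \<open>The inequality between arithmetic and geometric mean, with weight \<epsilon>, takes the
  place of Cauchy-Schwarz. It gives (2 pi + 1) / 2 times \<epsilon>, and 4 is a round upper
  bound.\<close>

lemma l1_le_l2:
  assumes "u \<in> bborel" "\<epsilon> > 0" "(LINT x|\<mu>. (norm (u x))\<^sup>2) \<le> \<epsilon>\<^sup>2"
  shows "(LINT x|\<mu>. norm (u x)) \<le> 4 * \<epsilon>"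
proof -
  have le: "norm (u x) \<le> (\<epsilon> + (norm (u x))\<^sup>2 / \<epsilon>) / 2" for x
    using sum_squares_bound[of "norm (u x)" \<epsilon>] assms(2) by (simp add: field_simps power2_eq_square)
  have "(LINT x|\<mu>. norm (u x)) \<le> (LINT x|\<mu>. (\<epsilon> + (norm (u x))\<^sup>2 / \<epsilon>) / 2)"
    using assms by (intro integral_mono le) (simp_all add: bb_integrable_circle)
  also have "\<dots> = (2 * pi * \<epsilon> + (LINT x|\<mu>. (norm (u x))\<^sup>2) / \<epsilon>) / 2"
    using assms by (simp add: bb_integrable_circle)
  also have "(LINT x|\<mu>. (norm (u x))\<^sup>2) / \<epsilon> \<le> \<epsilon>"
    using assms by (simp add: field_simps power2_eq_square)
  also have "(2 * pi * \<epsilon> + \<epsilon>) / 2 \<le> 4 * \<epsilon>"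
  proof -
    have "2 * pi + 1 \<le> 8" using pi_approx(2) by simp
    from mult_right_mono[OF this, of \<epsilon>] assms(2) show ?thesis by (simp add: algebra_simps)
  qed
  finally show ?thesis by simp
qed

definition l2_trig_approx :: "(circle \<Rightarrow> complex) \<Rightarrow> bool" where
  "l2_trig_approx u \<longleftrightarrow> (\<forall>\<epsilon>>0. \<exists>p. trig p \<and> l2dist u p < \<epsilon>)"

lemma l2_trig_approx_trig: "trig p \<Longrightarrow> l2_trig_approx p"
  by (auto simp: l2_trig_approx_def l2dist_def intro!: exI[of _ p])

lemma l2_trig_approx_add:
  assumes "u \<in> bborel" "v \<in> bborel" "l2_trig_approx u" "l2_trig_approx v"
  shows "l2_trig_approx (\<lambda>x. u x + v x)"
  unfolding l2_trig_approx_def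
proof (intro allI impI)
  fix \<epsilon> :: real assume "\<epsilon> > 0"
  then obtain p q where pq: "trig p" "l2dist u p < \<epsilon> / 4" "trig q" "l2dist v q < \<epsilon> / 4"
    using assms(3,4) unfolding l2_trig_approx_def by (meson divide_pos_pos zero_less_numeral)
  have "l2dist (\<lambda>x. u x + v x) (\<lambda>x. p x + q x) \<le> 2 * l2dist u p + 2 * l2dist v q"
    using l2_add_le[of "\<lambda>x. u x - p x" "\<lambda>x. v x - q x"] assms pq
    by (simp add: l2dist_def bb_intros bb_trig algebra_simps)
  then show "\<exists>p. trig p \<and> l2dist (\<lambda>x. u x + v x) p < \<epsilon>"
    using pq by (intro exI[of _ "\<lambda>x. p x + q x"]) (auto intro: trig_add)
qed

lemma l2_trig_approx_cmult:
  assumes "l2_trig_approx u"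
  shows "l2_trig_approx (\<lambda>x. c * u x)"
proof (cases "c = 0")
  case True then show ?thesis using l2_trig_approx_trig[OF trig_const[of 0]] by simp
next
  case False
  show ?thesis unfolding l2_trig_approx_def
  proof (intro allI impI)
    fix \<epsilon> :: real assume "\<epsilon> > 0"
    then obtain p where p: "trig p" "l2dist u p < \<epsilon> / (norm c)\<^sup>2"
      using assms False unfolding l2_trig_approx_def by (meson divide_pos_pos zero_less_norm_iff zero_less_power)
    have "l2dist (\<lambda>x. c * u x) (\<lambda>x. c * p x) = (norm c)\<^sup>2 * l2dist u p"
      by (simp add: l2dist_def norm_mult power_mult_distrib flip: right_diff_distrib)
    also have "\<dots> < \<epsilon>" using p False by (simp add: field_simps)
    finally show "\<exists>p. trig p \<and> l2dist (\<lambda>x. c * u x) p < \<epsilon>"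
      using trig_cmult[OF p(1)] by blast
  qed
qed

text \<open>Dominated convergence. This closure property carries approximability from open sets up
  to all bounded Borel functions.\<close>

lemma l2_trig_approx_limit:
  assumes u: "u \<in> borel_measurable borel" and v: "\<And>n. v n \<in> borel_measurable borel"
    and B: "\<And>n x. norm (v n x) \<le> B" and lim: "\<And>x. (\<lambda>n. v n x) \<longlonglongrightarrow> u x"
    and approx: "\<And>n. l2_trig_approx (v n)"
  shows "l2_trig_approx u"
proof -
  have uB: "norm (u x) \<le> B" for x
    by (rule LIMSEQ_le_const2[OF tendsto_norm[OF lim[of x]]]) (use B in auto)
  have bb: "u \<in> bborel" "\<And>n. v n \<in> bborel"
    using uB B u v by (auto intro!: bborelI)
  have [measurable]: "u \<in> borel_measurable borel" "\<And>n. v n \<in> borel_measurable borel" using u v by auto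
  have B0: "0 \<le> B" using B norm_ge_zero order_trans by blast
  have "(\<lambda>n. l2dist u (v n)) \<longlonglongrightarrow> (LINT x|\<mu>. 0)"
    unfolding l2dist_def
  proof (rule integral_dominated_convergence[where w="\<lambda>x. (2 * B)\<^sup>2"])
    show "AE x in \<mu>. (\<lambda>n. (norm (u x - v n x))\<^sup>2) \<longlonglongrightarrow> 0"
    proof (rule AE_I2)
      fix x
      have "(\<lambda>n. (norm (u x - v n x))\<^sup>2) \<longlonglongrightarrow> (norm (u x - u x))\<^sup>2"
        by (intro tendsto_intros lim)
      then show "(\<lambda>n. (norm (u x - v n x))\<^sup>2) \<longlonglongrightarrow> 0" by simp
    qed
    have "(norm (u x - v n x)) \<le> 2 * B" for n x
      using norm_triangle_ineq4[of "u x" "v n x"] uB[of x] B[of n x] by linarith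
    then have "(norm (u x - v n x))\<^sup>2 \<le> (2 * B)\<^sup>2" for n x
      by (intro power_mono) auto
    then show "AE x in \<mu>. norm ((norm (u x - v n x))\<^sup>2) \<le> (2 * B)\<^sup>2" for n
      by simp
  qed auto
  then have conv: "(\<lambda>n. l2dist u (v n)) \<longlonglongrightarrow> 0" by simp
  show ?thesis unfolding l2_trig_approx_def
  proof (intro allI impI)
    fix \<epsilon> :: real assume e: "\<epsilon> > 0"
    then obtain n where n: "l2dist u (v n) < \<epsilon> / 4"
      using order_tendstoD(2)[OF conv, of "\<epsilon> / 4"] by (auto simp: eventually_sequentially)
    obtain p where p: "trig p" "l2dist (v n) p < \<epsilon> / 4"
      using approx[of n] e unfolding l2_trig_approx_def by (meson divide_pos_pos zero_less_numeral)
    from l2dist_triangle[OF bb(1) bb(2)[of n] bb_trig[OF p(1)]] n p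
    show "\<exists>p. trig p \<and> l2dist u p < \<epsilon>" by (intro exI[of _ p]) auto
  qed
qed

text \<open>The open sets form an intersection-stable generator, and the sets with approximable
  indicators form a Dynkin system: complements by linearity, disjoint unions as bounded limits of
  finite unions.\<close>

lemma l2_trig_approx_indicator:
  assumes "A \<in> sets (borel :: circle measure)"
  shows "l2_trig_approx (indicator A)"
proof -
  let ?G = "{U :: circle set. open U}"
  have "Int_stable ?G" by (auto simp: Int_stable_def)
  moreover have "A \<in> sigma_sets UNIV ?G" using assms by (simp add: sets_borel)
  ultimately show ?thesis
  proof (induction rule: sigma_sets_induct_disjoint[OF _ subset_UNIV[of ?G, folded Pow_UNIV], consumes 2, case_names basic empty compl union])
    case (basic U)
    then obtain p where p: "\<And>n. trig (\<lambda>x. of_real (p n x))" "\<And>n x. p n x \<le> indicator U x"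
      "\<And>n x. \<bar>p n x\<bar> \<le> 2" "\<And>x. (\<lambda>n. p n x) \<longlonglongrightarrow> indicator U x"
      using open_trig_approx_below[of U] by blast
    have [measurable]: "U \<in> sets borel" using basic by simp
    show ?case
    proof (rule l2_trig_approx_limit[where v="\<lambda>n x. of_real (p n x)" and B=2])
      show "(\<lambda>n. complex_of_real (p n x)) \<longlonglongrightarrow> indicator U x" for x
        using tendsto_of_real[OF p(4)[of x], where ?'a=complex] by (simp add: of_real_indicator)
    qed (use p in \<open>auto intro: l2_trig_approx_trig bborel_measurable bb_trig\<close>)
  next
    case empty
    show ?case using l2_trig_approx_trig[OF trig_const[of 0]] by simp
  next
    case (compl A)
    then have [measurable]: "A \<in> sets borel" by (simp add: sets_borel)
    have eq: "indicator (UNIV - A) = (\<lambda>x. 1 + (-1) * indicator A x :: complex)"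
      by (auto simp: indicator_def)
    have "indicator A \<in> bborel" by (rule bborelI[where B=1]) (auto simp: indicator_def)
    then show ?case
      unfolding eq using compl by (intro l2_trig_approx_add l2_trig_approx_cmult l2_trig_approx_trig[OF trig_const] bb_intros)
  next
    case (union A)
    then have [measurable]: "A i \<in> sets borel" for i by (auto simp: sets_borel)
    have bb: "indicator (A i) \<in> bborel" for i
      by (rule bborelI[where B=1]) (auto simp: indicator_def)
    have fin: "l2_trig_approx (indicator (\<Union>i<n. A i))" for n
    proof (induction n)
      case 0 show ?case using l2_trig_approx_trig[OF trig_const[of 0]] by simp
    next
      case (Suc n)
      have "A n \<inter> A i = {}" if "i < n" for i
        using union(1) that by (metis UNIV_I disjoint_family_on_def nat_neq_iff)
      then have "A n \<inter> (\<Union>i<n. A i) = {}" by blast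
      then have eq: "indicator (\<Union>i<Suc n. A i) = (\<lambda>x. indicator (A n) x + indicator (\<Union>i<n. A i) x :: complex)"
        by (simp add: lessThan_Suc indicator_add fun_eq_iff)
      have "indicator (\<Union>i<n. A i) \<in> bborel"
        by (rule bborelI[where B=1]) (auto simp: indicator_def)
      with Suc union(3) bb show ?case unfolding eq by (intro l2_trig_approx_add)
    qed
    show ?case
    proof (rule l2_trig_approx_limit[where v="\<lambda>n. indicator (\<Union>i<n. A i)" and B=1])
      show "(\<lambda>n. indicator (\<Union>i<n. A i) x :: complex) \<longlonglongrightarrow> indicator (\<Union>i. A i) x" for x
        by (rule LIMSEQ_indicator_UN)
      show "norm (indicator (\<Union>i<n. A i) x :: complex) \<le> 1" for n x
        by (simp add: indicator_def)
    qed (simp_all add: fin)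
  qed
qed

lemma l2_trig_approx_real:
  fixes u :: "circle \<Rightarrow> real"
  assumes "u \<in> borel_measurable borel" "\<And>x. 0 \<le> u x" "\<And>x. u x \<le> B"
  shows "l2_trig_approx (\<lambda>x. of_real (u x))"
  using assms
proof (induction arbitrary: B rule: borel_measurable_induct_real)
  case (set A)
  then show ?case using l2_trig_approx_indicator[of A] by (simp add: of_real_indicator)
next
  case (mult u c)
  show ?case
  proof (cases "c = 0")
    case True then show ?thesis using l2_trig_approx_trig[OF trig_const[of 0]] by simp
  next
    case False
    then have "u x \<le> B / c" for x using mult by (simp add: field_simps)
    from l2_trig_approx_cmult[OF mult.IH[OF this], of "of_real c"] show ?thesis by simp
  qed
next
  case (add u v)
  have le: "u x \<le> B" "v x \<le> B" for x
    using add.prems[of x] add.hyps(2)[of x] add.hyps(4)[of x] by linarith+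
  have "(\<lambda>x. of_real (u x)) \<in> bborel" "(\<lambda>x. of_real (v x)) \<in> bborel"
    using le add by (auto intro!: bborelI[where B=B])
  from l2_trig_approx_add[OF this(2,1) add.IH(2)[OF le(2)] add.IH(1)[OF le(1)]] show ?case by simp
next
  case (seq U)
  have le: "U i x \<le> B" for i x
  proof -
    have "incseq (\<lambda>i. U i x)" using seq.hyps(3) by (auto simp: incseq_def le_fun_def)
    from incseq_le[OF this seq.hyps(4)] have "U i x \<le> u x" by simp
    also have "u x \<le> B" by (rule seq.prems)
    finally show ?thesis .
  qed
  show ?case
  proof (rule l2_trig_approx_limit[where v="\<lambda>n x. of_real (U n x)" and B=B])
    show "l2_trig_approx (\<lambda>x. complex_of_real (U n x))" for n by (rule seq.IH[OF le])
  qed (use seq le assms(1) in \<open>auto intro: tendsto_of_real\<close>)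
qed

lemma l2_trig_approx_bborel:
  assumes "u \<in> bborel"
  shows "l2_trig_approx u"
proof -
  obtain B where B: "0 \<le> B" "\<And>x. norm (u x) \<le> B" and [measurable]: "u \<in> borel_measurable borel"
    using bborelE[OF assms] by blast
  have "\<bar>Re (u x)\<bar> \<le> B" "\<bar>Im (u x)\<bar> \<le> B" for x
    using B(2)[of x] abs_Re_le_cmod[of "u x"] abs_Im_le_cmod[of "u x"] by linarith+
  then have b: "0 \<le> Re (u x) + B" "Re (u x) + B \<le> 2 * B" "0 \<le> Im (u x) + B" "Im (u x) + B \<le> 2 * B" for x
    by (smt (verit))+
  have 1: "l2_trig_approx (\<lambda>x. of_real (Re (u x) + B))"
    using b by (intro l2_trig_approx_real[where B="2 * B"]) auto
  have 2: "l2_trig_approx (\<lambda>x. of_real (Im (u x) + B))"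
    using b by (intro l2_trig_approx_real[where B="2 * B"]) auto
  have bb: "(\<lambda>x. complex_of_real (Re (u x) + B)) \<in> bborel" "(\<lambda>x. complex_of_real (Im (u x) + B)) \<in> bborel"
    using b by (auto intro!: bborelI[where B="2 * B"] simp only: norm_of_real abs_of_nonneg) auto
  \<comment> \<open>Adding \<open>B\<close> makes both parts nonnegative, as the monotone induction
    on measurable functions requires; the constant is itself a trigonometric polynomial.\<close>
  have "u = (\<lambda>x. (of_real (Re (u x) + B) + \<i> * of_real (Im (u x) + B)) + - (1 + \<i>) * of_real B)"
    by (auto simp: fun_eq_iff complex_eq_iff)
  moreover have "l2_trig_approx \<dots>"
    by (intro l2_trig_approx_add l2_trig_approx_cmult 1 2 l2_trig_approx_trig[OF trig_const] bb bb_intros)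
  ultimately show ?thesis by simp
qed

lemma trig_dense:
  assumes "u \<in> bborel" "\<epsilon> > 0"
  obtains p where "trig p" "l2dist u p < \<epsilon>"
  using l2_trig_approx_bborel[OF assms(1)] assms(2) by (auto simp: l2_trig_approx_def)

lemma trig_dense_l1:
  assumes "u \<in> bborel" "\<epsilon> > 0"
  obtains p where "trig p" "(LINT x|\<mu>. norm (u x - p x)) < \<epsilon>"
proof -
  obtain p where p: "trig p" "l2dist u p < (\<epsilon> / 5)\<^sup>2" using trig_dense[OF assms(1), of "(\<epsilon> / 5)\<^sup>2"] assms(2) by auto
  have "(LINT x|\<mu>. norm (u x - p x)) \<le> 4 * (\<epsilon> / 5)"
    using assms p by (intro l1_le_l2 bb_diff[OF _ bb_trig]) (auto simp: l2dist_def)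
  with that p assms show ?thesis by auto
qed

text \<open>The difference is orthogonal to every trigonometric polynomial, and such polynomials
  come close to its conjugate in mean; so its own square integral vanishes.\<close>

lemma ncoeff_uniqueness:
  assumes u: "u \<in> bborel" and v: "v \<in> bborel" and eq: "\<And>k. ncoeff u k = ncoeff v k"
  shows "AE x in \<mu>. u x = v x"
proof -
  define w where "w x = cnj (u x - v x)" for x
  have w: "w \<in> bborel" unfolding w_def by (intro bb_intros u v)
  have w': "(\<lambda>x. u x - v x) \<in> bborel" by (intro bb_intros u v)
  obtain B where B: "0 \<le> B" "\<And>x. norm (u x - v x) \<le> B" and "(\<lambda>x. u x - v x) \<in> borel_measurable borel"
    using bborelE[OF w'] by blast
  have z: "(LINT x|\<mu>. (u x - v x) * circle_char k x) = 0" for k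
  proof -
    have "ncoeff (\<lambda>x. u x - v x) (- k) = 0" using ncoeff_diff[OF u v, of "- k"] eq by simp
    then show ?thesis by (simp add: ncoeff_eq)
  qed
  have zp: "(LINT x|\<mu>. (u x - v x) * p x) = 0" if "trig p" for p
    using that
  proof (induction rule: trig.induct)
    case (trig_char c k)
    have "(LINT x|\<mu>. (u x - v x) * (c * circle_char k x)) =
      (LINT x|\<mu>. c * ((u x - v x) * circle_char k x))" by (simp add: mult_ac)
    then show ?case using z by simp
  next
    case (trig_add p q)
    then have "p \<in> bborel" "q \<in> bborel" by (auto intro: bb_trig)
    then show ?case
      using trig_add w' by (simp add: distrib_left bb_integrable_circle bb_mult)
  qed
  have "(LINT x|\<mu>. (norm (u x - v x))\<^sup>2) \<le> \<epsilon>" if e: "\<epsilon> > 0" for \<epsilon>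
  proof -
    obtain p where p: "trig p" "(LINT x|\<mu>. norm (w x - p x)) < \<epsilon> / (B + 1)"
      using trig_dense_l1[OF w, of "\<epsilon> / (B + 1)"] B e by auto
    note bbp = bb_trig[OF p(1)]
    have "complex_of_real (LINT x|\<mu>. (norm (u x - v x))\<^sup>2) = (LINT x|\<mu>. (u x - v x) * w x)"
      unfolding w_def complex_norm_square[symmetric] by (rule integral_complex_of_real[symmetric])
    also have "\<dots> = (LINT x|\<mu>. (u x - v x) * (w x - p x)) + (LINT x|\<mu>. (u x - v x) * p x)"
      by (subst Bochner_Integration.integral_add[symmetric])
         (auto simp: algebra_simps intro!: bb_integrable_circle bb_intros w u v bbp)
    finally have "norm (complex_of_real (LINT x|\<mu>. (norm (u x - v x))\<^sup>2)) =
        norm (LINT x|\<mu>. (u x - v x) * (w x - p x))" using zp[OF p(1)] by simp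
    also have "\<dots> \<le> (LINT x|\<mu>. norm ((u x - v x) * (w x - p x)))" by (rule integral_norm_bound)
    also have "\<dots> \<le> (LINT x|\<mu>. B * norm (w x - p x))"
    proof (rule integral_mono)
      show "norm ((u x - v x) * (w x - p x)) \<le> B * norm (w x - p x)" for x
        by (simp add: norm_mult mult_right_mono B)
    qed (auto intro!: bb_integrable_circle bb_intros w u v bbp Bochner_Integration.integrable_mult_right)
    also have "\<dots> = B * (LINT x|\<mu>. norm (w x - p x))" by simp
    also have "\<dots> \<le> B * (\<epsilon> / (B + 1))" using p(2) B by (intro mult_left_mono) auto
    also have "\<dots> \<le> \<epsilon>" using B e by (simp add: field_simps)
    finally show ?thesis by simp
  qed
  then have "(LINT x|\<mu>. (norm (u x - v x))\<^sup>2) \<le> 0" by (rule field_le_epsilon[where y=0, simplified])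
  then have "(LINT x|\<mu>. (norm (u x - v x))\<^sup>2) = 0" by (rule antisym) (rule Bochner_Integration.integral_nonneg, simp)
  then have "AE x in \<mu>. (norm (u x - v x))\<^sup>2 = 0"
    by (subst (asm) integral_nonneg_eq_0_iff_AE) (auto intro: bb_integrable_circle w')
  then show ?thesis by simp
qed

lemma ncoeff_trig_eventually_0:
  assumes "trig p"
  shows "\<exists>N. \<forall>k\<ge>N. ncoeff p k = 0"
  using assms
proof (induction rule: trig.induct)
  case (trig_char c k)
  show ?case by (rule exI[of _ "k + 1"]) (auto simp: ncoeff_cmult ncoeff_char)
next
  case (trig_add p q)
  then obtain N M where "\<forall>k\<ge>N. ncoeff p k = 0" "\<forall>k\<ge>M. ncoeff q k = 0" by blast
  then show ?case
    using trig_add by (intro exI[of _ "max N M"]) (auto simp: ncoeff_add bb_trig)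
qed

text \<open>A trigonometric polynomial close in mean has no coefficients at high frequencies, and
  the mean error bounds every coefficient of the difference.\<close>

lemma riemann_lebesgue:
  assumes u: "u \<in> bborel"
  shows "(ncoeff u \<longlongrightarrow> 0) at_top"
proof (rule tendstoI)
  fix \<epsilon> :: real assume e: "\<epsilon> > 0"
  obtain p where p: "trig p" "(LINT x|\<mu>. norm (u x - p x)) < \<epsilon>"
    using trig_dense_l1[OF u e] by blast
  obtain N where N: "\<forall>k\<ge>N. ncoeff p k = 0" using ncoeff_trig_eventually_0[OF p(1)] by blast
  show "\<forall>\<^sub>F k in at_top. dist (ncoeff u k) 0 < \<epsilon>"
    using eventually_ge_at_top[of N]
  proof eventually_elim
    case (elim k)
    have "norm (ncoeff u k) = norm (ncoeff (\<lambda>x. u x - p x) k)"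
      using N elim ncoeff_diff[OF u bb_trig[OF p(1)]] by simp
    also have "\<dots> \<le> (LINT x|\<mu>. norm (u x - p x))"
      by (intro norm_ncoeff_le bb_diff[OF u bb_trig] p(1))
    finally show ?case using p(2) by simp
  qed
qed

section \<open>Convolution with a step distribution and its spectral projections\<close>

text \<open>The transition operator of the random walk on the circle with step law \<nu>.\<close>

definition circle_step_op :: "circle measure \<Rightarrow> (circle \<Rightarrow> complex) \<Rightarrow> circle \<Rightarrow> complex" where
  "circle_step_op \<nu> u x = (LINT y|\<nu>. u (x + y))"

text \<open>That the coefficients are real encodes the symmetry of the step law. They are then even
  in k, so injectivity can only be asked for on one half-line.\<close>

locale circle_step = prob_space \<nu> for \<nu> :: "circle measure" +
  fixes \<phi> :: "int \<Rightarrow> real"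
  assumes sets_step: "sets \<nu> = sets borel"
    and char_step: "(LINT y|\<nu>. circle_char k y) = of_real (\<phi> k)"
    and inj_\<phi>: "inj_on \<phi> {0..}"
begin

declare sets_step [measurable_cong]

abbreviation T where "T \<equiv> circle_step_op \<nu>"

lemma bb_step_integrable: "u \<in> bborel \<Longrightarrow> integrable \<nu> u"
  by (rule bb_norm2_integrable(3)[OF _ finite_measure_axioms sets_step])

lemma T_char: "T (circle_char k) = (\<lambda>x. of_real (\<phi> k) * circle_char k x)"
  by (simp add: circle_step_op_def circle_char_add char_step fun_eq_iff)

lemma T_add:
  assumes "u \<in> bborel" "v \<in> bborel"
  shows "T (\<lambda>x. u x + v x) = (\<lambda>x. T u x + T v x)"
  using assms by (simp add: circle_step_op_def bb_step_integrable bb_plus fun_eq_iff)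

lemma T_cmult: "T (\<lambda>x. c * u x) = (\<lambda>x. c * T u x)"
  by (simp add: circle_step_op_def fun_eq_iff)

text \<open>Positivity of \<open>T\<close> for complex functions. The majorant is complex as well,
  with only its real part read, so that the same operator acts on both sides and the bound can be
  iterated.\<close>

lemma T_bound_by:
  assumes "u \<in> bborel" "h \<in> bborel" "\<And>x. norm (u x) \<le> Re (h x)"
  shows "norm (T u x) \<le> Re (T h x)"
proof -
  have h: "integrable \<nu> (\<lambda>y. h (x + y))" "integrable \<nu> (\<lambda>y. u (x + y))"
    by (intro bb_step_integrable bb_plus assms)+
  have "norm (T u x) \<le> (LINT y|\<nu>. norm (u (x + y)))"
    unfolding circle_step_op_def by (rule integral_norm_bound)
  also have "\<dots> \<le> (LINT y|\<nu>. Re (h (x + y)))"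
    using h by (intro integral_mono assms) auto
  also have "\<dots> = Re (T h x)"
    unfolding circle_step_op_def using h by simp
  finally show ?thesis .
qed

lemma T_const: "T (\<lambda>_. c) = (\<lambda>_. c)"
  by (simp add: circle_step_op_def prob_space fun_eq_iff)

lemma bb_T [bb_intros]:
  assumes "u \<in> bborel" shows "T u \<in> bborel"
proof -
  obtain B where B: "0 \<le> B" "\<And>x. norm (u x) \<le> B" and [measurable]: "u \<in> borel_measurable borel"
    using bborelE[OF assms] by blast
  have "T u \<in> borel_measurable borel" unfolding circle_step_op_def by measurable
  moreover have "norm (T u x) \<le> B" for x
    using T_bound_by[OF assms bb_const[of "of_real B"], of x] B by (simp add: T_const)
  ultimately show ?thesis by (rule bborelI)
qed

text \<open>Lebesgue measure is stationary for the walk; Fubini reduces this to translation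
  invariance.\<close>

lemma integral_T:
  assumes "u \<in> bborel"
  shows "(LINT x|\<mu>. T u x) = (LINT x|\<mu>. u x)"
proof -
  obtain B where B: "0 \<le> B" "\<And>x. norm (u x) \<le> B" and [measurable]: "u \<in> borel_measurable borel"
    using bborelE[OF assms] by blast
  interpret P: pair_sigma_finite \<mu> \<nu> ..
  interpret Q: finite_measure "\<mu> \<Otimes>\<^sub>M \<nu>"
    by (rule finite_measure_pair_measure) (rule circle_lebesgue.finite_measure_axioms finite_measure_axioms)+
  have "integrable (\<mu> \<Otimes>\<^sub>M \<nu>) (\<lambda>(x, y). u (x + y))"
    using B by (intro Q.integrable_const_bound[where B=B]) auto
  then have "(LINT x|\<mu>. (LINT y|\<nu>. u (x + y))) = (LINT y|\<nu>. (LINT x|\<mu>. u (x + y)))"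
    by (rule P.Fubini_integral[symmetric])
  also have "\<dots> = (LINT x|\<mu>. u x)"
    by (simp add: integral_circle_plus prob_space)
  finally show ?thesis by (simp add: circle_step_op_def)
qed

text \<open>Nonnegativity of the variance bounds the squared modulus of \<open>T u\<close> pointwise
  by \<open>T\<close> applied to that of \<open>u\<close>; integrating uses stationarity.\<close>

lemma T_l2:
  assumes "u \<in> bborel"
  shows "(LINT x|\<mu>. (norm (T u x))\<^sup>2) \<le> (LINT x|\<mu>. (norm (u x))\<^sup>2)"
proof -
  have "(norm (T u x))\<^sup>2 \<le> Re (T (\<lambda>x. of_real ((norm (u x))\<^sup>2)) x)" for x
  proof -
    have "(\<lambda>y. u (x + y)) \<in> bborel" by (rule bb_plus[OF assms])
    note i = bb_norm2_integrable[OF this finite_measure_axioms sets_step]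
    have "norm (T u x) \<le> (LINT y|\<nu>. norm (u (x + y)))"
      unfolding circle_step_op_def by (rule integral_norm_bound)
    then have "(norm (T u x))\<^sup>2 \<le> (LINT y|\<nu>. norm (u (x + y)))\<^sup>2"
      by (rule power_mono) simp
    also have "\<dots> \<le> (LINT y|\<nu>. (norm (u (x + y)))\<^sup>2)"
      using variance_positive[of "\<lambda>y. norm (u (x + y))"] variance_eq[OF i(2,1)] by simp
    also have "\<dots> = Re (T (\<lambda>x. of_real ((norm (u x))\<^sup>2)) x)"
      by (simp add: circle_step_op_def del: of_real_power)
    finally show ?thesis .
  qed
  then have "(LINT x|\<mu>. (norm (T u x))\<^sup>2) \<le> (LINT x|\<mu>. Re (T (\<lambda>x. of_real ((norm (u x))\<^sup>2)) x))"
    by (intro integral_mono bb_integrable_circle integrable_Re bb_intros assms)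
  also have "\<dots> = Re (LINT x|\<mu>. T (\<lambda>x. of_real ((norm (u x))\<^sup>2)) x)"
    by (intro integral_Re bb_integrable_circle bb_intros assms)
  also have "\<dots> = (LINT x|\<mu>. (norm (u x))\<^sup>2)"
    by (subst integral_T) (auto intro: bb_norm2 assms simp del: of_real_power)
  finally show ?thesis .
qed

lemma bb_Tpow [bb_intros]: "u \<in> bborel \<Longrightarrow> (T ^^ n) u \<in> bborel"
  by (induction n) (auto intro: bb_intros)

lemma Tpow_add:
  assumes "u \<in> bborel" "v \<in> bborel"
  shows "(T ^^ n) (\<lambda>x. u x + v x) = (\<lambda>x. (T ^^ n) u x + (T ^^ n) v x)"
  using assms by (induction n) (simp_all add: T_add bb_Tpow)

lemma Tpow_cmult: "(T ^^ n) (\<lambda>x. c * u x) = (\<lambda>x. c * (T ^^ n) u x)"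
  by (induction n) (simp_all add: T_cmult)

lemma Tpow_char: "(T ^^ n) (circle_char k) = (\<lambda>x. of_real (\<phi> k ^ n) * circle_char k x)"
proof (induction n)
  case (Suc n)
  have "T (\<lambda>x. of_real (\<phi> k ^ n) * circle_char k x) = (\<lambda>x. of_real (\<phi> k ^ n) * T (circle_char k) x)"
    by (rule T_cmult)
  with Suc show ?case by (simp add: T_char mult_ac)
qed simp

lemma integral_Tpow:
  "u \<in> bborel \<Longrightarrow> (LINT x|\<mu>. (T ^^ n) u x) = (LINT x|\<mu>. u x)"
  by (induction n) (simp_all add: integral_T bb_Tpow)

lemma Tpow_l2:
  "u \<in> bborel \<Longrightarrow>
    (LINT x|\<mu>. (norm ((T ^^ n) u x))\<^sup>2) \<le> (LINT x|\<mu>. (norm (u x))\<^sup>2)"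
  by (induction n) (auto intro: order_trans[OF T_l2] bb_Tpow)

lemma Tpow_bound_by:
  assumes "u \<in> bborel" "h \<in> bborel" "\<And>x. norm (u x) \<le> Re (h x)"
  shows "norm ((T ^^ n) u x) \<le> Re ((T ^^ n) h x)"
  by (induction n arbitrary: x) (auto intro!: T_bound_by bb_Tpow assms)

lemma \<phi>_uminus: "\<phi> (- k) = \<phi> k"
proof -
  have "complex_of_real (\<phi> (- k)) = (LINT y|\<nu>. cnj (circle_char k y))"
    by (simp only: char_step[symmetric] circle_char_uminus_index)
  also have "\<dots> = cnj (of_real (\<phi> k))" by (simp only: Bochner_Integration.integral_cnj char_step)
  finally show ?thesis by simp
qed

lemma \<phi>_abs_le: "\<bar>\<phi> k\<bar> \<le> 1"
proof -
  have "norm (complex_of_real (\<phi> k)) \<le> (LINT y|\<nu>. norm (circle_char k y))"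
    unfolding char_step[symmetric] by (rule integral_norm_bound)
  then show ?thesis by (simp add: prob_space)
qed

lemma \<phi>_0: "\<phi> 0 = 1"
  using char_step[of 0] by (simp add: prob_space)

text \<open>No function of \<open>T\<close> tells a frequency from its negative, but this is the
  only coincidence of eigenvalues.\<close>

lemma \<phi>_eq_iff: "\<phi> k = \<phi> l \<longleftrightarrow> k = l \<or> k = - l"
proof -
  have abs: "\<phi> \<bar>k\<bar> = \<phi> k" for k using \<phi>_uminus[of k] by (simp add: abs_if)
  have "\<phi> k = \<phi> l \<longleftrightarrow> \<bar>k\<bar> = \<bar>l\<bar>"
    using inj_on_eq_iff[OF inj_\<phi>, of "\<bar>k\<bar>" "\<bar>l\<bar>"] by (simp add: abs)
  then show ?thesis by linarith
qed

section \<open>Polynomials in the step operator\<close>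

definition poly_op :: "real poly \<Rightarrow> (circle \<Rightarrow> complex) \<Rightarrow> circle \<Rightarrow> complex" where
  "poly_op q u x = (\<Sum>i\<le>degree q. of_real (coeff q i) * (T ^^ i) u x)"

lemma bb_poly_op [bb_intros]: "u \<in> bborel \<Longrightarrow> poly_op q u \<in> bborel"
  unfolding poly_op_def[abs_def] by (intro bb_intros)

lemma poly_op_add:
  "u \<in> bborel \<Longrightarrow> v \<in> bborel \<Longrightarrow> poly_op q (\<lambda>x. u x + v x) = (\<lambda>x. poly_op q u x + poly_op q v x)"
  by (simp add: poly_op_def Tpow_add distrib_left sum.distrib fun_eq_iff)

lemma poly_op_cmult: "poly_op q (\<lambda>x. c * u x) = (\<lambda>x. c * poly_op q u x)"
  by (simp add: poly_op_def Tpow_cmult sum_distrib_left mult_ac fun_eq_iff)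

lemma poly_op_char: "poly_op q (circle_char k) = (\<lambda>x. of_real (poly q (\<phi> k)) * circle_char k x)"
  by (simp add: poly_op_def Tpow_char poly_altdef sum_distrib_right fun_eq_iff mult.assoc)

lemma poly_op_diff:
  assumes "u \<in> bborel" "v \<in> bborel"
  shows "poly_op q (\<lambda>x. u x - v x) = (\<lambda>x. poly_op q u x - poly_op q v x)"
  using poly_op_add[of u "\<lambda>x. (-1) * v x" q] poly_op_cmult[of q "-1" v] assms
  by (simp add: bb_intros)

text \<open>The constant depends on \<open>q\<close> here. It only serves to pass from trigonometric
  polynomials to bounded functions in \<open>poly_op_l2\<close>.\<close>

lemma poly_op_l2_bounded:
  "\<exists>C\<ge>0. \<forall>u\<in>bborel. (LINT x|\<mu>. (norm (poly_op q u x))\<^sup>2) \<le> C * (LINT x|\<mu>. (norm (u x))\<^sup>2)"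
proof -
  have "\<exists>C\<ge>0. \<forall>u\<in>bborel. (LINT x|\<mu>. (norm (\<Sum>i<n. of_real (coeff q i) * (T ^^ i) u x))\<^sup>2)
      \<le> C * (LINT x|\<mu>. (norm (u x))\<^sup>2)" for n
  proof (induction n)
    case 0
    then show ?case by (intro exI[of _ 0]) simp
  next
    case (Suc n)
    then obtain C where C: "C \<ge> 0" "\<And>u. u \<in> bborel \<Longrightarrow>
      (LINT x|\<mu>. (norm (\<Sum>i<n. of_real (coeff q i) * (T ^^ i) u x))\<^sup>2)
      \<le> C * (LINT x|\<mu>. (norm (u x))\<^sup>2)" by blast
    show ?case
    proof (intro exI[of _ "2 * C + 2 * (coeff q n)\<^sup>2"] conjI ballI)
      fix u assume u: "u \<in> bborel"
      have "(LINT x|\<mu>. (norm (\<Sum>i<Suc n. of_real (coeff q i) * (T ^^ i) u x))\<^sup>2) \<le>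
        2 * (LINT x|\<mu>. (norm (\<Sum>i<n. of_real (coeff q i) * (T ^^ i) u x))\<^sup>2)
        + 2 * (LINT x|\<mu>. (norm (of_real (coeff q n) * (T ^^ n) u x))\<^sup>2)"
        unfolding sum.lessThan_Suc by (intro l2_add_le bb_intros u)
      also have "(LINT x|\<mu>. (norm (of_real (coeff q n) * (T ^^ n) u x))\<^sup>2) =
          (coeff q n)\<^sup>2 * (LINT x|\<mu>. (norm ((T ^^ n) u x))\<^sup>2)"
        by (simp add: norm_mult power_mult_distrib)
      also have "2 * (LINT x|\<mu>. (norm (\<Sum>i<n. of_real (coeff q i) * (T ^^ i) u x))\<^sup>2)
          + 2 * \<dots> \<le> 2 * (C * (LINT x|\<mu>. (norm (u x))\<^sup>2))
          + 2 * ((coeff q n)\<^sup>2 * (LINT x|\<mu>. (norm (u x))\<^sup>2))"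
        by (intro add_mono mult_left_mono C Tpow_l2 u) auto
      finally show "(LINT x|\<mu>. (norm (\<Sum>i<Suc n. of_real (coeff q i) * (T ^^ i) u x))\<^sup>2)
        \<le> (2 * C + 2 * (coeff q n)\<^sup>2) * (LINT x|\<mu>. (norm (u x))\<^sup>2)"
        by (simp add: algebra_simps)
    qed (use C in auto)
  qed
  from this[of "Suc (degree q)"] show ?thesis by (simp add: poly_op_def lessThan_Suc_atMost)
qed

text \<open>The operator is diagonal in the characters with multipliers of modulus at most 1, so
  Parseval applies.\<close>

lemma poly_op_l2_trig:
  assumes q: "\<And>k. \<bar>poly q (\<phi> k)\<bar> \<le> 1" and p: "trig p"
  shows "(LINT x|\<mu>. (norm (poly_op q p x))\<^sup>2) \<le> (LINT x|\<mu>. (norm (p x))\<^sup>2)"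
proof -
  obtain S c where S: "finite S" and p_eq: "p = (\<lambda>x. \<Sum>k\<in>S. c k * circle_char k x)"
    using trig_expansion[OF p] by blast
  have "poly_op q (\<lambda>x. \<Sum>k\<in>S. c k * circle_char k x) =
      (\<lambda>x. \<Sum>k\<in>S. (c k * of_real (poly q (\<phi> k))) * circle_char k x)"
    using S
  proof induction
    case empty
    have "poly_op q (\<lambda>x. 0 * 0) = (\<lambda>x. 0 * poly_op q (\<lambda>_. 0) x)" by (rule poly_op_cmult)
    then show ?case by simp
  next
    case (insert k S)
    then show ?case
      by (simp add: poly_op_add poly_op_cmult poly_op_char bb_intros mult.assoc)
  qed
  then have "(LINT x|\<mu>. (norm (poly_op q p x))\<^sup>2) =
      2 * pi * (\<Sum>k\<in>S. (norm (c k * of_real (poly q (\<phi> k))))\<^sup>2)"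
    unfolding p_eq using parseval_trig[OF S] by simp
  also have "\<dots> \<le> 2 * pi * (\<Sum>k\<in>S. (norm (c k))\<^sup>2)"
  proof (intro mult_left_mono sum_mono power_mono)
    show "norm (c k * of_real (poly q (\<phi> k))) \<le> norm (c k)" for k
      using mult_left_le[OF q[of k], of "norm (c k)"] by (simp add: norm_mult)
  qed auto
  also have "\<dots> = (LINT x|\<mu>. (norm (p x))\<^sup>2)"
    unfolding p_eq by (rule parseval_trig[OF S, symmetric])
  finally show ?thesis .
qed

text \<open>The constant \<open>1\<close> would be sharp; \<open>4\<close> only costs the inequality \<open>\<bar>a + b\<bar>\<^sup>2 \<le> 2 \<bar>a\<bar>\<^sup>2 + 2 \<bar>b\<bar>\<^sup>2\<close>.
  What matters is that it does not depend on the polynomial.\<close>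

lemma poly_op_l2:
  assumes q: "\<And>k. \<bar>poly q (\<phi> k)\<bar> \<le> 1" and u: "u \<in> bborel"
  shows "(LINT x|\<mu>. (norm (poly_op q u x))\<^sup>2) \<le> 4 * (LINT x|\<mu>. (norm (u x))\<^sup>2)"
proof (rule field_le_epsilon)
  fix \<epsilon> :: real assume e: "\<epsilon> > 0"
  obtain C where C: "C \<ge> 0" "\<And>u. u \<in> bborel \<Longrightarrow>
    (LINT x|\<mu>. (norm (poly_op q u x))\<^sup>2) \<le> C * (LINT x|\<mu>. (norm (u x))\<^sup>2)"
    using poly_op_l2_bounded[of q] by blast
  \<comment> \<open>The term 4 \<delta> pays for the norm of \<open>p\<close> in place of that of
    \<open>u\<close>, the term with \<open>C\<close> for the operator applied to the
    difference.\<close>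
  define \<delta> where "\<delta> = \<epsilon> / (4 + 2 * C)"
  have d: "\<delta> > 0" "4 * \<delta> + 2 * (C * \<delta>) = \<epsilon>"
  proof -
    show "\<delta> > 0" using C e by (simp add: \<delta>_def)
    have "4 * \<delta> + 2 * (C * \<delta>) = (4 + 2 * C) * \<delta>" by (simp add: algebra_simps)
    also have "\<dots> = \<epsilon>" using C by (simp add: \<delta>_def)
    finally show "4 * \<delta> + 2 * (C * \<delta>) = \<epsilon>" .
  qed
  obtain p where p: "trig p" "l2dist u p < \<delta>" using trig_dense[OF u d(1)] by blast
  note bbp = bb_trig[OF p(1)]
  have "(LINT x|\<mu>. (norm (poly_op q u x))\<^sup>2) =
      (LINT x|\<mu>. (norm (poly_op q p x + poly_op q (\<lambda>x. u x - p x) x))\<^sup>2)"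
    by (simp add: poly_op_diff u bbp)
  also have "\<dots> \<le> 2 * (LINT x|\<mu>. (norm (poly_op q p x))\<^sup>2) +
      2 * (LINT x|\<mu>. (norm (poly_op q (\<lambda>x. u x - p x) x))\<^sup>2)"
    by (intro l2_add_le bb_intros u bbp)
  also have "\<dots> \<le> 2 * (LINT x|\<mu>. (norm (p x))\<^sup>2) + 2 * (C * \<delta>)"
  proof (intro add_mono mult_left_mono)
    show "(LINT x|\<mu>. (norm (poly_op q p x))\<^sup>2) \<le> (LINT x|\<mu>. (norm (p x))\<^sup>2)"
      by (rule poly_op_l2_trig[OF q p(1)])
    have "(LINT x|\<mu>. (norm (poly_op q (\<lambda>x. u x - p x) x))\<^sup>2) \<le> C * l2dist u p"
      unfolding l2dist_def by (intro C bb_intros u bbp)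
    also have "\<dots> \<le> C * \<delta>" using p(2) C by (intro mult_left_mono) auto
    finally show "(LINT x|\<mu>. (norm (poly_op q (\<lambda>x. u x - p x) x))\<^sup>2) \<le> C * \<delta>" .
  qed auto
  also have "(LINT x|\<mu>. (norm (p x))\<^sup>2) \<le> 2 * (LINT x|\<mu>. (norm (u x))\<^sup>2) + 2 * \<delta>"
  proof -
    have "(LINT x|\<mu>. (norm (u x + (p x - u x)))\<^sup>2) \<le> 2 * (LINT x|\<mu>. (norm (u x))\<^sup>2) +
      2 * (LINT x|\<mu>. (norm (p x - u x))\<^sup>2)"
      by (intro l2_add_le bb_intros u bbp)
    then show ?thesis using p(2) by (simp add: l2dist_def norm_minus_commute)
  qed
  finally show "(LINT x|\<mu>. (norm (poly_op q u x))\<^sup>2) \<le> 4 * (LINT x|\<mu>. (norm (u x))\<^sup>2) + \<epsilon>"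
    using d(2) by (simp add: algebra_simps)
qed

end

section \<open>Projections onto pairs of opposite frequencies\<close>

definition freq_proj :: "int \<Rightarrow> (circle \<Rightarrow> complex) \<Rightarrow> circle \<Rightarrow> complex" where
  "freq_proj l u x = (\<Sum>j\<in>{l, - l}. ncoeff u j * circle_char j x)"

lemma bb_freq_proj [bb_intros]: "freq_proj l u \<in> bborel"
  unfolding freq_proj_def[abs_def] by (intro bb_intros)

lemma freq_proj_add:
  "u \<in> bborel \<Longrightarrow> v \<in> bborel \<Longrightarrow>
    freq_proj l (\<lambda>x. u x + v x) = (\<lambda>x. freq_proj l u x + freq_proj l v x)"
  by (simp only: freq_proj_def[abs_def] ncoeff_add distrib_right sum.distrib)

lemma freq_proj_diff:
  "u \<in> bborel \<Longrightarrow> v \<in> bborel \<Longrightarrow>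
    freq_proj l (\<lambda>x. u x - v x) = (\<lambda>x. freq_proj l u x - freq_proj l v x)"
  by (simp only: freq_proj_def[abs_def] ncoeff_diff left_diff_distrib sum_subtractf)

lemma freq_proj_char:
  "freq_proj l (\<lambda>x. c * circle_char k x) = (\<lambda>x. (if k = l \<or> k = - l then c else 0) * circle_char k x)"
proof
  fix x
  have "freq_proj l (\<lambda>x. c * circle_char k x) x = (\<Sum>j\<in>{l, - l}. if j = k then c * circle_char k x else 0)"
    unfolding freq_proj_def by (rule sum.cong) (auto simp: ncoeff_cmult ncoeff_char)
  also have "\<dots> = (if k = l \<or> k = - l then c else 0) * circle_char k x"
    by (subst sum.delta) auto
  finally show "freq_proj l (\<lambda>x. c * circle_char k x) x = (if k = l \<or> k = - l then c else 0) * circle_char k x" .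
qed

text \<open>A crude bound through the supremum norm: two coefficients of size at most 4 \<epsilon>
  give at most 8 \<epsilon>, and the total mass 2 pi is below 8. Only independence of the constant
  from \<open>u\<close> matters.\<close>

lemma freq_proj_l2:
  assumes u: "u \<in> bborel" "\<epsilon> > 0" "(LINT x|\<mu>. (norm (u x))\<^sup>2) \<le> \<epsilon>\<^sup>2"
  shows "(LINT x|\<mu>. (norm (freq_proj l u x))\<^sup>2) \<le> 512 * \<epsilon>\<^sup>2"
proof -
  have ncoeff: "norm (ncoeff u j) \<le> 4 * \<epsilon>" for j
    using norm_ncoeff_le[OF u(1), of j] l1_le_l2[OF u] by simp
  have "norm (freq_proj l u x) \<le> 8 * \<epsilon>" for x
  proof -
    have "norm (freq_proj l u x) \<le> (\<Sum>j\<in>{l, - l}. norm (ncoeff u j * circle_char j x))"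
      unfolding freq_proj_def by (rule norm_sum)
    also have "\<dots> \<le> of_nat (card {l, - l}) * (4 * \<epsilon>)"
      by (intro sum_bounded_above) (simp add: norm_mult ncoeff)
    also have "\<dots> \<le> 2 * (4 * \<epsilon>)"
      using u(2) by (intro mult_right_mono) (auto simp: card_insert_if)
    finally show ?thesis by simp
  qed
  then have "(norm (freq_proj l u x))\<^sup>2 \<le> (8 * \<epsilon>)\<^sup>2" for x by (intro power_mono) auto
  then have "(LINT x|\<mu>. (norm (freq_proj l u x))\<^sup>2) \<le> (LINT x|\<mu>. (8 * \<epsilon>)\<^sup>2)"
    by (intro integral_mono bb_integrable_circle bb_intros) auto
  also have "\<dots> = 2 * pi * 64 * \<epsilon>\<^sup>2" by (simp add: power2_eq_square)
  also have "\<dots> \<le> 8 * 64 * \<epsilon>\<^sup>2"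
    using pi_less_4 by (intro mult_right_mono) auto
  finally show ?thesis by simp
qed

context circle_step begin

text \<open>Since \<open>\<phi>\<close> takes values in \<open>[-1, 1]\<close>, the base polynomial \<open>1 - (x - \<phi> l)\<^sup>2 / 4\<close> takes values in
  \<open>[0, 1]\<close> there and equals \<open>1\<close> only at \<open>\<phi> l\<close>, so its powers converge to an eigenprojection.\<close>

definition spec_poly :: "int \<Rightarrow> nat \<Rightarrow> real poly" where
  "spec_poly l n = [:1 - (\<phi> l)\<^sup>2 / 4, \<phi> l / 2, - 1 / 4:] ^ n"

lemma poly_spec_poly: "poly (spec_poly l n) x = (1 - (x - \<phi> l)\<^sup>2 / 4) ^ n"
proof -
  have "poly [:1 - (\<phi> l)\<^sup>2 / 4, \<phi> l / 2, - 1 / 4:] x = 1 - (x - \<phi> l)\<^sup>2 / 4"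
    by (simp add: power2_eq_square field_simps)
  then show ?thesis by (simp only: spec_poly_def poly_power)
qed

lemma spectral_base:
  "0 \<le> 1 - (\<phi> k - \<phi> l)\<^sup>2 / 4" "1 - (\<phi> k - \<phi> l)\<^sup>2 / 4 \<le> 1"
proof -
  have "\<bar>\<phi> k - \<phi> l\<bar> \<le> 2" using \<phi>_abs_le[of k] \<phi>_abs_le[of l] by linarith
  then have "\<bar>\<phi> k - \<phi> l\<bar>\<^sup>2 \<le> 2\<^sup>2" by (intro power_mono) auto
  then show "0 \<le> 1 - (\<phi> k - \<phi> l)\<^sup>2 / 4" by simp
qed simp

lemma spec_poly_le: "\<bar>poly (spec_poly l n) (\<phi> k)\<bar> \<le> 1"
  using spectral_base[of k l] by (simp add: poly_spec_poly power_le_one)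

lemma spec_poly_tendsto:
  "(\<lambda>n. poly (spec_poly l n) (\<phi> k)) \<longlonglongrightarrow> (if k = l \<or> k = - l then 1 else 0)"
proof (cases "k = l \<or> k = - l")
  case True
  then have "\<phi> k = \<phi> l" by (simp add: \<phi>_eq_iff)
  with True show ?thesis by (simp add: poly_spec_poly)
next
  case False
  then have "(\<phi> k - \<phi> l)\<^sup>2 > 0" by (simp add: \<phi>_eq_iff)
  then have "(\<lambda>n. (1 - (\<phi> k - \<phi> l)\<^sup>2 / 4) ^ n) \<longlonglongrightarrow> 0"
    using spectral_base[of k l] by (intro LIMSEQ_power_zero) (auto simp: abs_le_iff)
  with False show ?thesis by (simp add: poly_spec_poly)
qed

lemma spectral_limit_trig:
  assumes "trig p"
  shows "(\<lambda>n. l2dist (poly_op (spec_poly l n) p) (freq_proj l p)) \<longlonglongrightarrow> 0"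
  using assms
proof (induction rule: trig.induct)
  case (trig_char c k)
  define d where "d n = c * (of_real (poly (spec_poly l n) (\<phi> k)) - (if k = l \<or> k = - l then 1 else 0))" for n
  have "d \<longlonglongrightarrow> c * (of_real (if k = l \<or> k = - l then 1 else 0) - (if k = l \<or> k = - l then 1 else 0))"
    unfolding d_def by (intro tendsto_intros spec_poly_tendsto)
  then have "d \<longlonglongrightarrow> 0" by (simp split: if_splits)
  then have "(\<lambda>n. 2 * pi * (norm (d n))\<^sup>2) \<longlonglongrightarrow> 2 * pi * (norm (0::complex))\<^sup>2"
    by (intro tendsto_intros)
  moreover have "l2dist (poly_op (spec_poly l n) (\<lambda>x. c * circle_char k x)) (freq_proj l (\<lambda>x. c * circle_char k x))
      = 2 * pi * (norm (d n))\<^sup>2" for n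
  proof -
    have "poly_op (spec_poly l n) (\<lambda>x. c * circle_char k x) x - freq_proj l (\<lambda>x. c * circle_char k x) x =
      d n * circle_char k x" for x
      unfolding poly_op_cmult poly_op_char freq_proj_char d_def by (simp add: algebra_simps)
    then show ?thesis by (simp add: l2dist_def norm_mult)
  qed
  ultimately show ?case by simp
next
  case (trig_add p q)
  note bb = bb_trig[OF trig_add(1)] bb_trig[OF trig_add(2)]
  have "(\<lambda>n. 2 * l2dist (poly_op (spec_poly l n) p) (freq_proj l p)
      + 2 * l2dist (poly_op (spec_poly l n) q) (freq_proj l q)) \<longlonglongrightarrow> 2 * 0 + 2 * 0"
    by (intro tendsto_intros trig_add.IH)
  then have lim: "(\<lambda>n. 2 * l2dist (poly_op (spec_poly l n) p) (freq_proj l p)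
      + 2 * l2dist (poly_op (spec_poly l n) q) (freq_proj l q)) \<longlonglongrightarrow> 0" by simp
  show ?case
  proof (rule tendsto_sandwich[OF _ _ tendsto_const lim])
    have "l2dist (poly_op (spec_poly l n) (\<lambda>x. p x + q x)) (freq_proj l (\<lambda>x. p x + q x))
      \<le> 2 * l2dist (poly_op (spec_poly l n) p) (freq_proj l p)
      + 2 * l2dist (poly_op (spec_poly l n) q) (freq_proj l q)" for n
      using l2_add_le[of "\<lambda>x. poly_op (spec_poly l n) p x - freq_proj l p x"
          "\<lambda>x. poly_op (spec_poly l n) q x - freq_proj l q x"] bb
      by (simp add: l2dist_def poly_op_add freq_proj_add bb_intros algebra_simps)
    then show "\<forall>\<^sub>F n in sequentially. l2dist (poly_op (spec_poly l n) (\<lambda>x. p x + q x)) (freq_proj l (\<lambda>x. p x + q x))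
      \<le> 2 * l2dist (poly_op (spec_poly l n) p) (freq_proj l p)
      + 2 * l2dist (poly_op (spec_poly l n) q) (freq_proj l q)" by (rule always_eventually[OF allI])
  qed simp
qed

text \<open>The operators are bounded uniformly in \<open>n\<close> and converge on the dense class
  of trigonometric polynomials; hence they converge on every bounded Borel function.\<close>

lemma spectral_limit:
  assumes v: "v \<in> bborel" and e: "\<epsilon> > 0"
  shows "\<forall>\<^sub>F n in sequentially. l2dist (poly_op (spec_poly l n) v) (freq_proj l v) \<le> \<epsilon>\<^sup>2"
proof -
  \<comment> \<open>The errors add up to 2060 times the square of \<delta>; 4096, the square of 64,
    is a convenient larger number.\<close>
  define \<delta> where "\<delta> = \<epsilon> / 64"
  have d: "\<delta> > 0" using e by (simp add: \<delta>_def)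
  obtain p where p: "trig p" "l2dist v p < \<delta>\<^sup>2" using trig_dense[OF v, of "\<delta>\<^sup>2"] d by auto
  note bbp = bb_trig[OF p(1)]
  have "\<forall>\<^sub>F n in sequentially. l2dist (poly_op (spec_poly l n) p) (freq_proj l p) < \<delta>\<^sup>2"
    using order_tendstoD(2)[OF spectral_limit_trig[OF p(1)]] d by simp
  then show ?thesis
  proof eventually_elim
    case (elim n)
    let ?A = "poly_op (spec_poly l n)" and ?P = "freq_proj l"
    have 1: "l2dist (?A v) (?A p) \<le> 4 * \<delta>\<^sup>2"
    proof -
      have "l2dist (?A v) (?A p) = (LINT x|\<mu>. (norm (?A (\<lambda>x. v x - p x) x))\<^sup>2)"
        by (simp add: l2dist_def poly_op_diff v bbp)
      also have "\<dots> \<le> 4 * l2dist v p"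
        unfolding l2dist_def by (intro poly_op_l2 spec_poly_le bb_intros v bbp)
      finally show ?thesis using p(2) by simp
    qed
    have 2: "l2dist (?P p) (?P v) \<le> 512 * \<delta>\<^sup>2"
    proof -
      have "l2dist (?P p) (?P v) = (LINT x|\<mu>. (norm (?P (\<lambda>x. v x - p x) x))\<^sup>2)"
        by (simp add: l2dist_def freq_proj_diff v bbp norm_minus_commute)
      also have "\<dots> \<le> 512 * \<delta>\<^sup>2"
        using p(2) by (intro freq_proj_l2 bb_intros v bbp d) (simp add: l2dist_def)
      finally show ?thesis .
    qed
    have 3: "l2dist (?A v) (?P v) \<le> 2 * l2dist (?A v) (?A p) + 2 * l2dist (?A p) (?P v)"
      by (intro l2dist_triangle bb_intros v bbp)
    have "l2dist (?A p) (?P v) \<le> 2 * l2dist (?A p) (?P p) + 2 * l2dist (?P p) (?P v)"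
      by (intro l2dist_triangle bb_intros v bbp)
    then have "l2dist (?A v) (?P v) \<le> 4096 * \<delta>\<^sup>2"
      using elim 1 2 3 zero_le_power2[of \<delta>] by linarith
    also have "\<dots> = \<epsilon>\<^sup>2" by (simp add: \<delta>_def power2_eq_square)
    finally show ?case .
  qed
qed

text \<open>Quadratic convergence survives multiplication by the bounded \<open>f\<close> and is
  then read off in a single coefficient.\<close>

lemma ncoeff_spectral_limit:
  assumes f: "f \<in> bborel" and v: "v \<in> bborel"
  shows "(\<lambda>n. ncoeff (\<lambda>x. f x * poly_op (spec_poly l n) v x) j) \<longlonglongrightarrow> ncoeff (\<lambda>x. f x * freq_proj l v x) j"
proof (rule tendstoI)
  fix \<epsilon> :: real assume e: "\<epsilon> > 0"
  obtain B where B: "0 \<le> B" "\<And>x. norm (f x) \<le> B" and "f \<in> borel_measurable borel"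
    using bborelE[OF f] by blast
  define \<delta> where "\<delta> = \<epsilon> / (8 * (B + 1))"
  have d0: "\<delta> > 0" using e B by (simp add: \<delta>_def)
  then have "B * (4 * \<delta>) < 8 * (B + 1) * \<delta>" using B mult_nonneg_nonneg[of B \<delta>] by (simp add: algebra_simps del: mult_nonneg_nonneg)
  also have "\<dots> = \<epsilon>" using B by (simp add: \<delta>_def)
  finally have d: "\<delta> > 0" "B * (4 * \<delta>) < \<epsilon>" using d0 by auto
  show "\<forall>\<^sub>F n in sequentially.
    dist (ncoeff (\<lambda>x. f x * poly_op (spec_poly l n) v x) j) (ncoeff (\<lambda>x. f x * freq_proj l v x) j) < \<epsilon>"
    using spectral_limit[OF v d(1), of l]
  proof eventually_elim
    case (elim n)
    let ?w = "\<lambda>x. poly_op (spec_poly l n) v x - freq_proj l v x"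
    have w: "?w \<in> bborel" by (intro bb_intros v)
    have "dist (ncoeff (\<lambda>x. f x * poly_op (spec_poly l n) v x) j) (ncoeff (\<lambda>x. f x * freq_proj l v x) j)
      = norm (ncoeff (\<lambda>x. f x * ?w x) j)"
      by (simp add: dist_norm ncoeff_diff f v bb_intros right_diff_distrib)
    also have "\<dots> \<le> (LINT x|\<mu>. norm (f x * ?w x))"
      by (intro norm_ncoeff_le bb_mult f w)
    also have "\<dots> \<le> (LINT x|\<mu>. B * norm (?w x))"
      by (intro integral_mono bb_integrable_circle bb_mult f w integrable_mult_right)
         (simp add: norm_mult mult_right_mono B)
    also have "\<dots> = B * (LINT x|\<mu>. norm (?w x))" by simp
    also have "\<dots> \<le> B * (4 * \<delta>)"
      using elim by (intro mult_left_mono l1_le_l2 w d B) (simp add: l2dist_def)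
    also have "\<dots> < \<epsilon>" by (rule d)
    finally show ?case .
  qed
qed

end

section \<open>Words of operators and their Toeplitz sums\<close>

primrec op_word :: "(circle \<Rightarrow> complex) \<Rightarrow> ((circle \<Rightarrow> complex) \<Rightarrow> circle \<Rightarrow> complex) list \<Rightarrow>
    (circle \<Rightarrow> complex) \<Rightarrow> circle \<Rightarrow> complex" where
  "op_word f [] w = w"
| "op_word f (A # As) w = (\<lambda>x. f x * A (op_word f As w) x)"

text \<open>The innermost function is a separate argument of \<open>op_word\<close> so that a word
  can be cut at any slot.\<close>

lemma op_word_append: "op_word f (As @ Bs) w = op_word f As (op_word f Bs w)"
  by (induction As) auto

lemma bb_op_word:
  assumes "\<And>A u. A \<in> set As \<Longrightarrow> u \<in> bborel \<Longrightarrow> A u \<in> bborel"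
    and "f \<in> bborel" "w \<in> bborel"
  shows "op_word f As w \<in> bborel"
  using assms(1) by (induction As) (auto intro!: bb_mult assms(2,3))

lemma ncoeff_mult_freq_proj: "ncoeff (\<lambda>x. f x * freq_proj l u x) i = (\<Sum>j\<in>{l, - l}. ncoeff f (i - j) * ncoeff u j)"
  if "f \<in> bborel"
proof -
  have "ncoeff (\<lambda>x. f x * freq_proj l u x) i = ncoeff (\<lambda>x. \<Sum>j\<in>{l, - l}. ncoeff u j * (f x * circle_char j x)) i"
    by (simp only: freq_proj_def sum_distrib_left mult_ac)
  also have "\<dots> = (\<Sum>j\<in>{l, - l}. ncoeff (\<lambda>x. ncoeff u j * (f x * circle_char j x)) i)"
    by (intro ncoeff_sum bb_intros that)
  also have "\<dots> = (\<Sum>j\<in>{l, - l}. ncoeff f (i - j) * ncoeff u j)"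
    by (simp only: ncoeff_cmult ncoeff_mult_char mult.commute)
  finally show ?thesis .
qed

text \<open>Multiplication by f acts on coefficients by the Toeplitz matrix with entries
  \<open>a (i - j)\<close>. This is one entry of repeated products of that matrix with the sequence
  \<open>a\<close>, the intermediate indices being restricted to l and -l. The index set is a
  singleton for l = 0, so this frequency counts once.\<close>

primrec toeplitz :: "(int \<Rightarrow> complex) \<Rightarrow> int list \<Rightarrow> int \<Rightarrow> complex" where
  "toeplitz a [] i = a i"
| "toeplitz a (l # ls) i = (\<Sum>j\<in>{l, - l}. a (i - j) * toeplitz a ls j)"

lemma ncoeff_op_word_proj:
  assumes "f \<in> bborel"
  shows "ncoeff (op_word f (map freq_proj ls) f) i = toeplitz (ncoeff f) ls i"
  by (induction ls arbitrary: i) (simp_all only: list.map op_word.simps toeplitz.simps ncoeff_mult_freq_proj[OF assms])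

text \<open>Each projection has finite rank, so \<open>J\<close> and \<open>d\<close> can be chosen
  before \<open>w\<close>; this uniformity allows limits and finite sums to be taken in the slot of
  \<open>w\<close>.\<close>

lemma ncoeff_op_word_proj_linear:
  assumes "f \<in> bborel"
  shows "\<exists>J d. finite J \<and> (\<forall>w. ncoeff (op_word f (map freq_proj ls) w) i = (\<Sum>j\<in>J. d j * ncoeff w j))"
proof (induction ls arbitrary: i)
  case Nil
  show ?case by (intro exI[of _ "{i}"] exI[of _ "\<lambda>_. 1"]) simp
next
  case (Cons l ls)
  have "\<forall>j. \<exists>J d. finite J \<and> (\<forall>w. ncoeff (op_word f (map freq_proj ls) w) j = (\<Sum>j\<in>J. d j * ncoeff w j))"
    using Cons.IH by blast
  then obtain J d where J: "\<And>j. finite (J j)"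
    and eq: "\<And>j w. ncoeff (op_word f (map freq_proj ls) w) j = (\<Sum>k\<in>J j. d j k * ncoeff w k)" by metis
  define K where "K = (\<Union>j\<in>{l, - l}. J j)"
  define e where "e k = (\<Sum>j\<in>{l, - l}. ncoeff f (i - j) * (if k \<in> J j then d j k else 0))" for k
  have K: "finite K" using J by (simp add: K_def)
  have "ncoeff (op_word f (map freq_proj (l # ls)) w) i = (\<Sum>k\<in>K. e k * ncoeff w k)" for w
  proof -
    have "ncoeff (op_word f (map freq_proj (l # ls)) w) i = (\<Sum>j\<in>{l, - l}. ncoeff f (i - j) * (\<Sum>k\<in>J j. d j k * ncoeff w k))"
      by (simp only: list.map op_word.simps ncoeff_mult_freq_proj[OF assms] eq)
    also have "\<dots> = (\<Sum>j\<in>{l, - l}. ncoeff f (i - j) * (\<Sum>k\<in>K. (if k \<in> J j then d j k else 0) * ncoeff w k))"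
    proof (rule sum.cong[OF refl])
      fix j assume "j \<in> {l, - l}"
      then have "J j \<subseteq> K" by (auto simp: K_def)
      then have "(\<Sum>k\<in>J j. d j k * ncoeff w k) = (\<Sum>k\<in>K. (if k \<in> J j then d j k else 0) * ncoeff w k)"
        using K by (intro sum.mono_neutral_cong_left) auto
      then show "ncoeff f (i - j) * (\<Sum>k\<in>J j. d j k * ncoeff w k) =
        ncoeff f (i - j) * (\<Sum>k\<in>K. (if k \<in> J j then d j k else 0) * ncoeff w k)" by (rule arg_cong)
    qed
    also have "\<dots> = (\<Sum>k\<in>K. e k * ncoeff w k)"
      unfolding sum_distrib_left e_def sum_distrib_right mult.assoc by (rule sum.swap)
    finally show ?thesis .
  qed
  with K show ?case by blast
qed

context circle_step begin

abbreviation "Tpows ms \<equiv> map (\<lambda>m. T ^^ m) ms"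

lemma bb_Tword: "f \<in> bborel \<Longrightarrow> w \<in> bborel \<Longrightarrow> op_word f (Tpows ms) w \<in> bborel"
  by (rule bb_op_word) (auto intro: bb_Tpow)

text \<open>The slots of a word are converted one at a time: with the other slots fixed, a word with spectral
  projections in front depends on the remaining function through finitely many Fourier coefficients.\<close>

lemma same_statistics_proj:
  assumes f: "f \<in> bborel" and g: "g \<in> bborel"
    and eq: "\<And>ms. ncoeff (op_word f (Tpows ms) f) 0 = ncoeff (op_word g (Tpows ms) g) 0"
  shows "ncoeff (op_word f (map freq_proj ls @ Tpows ms) f) 0 = ncoeff (op_word g (map freq_proj ls @ Tpows ms) g) 0"
proof (induction ls arbitrary: ms rule: rev_induct)
  case Nil
  then show ?case using eq by simp
next
  \<comment> \<open>The new projection comes last among the projections: the slots before it are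
    already converted, the slots after it still carry powers of \<open>T\<close>.\<close>
  case (snoc l ls)
  define val where "val f = ncoeff (op_word f (map freq_proj (ls @ [l]) @ Tpows ms) f) 0" for f
  define approx where "approx f n = (\<Sum>i\<le>degree (spec_poly l n). of_real (coeff (spec_poly l n) i) *
      ncoeff (op_word f (map freq_proj ls @ Tpows (i # ms)) f) 0)" for f n
  have conv: "approx f \<longlonglongrightarrow> val f" if f: "f \<in> bborel" for f
  proof -
    define v where "v = op_word f (Tpows ms) f"
    have v: "v \<in> bborel" unfolding v_def by (intro bb_Tword f)
    obtain J d where J: "\<And>w. ncoeff (op_word f (map freq_proj ls) w) 0 = (\<Sum>j\<in>J. d j * ncoeff w j)"
      using ncoeff_op_word_proj_linear[OF f] by blast
    have "val f = (\<Sum>j\<in>J. d j * ncoeff (\<lambda>x. f x * freq_proj l v x) j)"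
      by (simp add: val_def op_word_append J v_def)
    moreover have "approx f n = (\<Sum>j\<in>J. d j * ncoeff (\<lambda>x. f x * poly_op (spec_poly l n) v x) j)" for n
    proof -
      have "ncoeff (\<lambda>x. f x * poly_op (spec_poly l n) v x) j =
        (\<Sum>i\<le>degree (spec_poly l n). of_real (coeff (spec_poly l n) i) * ncoeff (\<lambda>x. f x * (T ^^ i) v x) j)" for j
      proof -
        have "ncoeff (\<lambda>x. f x * poly_op (spec_poly l n) v x) j =
          ncoeff (\<lambda>x. \<Sum>i\<le>degree (spec_poly l n). of_real (coeff (spec_poly l n) i) * (f x * (T ^^ i) v x)) j"
          by (simp only: poly_op_def sum_distrib_left mult_ac)
        also have "\<dots> = (\<Sum>i\<le>degree (spec_poly l n). ncoeff (\<lambda>x. of_real (coeff (spec_poly l n) i) * (f x * (T ^^ i) v x)) j)"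
          by (intro ncoeff_sum bb_intros f v)
        finally show ?thesis by (simp only: ncoeff_cmult)
      qed
      then have "(\<Sum>j\<in>J. d j * ncoeff (\<lambda>x. f x * poly_op (spec_poly l n) v x) j) =
        (\<Sum>j\<in>J. \<Sum>i\<le>degree (spec_poly l n). of_real (coeff (spec_poly l n) i) * (d j * ncoeff (\<lambda>x. f x * (T ^^ i) v x) j))"
        by (simp only: sum_distrib_left mult_ac)
      also have "\<dots> = (\<Sum>i\<le>degree (spec_poly l n). of_real (coeff (spec_poly l n) i) * (\<Sum>j\<in>J. d j * ncoeff (\<lambda>x. f x * (T ^^ i) v x) j))"
        by (subst sum.swap) (simp only: sum_distrib_left)
      also have "\<dots> = approx f n"
        by (simp add: approx_def op_word_append J v_def)
      finally show ?thesis by simp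
    qed
    moreover have "(\<lambda>n. \<Sum>j\<in>J. d j * ncoeff (\<lambda>x. f x * poly_op (spec_poly l n) v x) j) \<longlonglongrightarrow>
        (\<Sum>j\<in>J. d j * ncoeff (\<lambda>x. f x * freq_proj l v x) j)"
      by (intro tendsto_intros ncoeff_spectral_limit f v)
    ultimately show ?thesis by presburger
  qed
  \<comment> \<open>The coefficients of the polynomial depend on \<phi> alone, so both sides are the
    same combination of quantities equated by the induction hypothesis.\<close>
  have "approx f = approx g"
    unfolding approx_def by (intro ext sum.cong refl arg_cong2[where f="(*)"] snoc.IH)
  then have "approx f \<longlonglongrightarrow> val g" using conv[OF g] by simp
  with conv[OF f] have "val f = val g" by (rule LIMSEQ_unique)
  then show ?case by (simp add: val_def)
qed

lemma same_statistics_toeplitz: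
  assumes "f \<in> bborel" "g \<in> bborel"
    and "\<And>ms. ncoeff (op_word f (Tpows ms) f) 0 = ncoeff (op_word g (Tpows ms) g) 0"
  shows "toeplitz (ncoeff f) ls 0 = toeplitz (ncoeff g) ls 0"
  using same_statistics_proj[OF assms, of ls "[]"] assms by (simp add: ncoeff_op_word_proj)

end

section \<open>Coefficients determined up to a phase and conjugation\<close>

definition hermitian :: "(int \<Rightarrow> complex) \<Rightarrow> bool" where
  "hermitian a \<longleftrightarrow> (\<forall>k. a (- k) = cnj (a k))"

lemma hermitianD: "hermitian a \<Longrightarrow> a (- k) = cnj (a k)"
  by (simp add: hermitian_def)

text \<open>Negating all intermediate indices permutes the sign choices and conjugates every
  factor.\<close>

lemma toeplitz_uminus:
  assumes "hermitian a"
  shows "toeplitz a ls (- i) = cnj (toeplitz a ls i)"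
proof (induction ls arbitrary: i)
  case (Cons l ls)
  have "toeplitz a (l # ls) (- i) = (\<Sum>j\<in>uminus ` {l, - l}. a (- i - j) * toeplitz a ls j)"
    by (simp add: insert_commute)
  also have "\<dots> = (\<Sum>j\<in>{l, - l}. a (- i - (- j)) * toeplitz a ls (- j))"
    by (subst sum.reindex) (auto simp only: inj_on_def o_def neg_equal_iff_equal)
  also have "\<dots> = (\<Sum>j\<in>{l, - l}. cnj (a (i - j) * toeplitz a ls j))"
  proof (intro sum.cong refl)
    fix j
    have "a (- i - - j) = cnj (a (i - j))" using hermitianD[OF assms, of "i - j"] by simp
    then show "a (- i - - j) * toeplitz a ls (- j) = cnj (a (i - j) * toeplitz a ls j)"
      by (simp add: Cons.IH)
  qed
  also have "\<dots> = cnj (toeplitz a (l # ls) i)"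
    by (simp only: toeplitz.simps cnj_sum)
  finally show ?case .
qed (simp add: assms hermitianD)

lemma toeplitz_Cons_pos:
  assumes "hermitian a" "l > 0"
  shows "toeplitz a (l # ls) i = a (i - l) * toeplitz a ls l + a (i + l) * cnj (toeplitz a ls l)"
  using assms(2) by (simp add: toeplitz_uminus[OF assms(1)])

text \<open>The differences of consecutive levels, read from \<open>N + sum_list ks\<close> to
  \<open>N\<close>, are the entries of \<open>ks\<close>. With all signs positive the Toeplitz
  factors are therefore the values \<open>a k\<close>, followed by \<open>a N\<close>.\<close>

primrec level_word :: "int \<Rightarrow> int list \<Rightarrow> int list" where
  "level_word N [] = []"
| "level_word N (k # ks) = (N + sum_list ks) # level_word N ks"

context
  fixes a :: "int \<Rightarrow> complex" and N :: "nat \<Rightarrow> int"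
  assumes herm: "hermitian a"
    and a_lim: "(a \<longlongrightarrow> 0) at_top"
    and N_lim: "filterlim N at_top sequentially"
    and a_N: "\<And>n. a (N n) \<noteq> 0"
begin

text \<open>Division by \<open>a N\<close> removes the innermost factor. In each slot the opposite
  sign contributes a coefficient near frequency 2 N times a quantity of the same modulus as the
  convergent ratio, so it disappears.\<close>

lemma toeplitz_tendsto:
  "(\<lambda>n. toeplitz a (level_word (N n) ks) (N n + sum_list ks) / a (N n)) \<longlonglongrightarrow> prod_list (map a ks)"
proof (induction ks)
  case Nil
  show ?case by (simp add: a_N)
next
  case (Cons k ks)
  define s where "s = sum_list ks"
  define R where "R n = toeplitz a (level_word (N n) ks) (N n + s) / a (N n)" for n
  have R: "R \<longlonglongrightarrow> prod_list (map a ks)" unfolding R_def s_def by (rule Cons.IH)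
  define E where "E n = a (2 * N n + (k + 2 * s)) * cnj (toeplitz a (level_word (N n) ks) (N n + s)) / a (N n)" for n
  have "filterlim (\<lambda>n. 2 * N n + (k + 2 * s)) at_top sequentially"
  proof (subst filterlim_at_top, intro allI)
    fix Z :: int
    have "\<forall>\<^sub>F n in sequentially. N n \<ge> max 0 (\<bar>Z\<bar> + \<bar>k\<bar> + 2 * \<bar>s\<bar>)"
      using N_lim unfolding filterlim_at_top by blast
    then show "\<forall>\<^sub>F n in sequentially. Z \<le> 2 * N n + (k + 2 * s)"
      by eventually_elim linarith
  qed
  from filterlim_compose[OF a_lim this]
  have a0: "(\<lambda>n. a (2 * N n + (k + 2 * s))) \<longlonglongrightarrow> 0" .
  have "(\<lambda>n. norm (E n)) \<longlonglongrightarrow> 0"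
  proof -
    have "(\<lambda>n. norm (a (2 * N n + (k + 2 * s))) * norm (R n)) \<longlonglongrightarrow> norm (0::complex) * norm (prod_list (map a ks))"
      by (intro tendsto_intros a0 R)
    moreover have "norm (E n) = norm (a (2 * N n + (k + 2 * s))) * norm (R n)" for n
      by (simp add: E_def R_def norm_mult norm_divide)
    ultimately show ?thesis by simp
  qed
  then have "E \<longlonglongrightarrow> 0" by (rule tendsto_norm_zero_cancel)
  then have "(\<lambda>n. a k * R n + E n) \<longlonglongrightarrow> a k * prod_list (map a ks) + 0"
    by (intro tendsto_intros R)
  moreover have "\<forall>\<^sub>F n in sequentially. a k * R n + E n =
    toeplitz a (level_word (N n) (k # ks)) (N n + sum_list (k # ks)) / a (N n)"
  proof -
    have "\<forall>\<^sub>F n in sequentially. N n \<ge> 1 + \<bar>s\<bar>"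
      using N_lim unfolding filterlim_at_top by blast
    then show ?thesis
    proof eventually_elim
      case (elim n)
      then have pos: "N n + s > 0" by linarith
      show ?case
        using toeplitz_Cons_pos[OF herm pos, of "level_word (N n) ks" "N n + (k + s)"]
        by (simp add: s_def[symmetric] R_def E_def add_divide_distrib algebra_simps)
    qed
  qed
  ultimately show ?case by (auto elim: Lim_transform_eventually)
qed

text \<open>Starting and ending a word at a high frequency \<open>N\<close> suppresses all sign patterns except the two
  constant ones, because a sign change costs a coefficient of frequency about \<open>2 N\<close>.\<close>

lemma toeplitz_0_tendsto:
  assumes "sum_list ks = 0"
  shows "(\<lambda>n. Re (toeplitz a (N n # level_word (N n) ks) 0) / (2 * (norm (a (N n)))\<^sup>2)) \<longlonglongrightarrow> Re (prod_list (map a ks))"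
proof -
  define W where "W n = toeplitz a (level_word (N n) ks) (N n)" for n
  have "(\<lambda>n. Re (W n / a (N n))) \<longlonglongrightarrow> Re (prod_list (map a ks))"
    using tendsto_Re[OF toeplitz_tendsto[of ks]] assms by (simp add: W_def)
  moreover have "\<forall>\<^sub>F n in sequentially. Re (W n / a (N n)) =
    Re (toeplitz a (N n # level_word (N n) ks) 0) / (2 * (norm (a (N n)))\<^sup>2)"
  proof -
    have "\<forall>\<^sub>F n in sequentially. N n \<ge> 1"
      using N_lim unfolding filterlim_at_top by blast
    then show ?thesis
    proof eventually_elim
      case (elim n)
      \<comment> \<open>The terms of the first slot at \<open>N n\<close> and at its negative are
        conjugate to each other; this is why only real parts are recovered.\<close>
      then have "toeplitz a (N n # level_word (N n) ks) 0 = cnj (a (N n)) * W n + a (N n) * cnj (W n)"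
        using toeplitz_Cons_pos[OF herm, of "N n" "level_word (N n) ks" 0] by (simp add: hermitianD[OF herm] W_def)
      then have "Re (toeplitz a (N n # level_word (N n) ks) 0) = 2 * Re (W n * cnj (a (N n)))"
        by simp
      also have "W n * cnj (a (N n)) = W n / a (N n) * of_real ((norm (a (N n)))\<^sup>2)"
        unfolding complex_norm_square using a_N[of n] by simp
      also have "Re \<dots> = Re (W n / a (N n)) * (norm (a (N n)))\<^sup>2"
        by (simp only: times_complex.sel Re_complex_of_real Im_complex_of_real mult_zero_right diff_zero)
      finally show ?case using a_N[of n] by simp
    qed
  qed
  ultimately show ?thesis by (rule Lim_transform_eventually)
qed

end

text \<open>A one-letter word at k > 0 yields twice the squared modulus of \<open>a k\<close>; the
  empty word covers k = 0.\<close>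

lemma same_toeplitz_norm:
  assumes "hermitian a" "hermitian b"
    and eq: "\<And>ls. toeplitz a ls 0 = toeplitz b ls 0"
  shows "norm (a k) = norm (b k)"
proof -
  have pos: "norm (a k) = norm (b k)" if k: "k > 0" for k
  proof -
    have *: "toeplitz c [k] 0 = of_real (2 * (norm (c k))\<^sup>2)" if "hermitian c" for c
      using k by (simp add: hermitianD[OF that] complex_norm_square[symmetric] mult.commute[of "cnj _"])
    from eq[of "[k]"] show ?thesis
      unfolding *[of a, OF assms(1)] *[of b, OF assms(2)] of_real_eq_iff by simp
  qed
  consider "k > 0" | "k = 0" | "- k > 0" by linarith
  then show ?thesis
  proof cases
    case 2 then show ?thesis using eq[of "[]"] by simp
  next
    case 3 then show ?thesis using pos[of "- k"] assms by (simp add: hermitianD)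
  qed (rule pos)
qed

text \<open>Both limits are taken along the same frequencies \<open>N n\<close>, with the same
  denominators because the moduli agree.\<close>

lemma same_toeplitz_Re_prod:
  assumes herm: "hermitian a" "hermitian b"
    and eq: "\<And>ls. toeplitz a ls 0 = toeplitz b ls 0"
    and lim: "(a \<longlongrightarrow> 0) at_top" "(b \<longlongrightarrow> 0) at_top"
    and inf: "\<And>N. \<exists>k\<ge>N. a k \<noteq> 0"
    and ks: "sum_list ks = 0"
  shows "Re (prod_list (map a ks)) = Re (prod_list (map b ks))"
proof -
  have nm: "norm (a k) = norm (b k)" for k by (rule same_toeplitz_norm[OF herm eq])
  have "\<forall>n::nat. \<exists>k\<ge>int n. a k \<noteq> 0" using inf by blast
  then obtain N where N: "\<And>n. N n \<ge> int n" "\<And>n. a (N n) \<noteq> 0" by metis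
  have N_lim: "filterlim N at_top sequentially"
    by (rule filterlim_at_top_mono[OF filterlim_int_sequentially]) (simp add: N always_eventually)
  have bN: "b (N n) \<noteq> 0" for n using N(2)[of n] nm[of "N n"] by auto
  show ?thesis
    using toeplitz_0_tendsto[OF herm(1) lim(1) N_lim N(2) ks]
      toeplitz_0_tendsto[OF herm(2) lim(2) N_lim bN ks]
    unfolding eq nm by (rule LIMSEQ_unique)
qed

section \<open>Recovering the phases\<close>

lemma prod_list_map_cnj: "prod_list (map (\<lambda>k. cnj (a k)) ks) = cnj (prod_list (map a ks))"
  by (induction ks) auto

lemma norm_prod_list_map: "norm (prod_list (map a ks)) = prod_list (map (\<lambda>k. norm (a k :: complex)) ks)"
  by (induction ks) (auto simp: norm_mult)

text \<open>The quotients b k / a k extend to a homomorphism from the subgroup of the integers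
  generated by the support of \<open>a\<close> to the unit circle. That subgroup is cyclic, so the
  homomorphism is the restriction of a character of the integers.\<close>

lemma phase_character:
  assumes herm: "hermitian a" "hermitian b"
    and nm: "\<And>k. norm (a k) = norm (b k)"
    and eq: "\<And>ks. sum_list ks = 0 \<Longrightarrow> prod_list (map a ks) = prod_list (map b ks)"
  shows "\<exists>\<theta>. \<forall>k. b k = a k * cis (of_int k * \<theta>)"
proof -
  \<comment> \<open>The graph of that homomorphism. Equality of products over zero-sum lists makes
    it single-valued, and hermitian symmetry provides inverses.\<close>
  define G where "G n z \<longleftrightarrow> (\<exists>ks. (\<forall>k\<in>set ks. a k \<noteq> 0) \<and> sum_list ks = n \<and>
      z = prod_list (map b ks) / prod_list (map a ks))" for n z
  have nm_prod: "norm (prod_list (map a ks)) = norm (prod_list (map b ks))" for ks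
    by (simp add: norm_prod_list_map nm)
  have nz: "prod_list (map a ks) \<noteq> 0" if "\<forall>k\<in>set ks. a k \<noteq> 0" for ks
    using that by (induction ks) auto
  have G0: "G 0 1" unfolding G_def by (intro exI[of _ "[]"]) simp
  have G_add: "G (n + m) (z * w)" if "G n z" "G m w" for n m z w
  proof -
    from that obtain ks ls where "\<forall>k\<in>set ks. a k \<noteq> 0" "sum_list ks = n" "z = prod_list (map b ks) / prod_list (map a ks)"
      "\<forall>k\<in>set ls. a k \<noteq> 0" "sum_list ls = m" "w = prod_list (map b ls) / prod_list (map a ls)"
      by (auto simp: G_def)
    then show ?thesis unfolding G_def by (intro exI[of _ "ks @ ls"]) auto
  qed
  have G_norm: "norm z = 1" if "G n z" for n z
  proof -
    from that obtain ks where "\<forall>k\<in>set ks. a k \<noteq> 0" "z = prod_list (map b ks) / prod_list (map a ks)"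
      by (auto simp: G_def)
    moreover from this have "norm (prod_list (map a ks)) \<noteq> 0" using nz[of ks] by simp
    ultimately show ?thesis using nm_prod[of ks] by (simp add: norm_divide del: norm_eq_zero)
  qed
  have G_uminus: "G (- n) (cnj z)" if "G n z" for n z
  proof -
    from that obtain ks where "\<forall>k\<in>set ks. a k \<noteq> 0" "sum_list ks = n" "z = prod_list (map b ks) / prod_list (map a ks)"
      by (auto simp: G_def)
    then show ?thesis unfolding G_def
      using uminus_sum_list_map[of id ks]
      by (intro exI[of _ "map uminus ks"]) (auto simp: herm[THEN hermitianD] o_def prod_list_map_cnj id_def)
  qed
  have G_0_unique: "z = 1" if "G 0 z" for z
  proof -
    from that obtain ks where "\<forall>k\<in>set ks. a k \<noteq> 0" "sum_list ks = 0" "z = prod_list (map b ks) / prod_list (map a ks)"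
      by (auto simp: G_def)
    then show ?thesis using nz[of ks] eq[of ks] by simp
  qed
  have G_unique: "z = w" if "G n z" "G n w" for n z w
  proof -
    have "z * cnj w = 1" using G_0_unique[of "z * cnj w"] G_add[OF that(1) G_uminus[OF that(2)]] by simp
    moreover have "w * cnj w = 1" using G_norm[OF that(2)] by (simp add: complex_norm_square[symmetric])
    ultimately show ?thesis by (metis mult_cancel_right mult_zero_right zero_neq_one)
  qed
  have G_single: "G k (b k / a k)" if "a k \<noteq> 0" for k
    unfolding G_def using that by (intro exI[of _ "[k]"]) auto
  have G_mult: "G (q * n) (cis (of_int q * t))" if "G n (cis t)" for n t q
  proof (induction q rule: int_induct[of _ 0])
    case base
    show ?case using G0 by simp
  next
    case (step1 i)
    then show ?case using G_add[OF _ that] by (force simp: algebra_simps cis_mult)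
  next
    case (step2 i)
    then show ?case using G_add[OF _ G_uminus[OF that]] by (force simp: algebra_simps cis_mult cis_cnj)
  qed
  show ?thesis
  proof (cases "\<exists>k. k > 0 \<and> a k \<noteq> 0")
    case False
    have a0: "a k = 0" if "k \<noteq> 0" for k
    proof (cases "k > 0")
      case True
      with False show ?thesis by blast
    next
      case False
      with that \<open>\<nexists>k. 0 < k \<and> a k \<noteq> 0\<close> have "a (- k) = 0" by force
      then show ?thesis using hermitianD[OF herm(1), of k] by simp
    qed
    have "b k = a k" for k
    proof (cases "k = 0")
      case True then show ?thesis using eq[of "[0]"] by simp
    next
      case False then show ?thesis using a0 nm[of k] by simp
    qed
    then show ?thesis by (intro exI[of _ 0]) simp
  next
    case True
    then have "\<exists>m::nat. m > 0 \<and> (\<exists>z. G (int m) z)"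
      using G_single by (metis zero_less_nat_eq int_nat_eq order_less_imp_le)
    note ex = this
    \<comment> \<open>The least positive element of the domain of \<open>G\<close>, hence its
      generator: a nonzero remainder modulo \<open>d\<close> would be a smaller one.\<close>
    define d where "d = (LEAST m::nat. m > 0 \<and> (\<exists>z. G (int m) z))"
    have d: "d > 0" "\<exists>z. G (int d) z" using LeastI_ex[OF ex] by (auto simp: d_def)
    have least: "\<not> m < d" if "m > 0" "G (int m) z" for m z
      using Least_le[of "\<lambda>m. m > 0 \<and> (\<exists>z. G (int m) z)" m] that by (auto simp: d_def not_less)
    from d(2) obtain z where z: "G (int d) z" by blast
    define t where "t = Arg z"
    have zt: "z = cis t" using G_norm[OF z] cis_Arg[of z] by (cases "z = 0") (auto simp: t_def sgn_eq)
    \<comment> \<open>Dividing the angle by \<open>d\<close> selects one of the \<open>d\<close>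
      extensions from the multiples of \<open>d\<close> to all integers; on the support they
      agree.\<close>
    have "b k = a k * cis (of_int k * (t / d))" for k
    proof (cases "a k = 0")
      case True then show ?thesis using nm[of k] by simp
    next
      case False
      define q where "q = k div int d"
      have "G (k + - (q * int d)) (b k / a k * cnj (cis (of_int q * t)))"
        by (intro G_add G_uminus G_mult G_single False) (use z zt in simp)
      then have "G (int (nat (k mod int d))) (b k / a k * cnj (cis (of_int q * t)))"
        using d(1) by (simp add: q_def minus_div_mult_eq_mod)
      then have "\<not> nat (k mod int d) > 0"
        using least[of "nat (k mod int d)"] d(1) pos_mod_bound[of "int d" k] pos_mod_sign[of "int d" k]
        by (auto simp: nat_less_iff)
      then have "k mod int d = 0" using pos_mod_sign[of "int d" k] d(1) by linarith
      then have k: "k = q * int d" by (auto simp: q_def)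
      have "G k (cis (of_int q * t))" using G_mult[of "int d" t q] z zt k by simp
      from G_unique[OF G_single[OF False] this] have "b k = a k * cis (of_int q * t)"
        using False by (simp add: field_simps)
      moreover have "of_int q * t = of_int k * (t / d)" using d(1) by (simp add: k)
      ultimately show ?thesis by simp
    qed
    then show ?thesis by blast
  qed
qed

text \<open>Real part and modulus fix each product up to conjugation. The choice is uniform: if
  \<open>v\<close> refuses equality and \<open>w\<close> refuses conjugation, their products are not
  real, and neither choice works for \<open>v @ w\<close>.\<close>

lemma phase_or_conjugate_phase:
  assumes herm: "hermitian a" "hermitian b"
    and nm: "\<And>k. norm (a k) = norm (b k)"
    and Re_eq: "\<And>ks. sum_list ks = 0 \<Longrightarrow> Re (prod_list (map a ks)) = Re (prod_list (map b ks))"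
  shows "\<exists>\<theta>. (\<forall>k. b k = a k * cis (of_int k * \<theta>)) \<or> (\<forall>k. b k = a (- k) * cis (of_int k * \<theta>))"
proof -
  let ?A = "\<lambda>ks. prod_list (map a ks)" and ?B = "\<lambda>ks. prod_list (map b ks)"
  have alt: "?B ks = ?A ks \<or> ?B ks = cnj (?A ks)" if "sum_list ks = 0" for ks
  proof -
    have "norm (?A ks) = norm (?B ks)" by (simp add: norm_prod_list_map nm)
    then have "(Im (?A ks))\<^sup>2 = (Im (?B ks))\<^sup>2"
      using Re_eq[OF that] by (simp add: cmod_def)
    then have "Im (?A ks) = Im (?B ks) \<or> Im (?A ks) = - Im (?B ks)" by (simp add: power2_eq_iff)
    then show ?thesis using Re_eq[OF that] by (auto simp: complex_eq_iff)
  qed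
  have "(\<forall>ks. sum_list ks = 0 \<longrightarrow> ?A ks = ?B ks) \<or> (\<forall>ks. sum_list ks = 0 \<longrightarrow> cnj (?A ks) = ?B ks)"
  proof (rule ccontr)
    assume "\<not> ?thesis"
    then obtain v w where v: "sum_list v = 0" "?B v \<noteq> ?A v" and w: "sum_list w = 0" "?B w \<noteq> cnj (?A w)"
      by metis
    have "?B v = cnj (?A v)" "?B w = ?A w" using alt v w by auto
    moreover have "?B (v @ w) = ?A (v @ w) \<or> ?B (v @ w) = cnj (?A (v @ w))" using v w by (intro alt) simp
    ultimately show False using v w by auto
  qed
  then show ?thesis
  proof
    assume "\<forall>ks. sum_list ks = 0 \<longrightarrow> ?A ks = ?B ks"
    then show ?thesis using phase_character[of a b] herm nm by blast
  next
    assume *: "\<forall>ks. sum_list ks = 0 \<longrightarrow> cnj (?A ks) = ?B ks"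
    have "\<exists>\<theta>. \<forall>k. b k = cnj (a k) * cis (of_int k * \<theta>)"
      using * herm nm by (intro phase_character) (auto simp: hermitian_def prod_list_map_cnj)
    then show ?thesis unfolding hermitianD[OF herm(1)] by blast
  qed
qed

section \<open>From coefficients back to functions\<close>

lemma ncoeff_cong_AE:
  assumes "u \<in> bborel" "v \<in> bborel" "AE x in \<mu>. u x = v x"
  shows "ncoeff u k = ncoeff v k"
proof -
  have [measurable]: "u \<in> borel_measurable borel" "v \<in> borel_measurable borel"
    using assms by (auto intro: bborel_measurable)
  show ?thesis unfolding ncoeff_eq
    by (intro arg_cong2[where f="(/)"] integral_cong_AE refl) (use assms(3) in auto)
qed

text \<open>A trigonometric polynomial of degree \<open>K > 0\<close> is not idempotent; its square has degree \<open>2 K\<close>.\<close>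

lemma idempotent_coefficients:
  assumes f: "f \<in> bborel" and idem: "\<And>x. f x * f x = f x" and herm: "hermitian (ncoeff f)"
    and N: "\<And>k. k \<ge> N \<Longrightarrow> ncoeff f k = 0"
  shows "\<forall>k. k \<noteq> 0 \<longrightarrow> ncoeff f k = 0"
proof -
  have pos: "ncoeff f k = 0" if "k > 0" for k
  proof (rule ccontr)
    assume "ncoeff f k \<noteq> 0"
    define S where "S = {j. 0 < j \<and> ncoeff f j \<noteq> 0}"
    have "S \<subseteq> {0<..<N}"
    proof
      fix j assume "j \<in> S"
      then show "j \<in> {0<..<N}" using N[of j] by (cases "N \<le> j") (auto simp: S_def)
    qed
    then have finS: "finite S" by (rule finite_subset) simp
    define K where "K = Max S"
    have neS: "S \<noteq> {}" using that \<open>ncoeff f k \<noteq> 0\<close> by (auto simp: S_def)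
    have K: "K > 0" "ncoeff f K \<noteq> 0" using Max_in[OF finS neS] by (auto simp: K_def S_def)
    have gt: "ncoeff f j = 0" if "j > K" for j
      using Max_ge[OF finS, of j] that K by (force simp: K_def S_def)
    have lt: "ncoeff f j = 0" if "j < - K" for j
      using gt[of "- j"] hermitianD[OF herm, of j] that by simp
    define p where "p x = (\<Sum>j\<in>{- K..K}. ncoeff f j * circle_char j x)" for x
    have p: "p \<in> bborel" unfolding p_def by (intro bb_intros)
    have "AE x in \<mu>. f x = p x"
    proof (rule ncoeff_uniqueness[OF f p])
      fix j
      have "ncoeff p j = (\<Sum>i\<in>{- K..K}. ncoeff f i * (if j = i then 1 else 0))"
        unfolding p_def by (subst ncoeff_sum) (auto simp only: ncoeff_cmult ncoeff_char intro!: bb_intros)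
      also have "\<dots> = (\<Sum>i\<in>{- K..K}. if j = i then ncoeff f i else 0)" by (intro sum.cong) auto
      also have "\<dots> = ncoeff f j" using gt[of j] lt[of j] by (subst sum.delta') auto
      finally show "ncoeff f j = ncoeff p j" by simp
    qed
    then have ae: "AE x in \<mu>. f x = f x * p x"
      by eventually_elim (metis idem)
    have "ncoeff f (2 * K) = ncoeff (\<lambda>x. f x * p x) (2 * K)"
      by (intro ncoeff_cong_AE f p bb_intros ae)
    also have "\<dots> = ncoeff (\<lambda>x. \<Sum>j\<in>{- K..K}. ncoeff f j * (f x * circle_char j x)) (2 * K)"
      by (simp add: p_def sum_distrib_left mult_ac)
    also have "\<dots> = (\<Sum>j\<in>{- K..K}. ncoeff f j * ncoeff f (2 * K - j))"
      by (subst ncoeff_sum) (auto simp only: ncoeff_cmult ncoeff_mult_char intro!: bb_intros f)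
    also have "\<dots> = (\<Sum>j\<in>{- K..K}. if K = j then ncoeff f K * ncoeff f K else 0)"
      using gt by (intro sum.cong) auto
    also have "\<dots> = ncoeff f K * ncoeff f K" using K by (subst sum.delta') auto
    finally show False using K gt[of "2 * K"] by simp
  qed
  show ?thesis
  proof (intro allI impI)
    fix k :: int assume "k \<noteq> 0"
    then consider "k > 0" | "- k > 0" by linarith
    then show "ncoeff f k = 0"
    proof cases
      case 2 then show ?thesis using pos[OF 2] hermitianD[OF herm, of k] by simp
    qed (rule pos)
  qed
qed

lemma same_toeplitz_congruent:
  assumes f: "f \<in> bborel" "\<And>x. f x * f x = f x" "\<And>x. cnj (f x) = f x"
    and g: "g \<in> bborel" "\<And>x. cnj (g x) = g x"
    and eq: "\<And>ls. toeplitz (ncoeff f) ls 0 = toeplitz (ncoeff g) ls 0"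
  shows "\<exists>\<theta>. (AE x in \<mu>. g x = f (x + \<theta>)) \<or> (AE x in \<mu>. g x = f (- x + \<theta>))"
proof -
  have herm: "hermitian (ncoeff f)" "hermitian (ncoeff g)"
    using ncoeff_uminus_index f(3) g(2) by (auto simp: hermitian_def)
  have nm: "norm (ncoeff f k) = norm (ncoeff g k)" for k by (rule same_toeplitz_norm[OF herm eq])
  have "\<exists>\<theta>. (\<forall>k. ncoeff g k = ncoeff f k * cis (of_int k * \<theta>)) \<or> (\<forall>k. ncoeff g k = ncoeff f (- k) * cis (of_int k * \<theta>))"
  proof (cases "\<forall>N. \<exists>k\<ge>N. ncoeff f k \<noteq> 0")
    case True
    then show ?thesis
      by (intro phase_or_conjugate_phase herm nm same_toeplitz_Re_prod eq riemann_lebesgue f g) auto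
  next
    case False
    \<comment> \<open>Here f is constant almost everywhere, and equal moduli together with the empty
      word settle g without any phases.\<close>
    then obtain N where "\<And>k. k \<ge> N \<Longrightarrow> ncoeff f k = 0" by auto
    from idempotent_coefficients[OF f(1,2) herm(1) this]
    have z: "ncoeff f k = 0" if "k \<noteq> 0" for k using that by blast
    have "ncoeff g k = ncoeff f k" for k
    proof (cases "k = 0")
      case True then show ?thesis using eq[of "[]"] by simp
    next
      case False then show ?thesis using z nm[of k] by simp
    qed
    then show ?thesis by (intro exI[of _ 0]) simp
  qed
  then obtain \<theta> where th: "(\<forall>k. ncoeff g k = ncoeff f k * cis (of_int k * \<theta>)) \<or> (\<forall>k. ncoeff g k = ncoeff f (- k) * cis (of_int k * \<theta>))"
    by blast
  have tr: "ncoeff (\<lambda>x. f (x + to_circle s)) k = ncoeff f k * cis (of_int k * s)" for k s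
    by (simp add: ncoeff_translate f circle_char_to_circle)
  from th show ?thesis
  proof
    assume "\<forall>k. ncoeff g k = ncoeff f k * cis (of_int k * \<theta>)"
    then have "AE x in \<mu>. g x = f (x + to_circle \<theta>)"
      by (intro ncoeff_uniqueness g bb_plus f) (simp add: tr)
    then show ?thesis by blast
  next
    assume *: "\<forall>k. ncoeff g k = ncoeff f (- k) * cis (of_int k * \<theta>)"
    \<comment> \<open>Reflection negates the frequency in the phase factor as well, hence the shift
      by the negative angle.\<close>
    have "ncoeff (\<lambda>x. f (- x + to_circle (- \<theta>))) k = ncoeff f (- k) * cis (of_int k * \<theta>)" for k
      using ncoeff_reflect[OF bb_plus(1)[OF f(1)], of "to_circle (- \<theta>)" k] by (simp add: tr)
    with * have "AE x in \<mu>. g x = f (- x + to_circle (- \<theta>))"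
      by (intro ncoeff_uniqueness g bb_minus_arg[OF bb_plus(1)] f) simp
    then show ?thesis by blast
  qed
qed

section \<open>Averages along paths\<close>

text \<open>The numbers in the list are gaps between consecutive observations, so they match the
  exponents of \<open>T\<close> in \<open>mean_word\<close>.\<close>

primrec path_word :: "(nat \<Rightarrow> circle) \<Rightarrow> nat \<Rightarrow> (nat \<times> (circle \<Rightarrow> complex)) list \<Rightarrow> complex" where
  "path_word y n [] = 1"
| "path_word y n (p # L) = snd p (y (n + fst p)) * path_word y (n + fst p) L"

text \<open>Along powers of two, almost sure convergence follows from summability of the second moments.\<close>

definition dyadic_avg :: "(nat \<Rightarrow> complex) \<Rightarrow> nat \<Rightarrow> complex" where
  "dyadic_avg h j = (\<Sum>n<2 ^ j. h n) / 2 ^ j"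

text \<open>Words of characters are indexed by lists of pairs of integers, a countable set, so that
  one null set serves for all of them.\<close>

definition char_list :: "(nat \<times> int) list \<Rightarrow> (nat \<times> (circle \<Rightarrow> complex)) list" where
  "char_list L = map (\<lambda>(m, k). (m, circle_char k)) L"

lemma char_list_simps [simp]:
  "char_list [] = []" "char_list (p # L) = (fst p, circle_char (snd p)) # char_list L"
  "char_list (K @ L) = char_list K @ char_list L"
  by (auto simp: char_list_def split: prod.splits)

lemma map_fst_char_list: "map fst (char_list L) = map fst L"
  by (induction L) simp_all

lemma dyadic_avg_add: "dyadic_avg (\<lambda>n. h n + g n) j = dyadic_avg h j + dyadic_avg g j"
  by (simp add: dyadic_avg_def sum.distrib add_divide_distrib)

lemma dyadic_avg_diff: "dyadic_avg (\<lambda>n. h n - g n) j = dyadic_avg h j - dyadic_avg g j"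
  by (simp add: dyadic_avg_def sum_subtractf diff_divide_distrib)

lemma dyadic_avg_cmult: "dyadic_avg (\<lambda>n. c * h n) j = c * dyadic_avg h j"
  by (simp add: dyadic_avg_def sum_distrib_left)

lemma dyadic_avg_const: "dyadic_avg (\<lambda>n. c) j = c"
  by (simp add: dyadic_avg_def)

lemma dyadic_avg_norm_le:
  assumes "\<And>n. norm (h n) \<le> Re (g n)"
  shows "norm (dyadic_avg h j) \<le> Re (dyadic_avg g j)"
proof -
  have "norm (\<Sum>n<2 ^ j. h n) \<le> (\<Sum>n<2 ^ j. Re (g n))"
    using assms by (intro sum_norm_le) auto
  then have "norm (\<Sum>n<2 ^ j. h n) / 2 ^ j \<le> (\<Sum>n<2 ^ j. Re (g n)) / 2 ^ j"
    by (intro divide_right_mono) auto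
  moreover have "dyadic_avg g j = (\<Sum>n<2 ^ j. g n) / of_real (2 ^ j)" by (simp add: dyadic_avg_def)
  then have "Re (dyadic_avg g j) = (\<Sum>n<2 ^ j. Re (g n)) / 2 ^ j"
    by (simp only: Re_divide_of_real Re_sum)
  ultimately show ?thesis by (simp add: dyadic_avg_def norm_divide norm_power)
qed

text \<open>The sum collapses to two boundary terms of modulus at most 1, divided by the number of
  summands.\<close>

lemma dyadic_avg_telescope:
  assumes "\<And>n. norm (h n) \<le> (1::real)"
  shows "dyadic_avg (\<lambda>n. h (Suc n) - h n) \<longlonglongrightarrow> 0"
proof (rule Lim_null_comparison)
  have "norm (dyadic_avg (\<lambda>n. h (Suc n) - h n) j) \<le> 2 * (1 / 2) ^ j" for j
  proof -
    have "norm (h (2 ^ j) - h 0) \<le> 2" using norm_triangle_ineq4[of "h (2 ^ j)" "h 0"] assms[of "2 ^ j"] assms[of 0] by linarith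
    then have "norm (h (2 ^ j) - h 0) / 2 ^ j \<le> 2 / 2 ^ j" by (intro divide_right_mono) auto
    then show ?thesis
      by (simp add: dyadic_avg_def sum_lessThan_telescope norm_divide norm_power power_divide)
  qed
  then show "\<forall>\<^sub>F j in sequentially. norm (dyadic_avg (\<lambda>n. h (Suc n) - h n) j) \<le> 2 * (1 / 2) ^ j"
    by (rule always_eventually[OF allI])
  show "(\<lambda>j. 2 * (1 / 2) ^ j :: real) \<longlonglongrightarrow> 0"
    using tendsto_mult_right_zero[OF LIMSEQ_realpow_zero[of "1/2"]] by simp
qed

lemma path_word_append:
  "path_word y n (K @ L) = path_word y n K * path_word y (n + sum_list (map fst K)) L"
  by (induction K arbitrary: n) (simp_all add: add.assoc)

lemma path_word_slot:
  "path_word y n (K @ (m, u) # L) =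
    path_word y n K * u (y (n + sum_list (map fst K) + m)) * path_word y (n + sum_list (map fst K) + m) L"
  by (simp add: path_word_append)

lemma norm_path_word_le:
  assumes "\<And>p x. p \<in> set L \<Longrightarrow> norm (snd p x) \<le> 1"
  shows "norm (path_word y n L) \<le> 1"
  using assms by (induction L arbitrary: n) (auto simp: norm_mult intro!: mult_le_one)

lemma norm_char_list: "p \<in> set (char_list L) \<Longrightarrow> norm (snd p x) \<le> 1"
  by (auto simp: char_list_def)

text \<open>As in Riemann integrability, sandwiching makes averages along every equidistributed path converge, whatever its
  starting point; this is where the null boundary is used.\<close>

definition sandwiched :: "(circle \<Rightarrow> complex) \<Rightarrow> bool" where
  "sandwiched f \<longleftrightarrow> f \<in> bborel \<and>
    (\<forall>\<epsilon>>0. \<exists>p h. trig p \<and> trig h \<and> (\<forall>x. norm (f x - p x) \<le> Re (h x)) \<and> Re (ncoeff h 0) < \<epsilon>)"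

section \<open>Deterministic limits along generic paths\<close>

context circle_step begin

text \<open>The expectation of the word for a walk started at the given point, computed by
  conditioning one gap at a time.\<close>

primrec mean_word :: "(nat \<times> (circle \<Rightarrow> complex)) list \<Rightarrow> circle \<Rightarrow> complex" where
  "mean_word [] = (\<lambda>_. 1)"
| "mean_word (p # L) = (T ^^ fst p) (\<lambda>x. snd p x * mean_word L x)"

text \<open>Delaying the last character by one step multiplies its conditional expectation by
  \<open>\<phi> k\<close>; a generic path shows this on average. The condition involves characters
  only, not the observed function.\<close>

definition generic :: "(nat \<Rightarrow> circle) \<Rightarrow> bool" where
  "generic y \<longleftrightarrow> (\<forall>L m k. dyadic_avg (\<lambda>n. path_word y n (char_list (L @ [(Suc m, k)])) -
     of_real (\<phi> k) * path_word y n (char_list (L @ [(m, k)]))) \<longlonglongrightarrow> 0)"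

definition converges :: "(nat \<Rightarrow> circle) \<Rightarrow> (nat \<times> (circle \<Rightarrow> complex)) list \<Rightarrow> bool" where
  "converges y L \<longleftrightarrow> dyadic_avg (\<lambda>n. path_word y n L) \<longlonglongrightarrow> ncoeff (mean_word L) 0"

lemma bb_mean_word:
  "(\<And>p. p \<in> set L \<Longrightarrow> snd p \<in> bborel) \<Longrightarrow> mean_word L \<in> bborel"
  by (induction L) (auto intro!: bb_intros)

lemma bb_mean_word_char: "mean_word (char_list L) \<in> bborel"
  by (rule bb_mean_word) (auto simp: char_list_def intro: bb_char)

lemma mean_word_append_cmult:
  assumes "mean_word L = (\<lambda>x. c * mean_word L' x)"
  shows "mean_word (K @ L) = (\<lambda>x. c * mean_word (K @ L') x)"
proof (induction K)
  case (Cons p K)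
  have "mean_word ((p # K) @ L) = (T ^^ fst p) (\<lambda>x. c * (snd p x * mean_word (K @ L') x))"
    by (simp add: Cons.IH mult_ac)
  then show ?case by (simp only: Tpow_cmult) simp
qed (simp add: assms)

lemma mean_word_slot_add:
  assumes "u \<in> bborel" "v \<in> bborel"
    and K: "\<And>p. p \<in> set K \<Longrightarrow> snd p \<in> bborel" and L: "\<And>p. p \<in> set L \<Longrightarrow> snd p \<in> bborel"
  shows "mean_word (K @ (m, \<lambda>x. u x + v x) # L) = (\<lambda>x. mean_word (K @ (m, u) # L) x + mean_word (K @ (m, v) # L) x)"
  using K
proof (induction K)
  case Nil
  then show ?case using assms(1,2) bb_mean_word[OF L] by (simp add: distrib_right Tpow_add bb_mult)
next
  case (Cons p K)
  have "mean_word (K @ (m, w) # L) \<in> bborel" if "w \<in> bborel" for w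
    using Cons.prems L that by (intro bb_mean_word) auto
  then show ?case using Cons assms(1,2) by (simp add: distrib_left Tpow_add bb_mult)
qed

lemma mean_word_slot_cmult:
  "mean_word (K @ (m, \<lambda>x. c * u x) # L) = (\<lambda>x. c * mean_word (K @ (m, u) # L) x)"
  by (rule mean_word_append_cmult) (simp add: mult.assoc Tpow_cmult)

lemma ncoeff_Tpow_0: "u \<in> bborel \<Longrightarrow> ncoeff ((T ^^ n) u) 0 = ncoeff u 0"
  by (simp add: ncoeff_eq integral_Tpow)

lemma converges_Nil: "dyadic_avg (\<lambda>n. 1) \<longlonglongrightarrow> ncoeff (\<lambda>x. 1) 0"
proof -
  have "ncoeff (\<lambda>x. 1) 0 = 1" by (simp add: ncoeff_eq scaleR_conv_of_real)
  then show ?thesis by (simp add: dyadic_avg_const[abs_def] ext[of "dyadic_avg (\<lambda>n. 1)" "\<lambda>_. 1"])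
qed

text \<open>Averages of consecutive terms differ by a telescoping sum, while genericity relates them
  by the factor \<open>\<phi> k\<close>, which is not 1 for k \<noteq> 0; so both must tend to
  0.\<close>

lemma converges_char_single:
  assumes y: "generic y"
  shows "converges y [(0, circle_char k)]"
proof (cases "k = 0")
  case True
  then show ?thesis using converges_Nil by (simp add: converges_def)
next
  case False
  have "\<phi> k \<noteq> \<phi> 0" using False by (simp add: \<phi>_eq_iff)
  then have ne: "1 - complex_of_real (\<phi> k) \<noteq> 0" by (simp add: \<phi>_0)
  let ?h = "\<lambda>n. circle_char k (y n)"
  have "dyadic_avg (\<lambda>n. ?h (Suc n) - of_real (\<phi> k) * ?h n) \<longlonglongrightarrow> 0"
    using y[unfolded generic_def, rule_format, of "[]" 0 k] by simp
  moreover have "dyadic_avg (\<lambda>n. ?h (Suc n) - ?h n) \<longlonglongrightarrow> 0" by (rule dyadic_avg_telescope) simp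
  ultimately have "(\<lambda>j. (dyadic_avg (\<lambda>n. ?h (Suc n) - of_real (\<phi> k) * ?h n) j - dyadic_avg (\<lambda>n. ?h (Suc n) - ?h n) j)
    / (1 - of_real (\<phi> k))) \<longlonglongrightarrow> (0 - 0) / (1 - of_real (\<phi> k))"
    by (intro tendsto_intros ne)
  moreover have "(dyadic_avg (\<lambda>n. ?h (Suc n) - of_real (\<phi> k) * ?h n) j - dyadic_avg (\<lambda>n. ?h (Suc n) - ?h n) j)
    / (1 - of_real (\<phi> k)) = dyadic_avg ?h j" for j
    using ne by (simp add: dyadic_avg_diff dyadic_avg_cmult field_simps)
  ultimately show ?thesis using False by (simp add: converges_def ncoeff_char)
qed

text \<open>Genericity lowers a positive last gap by one at the price of a factor
  \<open>\<phi> k\<close>; a last gap of zero lets the last two characters merge into one, which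
  shortens the word.\<close>

lemma converges_char:
  assumes y: "generic y"
  shows "converges y (char_list L)"
proof (induction "length L" arbitrary: L)
  case 0
  then show ?case using converges_Nil by (simp add: converges_def)
next
  case (Suc len)
  then obtain K p where L: "L = K @ [p]" by (metis length_0_conv nat.distinct(1) rev_exhaust)
  obtain m k where p: "p = (m, k)" by force
  have len: "length K = len" using Suc.hyps(2) L by simp
  have "converges y (char_list (K @ [(m, k)]))"
  proof (induction m)
    case 0
    show ?case
    proof (cases K rule: rev_cases)
      case Nil
      then show ?thesis using converges_char_single[OF y] by simp
    next
      case (snoc K' p')
      obtain m' k' where p': "p' = (m', k')" by force
      have "len = length (K' @ [(m', k' + k)])" using len snoc by simp
      from Suc.hyps(1)[OF this] have IH: "converges y (char_list (K' @ [(m', k' + k)]))" .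
      have "path_word y n (char_list (K @ [(0, k)])) = path_word y n (char_list (K' @ [(m', k' + k)]))" for n
        by (simp add: snoc p' path_word_append circle_char_add_index)
      moreover have "mean_word (char_list K' @ [(m', circle_char k'), (0, circle_char k)]) =
        (\<lambda>x. 1 * mean_word (char_list K' @ [(m', circle_char (k' + k))]) x)"
        by (rule mean_word_append_cmult) (simp add: circle_char_add_index[symmetric])
      ultimately show ?thesis using IH by (simp add: converges_def snoc p')
    qed
  next
    case (Suc m)
    have mw: "mean_word (char_list K @ [(Suc m, circle_char k)]) = (\<lambda>x. of_real (\<phi> k) * mean_word (char_list K @ [(m, circle_char k)]) x)"
    proof (rule mean_word_append_cmult)
      have "(T ^^ Suc m) (circle_char k) = (\<lambda>x. of_real (\<phi> k) * (T ^^ m) (circle_char k) x)"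
        unfolding Tpow_char by (simp add: mult.assoc)
      then show "mean_word [(Suc m, circle_char k)] = (\<lambda>x. of_real (\<phi> k) * mean_word [(m, circle_char k)] x)"
        by (simp del: funpow.simps)
    qed
    have "(\<lambda>j. dyadic_avg (\<lambda>n. path_word y n (char_list (K @ [(Suc m, k)])) -
        of_real (\<phi> k) * path_word y n (char_list (K @ [(m, k)]))) j
        + of_real (\<phi> k) * dyadic_avg (\<lambda>n. path_word y n (char_list (K @ [(m, k)]))) j)
      \<longlonglongrightarrow> 0 + of_real (\<phi> k) * ncoeff (mean_word (char_list (K @ [(m, k)]))) 0"
      using y Suc by (intro tendsto_intros) (auto simp: generic_def converges_def)
    then show ?case
      by (simp add: converges_def mw ncoeff_cmult dyadic_avg_diff dyadic_avg_cmult)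
  qed
  then show ?case by (simp add: L p)
qed

text \<open>The other factors have modulus at most 1, so positivity of \<open>T\<close> leaves only
  the majorant, transported by the total gap up to its slot.\<close>

lemma mean_word_slot_bound:
  assumes u: "u \<in> bborel" and h: "h \<in> bborel" "\<And>x. norm (u x) \<le> Re (h x)"
    and K: "\<And>p. p \<in> set K \<Longrightarrow> snd p \<in> bborel" "\<And>p x. p \<in> set K \<Longrightarrow> norm (snd p x) \<le> 1"
  shows "norm (mean_word (K @ (m, u) # char_list L) x) \<le> Re ((T ^^ (sum_list (map fst K) + m)) h x)"
  using K
proof (induction K arbitrary: x)
  case Nil
  have w: "norm (mean_word (char_list L) x) \<le> 1" for x
  proof (induction L arbitrary: x)
    case (Cons p L)
    have "norm ((T ^^ fst p) (\<lambda>x. circle_char (snd p) x * mean_word (char_list L) x) x) \<le> Re ((T ^^ fst p) (\<lambda>_. 1) x)"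
      by (rule Tpow_bound_by) (auto intro!: bb_intros bb_mean_word_char simp: norm_mult Cons.IH)
    also have "(T ^^ fst p) (\<lambda>_. 1) = (\<lambda>_. 1)"
      using Tpow_char[of "fst p" 0] by (simp add: \<phi>_0 circle_char_0[abs_def])
    finally show ?case by simp
  qed simp
  have "norm (u x * mean_word (char_list L) x) \<le> Re (h x)" for x
    using mult_mono[OF h(2)[of x] w[of x]] h(2)[of x] norm_ge_zero[of "u x"] by (simp add: norm_mult order_trans[of 0])
  then show ?case
    by (simp add: Tpow_bound_by bb_mult u h bb_mean_word_char)
next
  case (Cons p K)
  let ?W = "mean_word (K @ (m, u) # char_list L)" and ?H = "(T ^^ (sum_list (map fst K) + m)) h"
  have W: "?W \<in> bborel"
    using Cons.prems u by (intro bb_mean_word) (auto simp: char_list_def intro: bb_char)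
  have le: "norm (snd p x * ?W x) \<le> Re (?H x)" for x
  proof -
    have "norm (snd p x * ?W x) \<le> 1 * norm (?W x)"
      using Cons.prems unfolding norm_mult by (intro mult_right_mono) auto
    also have "\<dots> \<le> Re (?H x)" using Cons by simp
    finally show ?thesis .
  qed
  have "norm ((T ^^ fst p) (\<lambda>x. snd p x * ?W x) x) \<le> Re ((T ^^ fst p) ?H x)"
    using Cons.prems by (intro Tpow_bound_by le bb_mult W bb_Tpow h) auto
  then show ?case by (simp add: funpow_add add.assoc)
qed

text \<open>The last sandwiched factor is replaced by a trigonometric polynomial, which by linearity
  becomes part of the tail of characters. The same \<open>h\<close> controls the error twice:
  through its average along the path and through its integral in the limit.\<close>

lemma converges_sandwiched:
  assumes y: "generic y"
    and K: "\<And>p. p \<in> set K \<Longrightarrow> sandwiched (snd p)" "\<And>p x. p \<in> set K \<Longrightarrow> norm (snd p x) \<le> 1"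
  shows "converges y (K @ char_list L)"
  using K
proof (induction K arbitrary: L rule: rev_induct)
  case Nil
  then show ?case using converges_char[OF y] by simp
next
  case (snoc q K)
  obtain m f where q: "q = (m, f)" by force
  have K1: "\<And>p. p \<in> set K \<Longrightarrow> snd p \<in> bborel" "\<And>p x. p \<in> set K \<Longrightarrow> norm (snd p x) \<le> 1"
    using snoc.prems by (auto simp: sandwiched_def)
  have bbL: "\<And>p. p \<in> set (char_list L) \<Longrightarrow> snd p \<in> bborel" for L
    by (auto simp: char_list_def intro: bb_char)
  have f: "sandwiched f" using snoc.prems(1)[of q] by (simp add: q)
  then have bbf: "f \<in> bborel" by (simp add: sandwiched_def)
  \<comment> \<open>Stated for an arbitrary prefix, since it is also applied to \<open>h\<close>
    alone with the empty prefix.\<close>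
  have trig_slot: "converges y (K @ (m, p) # char_list L)"
    if "trig p" and IH: "\<And>L. converges y (K @ char_list L)"
      and K: "\<And>p. p \<in> set K \<Longrightarrow> snd p \<in> bborel" for p K L m
    using that(1)
  proof (induction rule: trig.induct)
    case (trig_char c k)
    have "(\<lambda>j. c * dyadic_avg (\<lambda>n. path_word y n (K @ char_list ((m, k) # L))) j) \<longlonglongrightarrow>
        c * ncoeff (mean_word (K @ char_list ((m, k) # L))) 0"
      using IH by (intro tendsto_intros) (simp only: converges_def)
    then show ?case
      by (simp add: converges_def mean_word_slot_cmult ncoeff_cmult path_word_slot dyadic_avg_cmult[symmetric] mult_ac)
  next
    case (trig_add p q)
    have bb: "p \<in> bborel" "q \<in> bborel" using trig_add by (auto intro: bb_trig)
    have bbw: "mean_word (K @ (m, w) # char_list L) \<in> bborel" if "w \<in> bborel" for w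
      using K bbL that by (intro bb_mean_word) auto
    have "(\<lambda>j. dyadic_avg (\<lambda>n. path_word y n (K @ (m, p) # char_list L)) j + dyadic_avg (\<lambda>n. path_word y n (K @ (m, q) # char_list L)) j)
      \<longlonglongrightarrow> ncoeff (mean_word (K @ (m, p) # char_list L)) 0 + ncoeff (mean_word (K @ (m, q) # char_list L)) 0"
      using trig_add.IH by (intro tendsto_intros) (simp_all add: converges_def)
    then show ?case
      by (simp add: converges_def mean_word_slot_add bb K bbL ncoeff_add bbw path_word_slot dyadic_avg_add[symmetric] algebra_simps)
  qed
  let ?F = "\<lambda>u n. path_word y n (K @ (m, u) # char_list L)" and ?I = "\<lambda>u. ncoeff (mean_word (K @ (m, u) # char_list L)) 0"
  define M where "M = sum_list (map fst K) + m"
  have "dyadic_avg (?F f) \<longlonglongrightarrow> ?I f"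
  proof (rule tendstoI)
    fix \<epsilon> :: real assume e: "\<epsilon> > 0"
    then obtain p h where ph: "trig p" "trig h" "\<And>x. norm (f x - p x) \<le> Re (h x)" "Re (ncoeff h 0) < \<epsilon> / 4"
      using f unfolding sandwiched_def by (meson divide_pos_pos zero_less_numeral)
    have bb: "p \<in> bborel" "h \<in> bborel" by (auto intro: bb_trig ph)
    have bbw: "mean_word (K @ (m, w) # char_list L) \<in> bborel" if "w \<in> bborel" for w
      using K1 bbL that by (intro bb_mean_word) auto
    have "converges y (K @ (m, p) # char_list L)"
      using snoc.IH snoc.prems K1 by (intro trig_slot ph) auto
    then have 1: "\<forall>\<^sub>F j in sequentially. dist (dyadic_avg (?F p) j) (?I p) < \<epsilon> / 4"
      unfolding converges_def using e by (intro tendstoD) auto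
    \<comment> \<open>The gap \<open>M\<close> places \<open>h\<close> at the position of the
      replaced factor, so its average bounds the path error at exactly these times.\<close>
    have "converges y ([] @ (M, h) # char_list [])"
      using converges_char[OF y] by (intro trig_slot ph) auto
    then have "dyadic_avg (\<lambda>n. h (y (n + M))) \<longlonglongrightarrow> ncoeff h 0"
      by (simp add: converges_def ncoeff_Tpow_0 bb)
    from order_tendstoD(2)[OF tendsto_Re[OF this] ph(4)]
    have 2: "\<forall>\<^sub>F j in sequentially. Re (dyadic_avg (\<lambda>n. h (y (n + M))) j) < \<epsilon> / 4" .
    have 3: "norm (?I f - ?I p) \<le> Re (ncoeff h 0)"
    proof -
      have "?I f = ncoeff (mean_word (K @ (m, \<lambda>x. (f x - p x) + p x) # char_list L)) 0" by simp
      also have "\<dots> = ?I (\<lambda>x. f x - p x) + ?I p"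
      proof -
        have "mean_word (K @ (m, \<lambda>x. (f x - p x) + p x) # char_list L) =
            (\<lambda>x. mean_word (K @ (m, \<lambda>x. f x - p x) # char_list L) x + mean_word (K @ (m, p) # char_list L) x)"
          by (rule mean_word_slot_add[OF bb_diff[OF bbf bb(1)] bb(1)]) (use K1(1) bbL in blast)+
        then show ?thesis
          by (simp only: ncoeff_add[OF bbw[OF bb_diff[OF bbf bb(1)]] bbw[OF bb(1)]])
      qed
      finally have "norm (?I f - ?I p) = norm (?I (\<lambda>x. f x - p x))" by simp
      also have "\<dots> = norm (LINT x|\<mu>. mean_word (K @ (m, \<lambda>x. f x - p x) # char_list L) x) / (2 * pi)"
        by (simp add: ncoeff_eq norm_divide)
      also have "\<dots> \<le> (LINT x|\<mu>. Re ((T ^^ M) h x)) / (2 * pi)"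
      proof (intro divide_right_mono)
        have "norm (LINT x|\<mu>. mean_word (K @ (m, \<lambda>x. f x - p x) # char_list L) x) \<le>
          (LINT x|\<mu>. norm (mean_word (K @ (m, \<lambda>x. f x - p x) # char_list L) x))"
          by (rule integral_norm_bound)
        also have "\<dots> \<le> (LINT x|\<mu>. Re ((T ^^ M) h x))"
          unfolding M_def using K1 ph
          by (intro integral_mono bb_integrable_circle mean_word_slot_bound bb_diff bbw bb bbf integrable_Re bb_Tpow) auto
        finally show "norm (LINT x|\<mu>. mean_word (K @ (m, \<lambda>x. f x - p x) # char_list L) x) \<le>
          (LINT x|\<mu>. Re ((T ^^ M) h x))" .
      qed simp
      also have "(LINT x|\<mu>. Re ((T ^^ M) h x)) = Re (LINT x|\<mu>. h x)"
        using integral_Tpow[OF bb(2), of M] bb by (simp add: bb_integrable_circle bb_Tpow)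
      also have "\<dots> / (2 * pi) = Re (ncoeff h 0)" by (simp add: ncoeff_eq)
      finally show ?thesis .
    qed
    have 4: "norm (dyadic_avg (?F f) j - dyadic_avg (?F p) j) \<le> Re (dyadic_avg (\<lambda>n. h (y (n + M))) j)" for j
      unfolding dyadic_avg_diff[symmetric]
    proof (rule dyadic_avg_norm_le)
      fix n
      have "?F f n - ?F p n = path_word y n K * (f (y (n + M)) - p (y (n + M))) * path_word y (n + M) (char_list L)"
        by (simp add: path_word_slot M_def algebra_simps)
      also have "norm \<dots> \<le> 1 * Re (h (y (n + M))) * 1"
        unfolding norm_mult using ph(3) order_trans[OF norm_ge_zero ph(3)] K1
        by (intro mult_mono norm_path_word_le) (auto intro: norm_char_list)
      finally show "norm (?F f n - ?F p n) \<le> Re (h (y (n + M)))" by simp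
    qed
    show "\<forall>\<^sub>F j in sequentially. dist (dyadic_avg (?F f) j) (?I f) < \<epsilon>"
      using 1 2
    proof eventually_elim
      case (elim j)
      have "dist (dyadic_avg (?F f) j) (?I f) \<le> norm (dyadic_avg (?F f) j - dyadic_avg (?F p) j)
        + dist (dyadic_avg (?F p) j) (?I p) + norm (?I f - ?I p)"
        unfolding dist_norm by norm
      with e elim 3 4[of j] ph(4) show ?case by linarith
    qed
  qed
  then show ?case by (simp add: converges_def q)
qed

lemma mean_word_replicate:
  "mean_word (map (\<lambda>m. (m, f)) (m # ms)) = (T ^^ m) (op_word f (Tpows ms) f)"
  by (induction ms arbitrary: m) simp_all

text \<open>The leading gap 0 anchors each word at time n, so no operator stands in front of the
  first \<open>f\<close>.\<close>

lemma generic_statistics: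
  assumes "generic y" "sandwiched f" "\<And>x. norm (f x) \<le> 1"
  shows "dyadic_avg (\<lambda>n. path_word y n (map (\<lambda>m. (m, f)) (0 # ms))) \<longlonglongrightarrow> ncoeff (op_word f (Tpows ms) f) 0"
proof -
  have "converges y (map (\<lambda>m. (m, f)) (0 # ms) @ char_list [])"
    using assms by (intro converges_sandwiched) auto
  then have "dyadic_avg (\<lambda>n. path_word y n (map (\<lambda>m. (m, f)) (0 # ms))) \<longlonglongrightarrow>
      ncoeff (mean_word (map (\<lambda>m. (m, f)) (0 # ms))) 0"
    by (simp only: converges_def char_list_simps append_Nil2)
  then show ?thesis unfolding mean_word_replicate by simp
qed

end

text \<open>\<open>p n\<close> lies below the indicator of \<open>U\<close> and \<open>q n\<close>
  below that of its exterior, so \<open>1 - q n\<close> lies above the former. The integral of the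
  width \<open>h n\<close> tends to the measure of the boundary.\<close>

lemma sandwiched_open_indicator:
  assumes U: "open U" and bd: "emeasure \<mu> (frontier U) = 0"
  shows "sandwiched (\<lambda>x. of_real (indicator U x))"
  unfolding sandwiched_def
proof (intro conjI allI impI)
  have [measurable]: "U \<in> sets borel" using U by simp
  show "(\<lambda>x. complex_of_real (indicator U x)) \<in> bborel"
    by (rule bborelI[where B=1]) (auto simp: indicator_def)
  fix \<epsilon> :: real assume e: "\<epsilon> > 0"
  define V where "V = - closure U"
  have V: "open V" unfolding V_def by (intro open_Compl closed_closure)
  then have [measurable]: "V \<in> sets borel" by simp
  obtain p where p: "\<And>n. trig (\<lambda>x. of_real (p n x))" "\<And>n x. p n x \<le> indicator U x" "\<And>n x. \<bar>p n x\<bar> \<le> 2"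
    "\<And>x. (\<lambda>n. p n x) \<longlonglongrightarrow> indicator U x" using open_trig_approx_below[OF U] by blast
  obtain q where q: "\<And>n. trig (\<lambda>x. of_real (q n x))" "\<And>n x. q n x \<le> indicator V x" "\<And>n x. \<bar>q n x\<bar> \<le> 2"
    "\<And>x. (\<lambda>n. q n x) \<longlonglongrightarrow> indicator V x" using open_trig_approx_below[OF V] by blast
  define h where "h n x = 1 - q n x - p n x" for n x
  have trig_h: "trig (\<lambda>x. of_real (h n x))" for n
    using trig_diff[OF trig_diff[OF trig_const[of 1] q(1)[of n]] p(1)[of n]] by (simp add: h_def)
  have meas [measurable]: "(\<lambda>x. p n x) \<in> borel_measurable borel" "(\<lambda>x. q n x) \<in> borel_measurable borel" for n
  proof -
    have [measurable]: "(\<lambda>x. complex_of_real (p n x)) \<in> borel_measurable borel" "(\<lambda>x. complex_of_real (q n x)) \<in> borel_measurable borel"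
      by (intro bborel_measurable bb_trig p q)+
    have "(\<lambda>x. Re (of_real (p n x))) \<in> borel_measurable borel" "(\<lambda>x. Re (of_real (q n x))) \<in> borel_measurable borel"
      by measurable
    then show "(\<lambda>x. p n x) \<in> borel_measurable borel" "(\<lambda>x. q n x) \<in> borel_measurable borel" by auto
  qed
  have disj: "indicator U x + indicator V x \<le> (1::real)" for x
    using closure_subset[of U] by (auto simp: V_def indicator_def)
  have le: "norm (complex_of_real (indicator U x) - of_real (p n x)) \<le> Re (of_real (h n x))" for n x
    using p(2)[of n x] q(2)[of n x] disj[of x] unfolding of_real_diff[symmetric] norm_of_real h_def Re_complex_of_real by linarith
  have "(\<lambda>n. LINT x|\<mu>. h n x) \<longlonglongrightarrow> (LINT x|\<mu>. 1 - indicator V x - indicator U x)"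
  \<comment> \<open>The constant is 1 + 2 + 2, from the uniform bounds on \<open>q\<close> and
    \<open>p\<close>.\<close>
  proof (rule integral_dominated_convergence[where w="\<lambda>_. 5"])
    show "AE x in \<mu>. (\<lambda>n. h n x) \<longlonglongrightarrow> 1 - indicator V x - indicator U x"
      unfolding h_def by (intro AE_I2 tendsto_intros p q)
    have "norm (h n x) \<le> 5" for n x
      using p(3)[of n x] q(3)[of n x] unfolding h_def real_norm_def by linarith
    then show "AE x in \<mu>. norm (h n x) \<le> 5" for n by simp
  qed (simp_all add: h_def)
  moreover have "(LINT x|\<mu>. 1 - indicator V x - indicator U x) = (LINT x|\<mu>. (0::real))"
  proof (rule integral_cong_AE)
    have "frontier U = closure U - U" using U by (simp add: frontier_def interior_open)
    moreover have "frontier U \<in> null_sets \<mu>"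
      using bd by (intro null_setsI) (auto simp: frontier_def)
    ultimately have "AE x in \<mu>. x \<notin> closure U - U" using AE_not_in by force
    then show "AE x in \<mu>. 1 - indicator V x - indicator U x = (0::real)"
      by eventually_elim (use closure_subset[of U] in \<open>auto simp: V_def indicator_def\<close>)
  qed simp_all
  ultimately have "(\<lambda>n. LINT x|\<mu>. h n x) \<longlonglongrightarrow> 0" by simp
  from order_tendstoD(2)[OF this e] obtain n where n: "(LINT x|\<mu>. h n x) < \<epsilon>"
    by (auto simp: eventually_sequentially)
  have nn: "0 \<le> (LINT x|\<mu>. h n x)"
    using p(2) q(2) disj by (intro integral_nonneg_AE AE_I2) (smt (verit) h_def)
  have "Re (ncoeff (\<lambda>x. of_real (h n x)) 0) = (LINT x|\<mu>. h n x) / (2 * pi)"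
    by (simp add: ncoeff_eq)
  also have "\<dots> \<le> (LINT x|\<mu>. h n x) / 1"
    using nn pi_gt3 by (intro divide_left_mono) auto
  also have "\<dots> < \<epsilon>" using n by simp
  finally show "\<exists>p h. trig p \<and> trig h \<and> (\<forall>x. norm (complex_of_real (indicator U x) - p x) \<le> Re (h x)) \<and> Re (ncoeff h 0) < \<epsilon>"
    using p(1)[of n] trig_h[of n] le[of _ n] by blast
qed

section \<open>The sampled random walk and its martingale differences\<close>

lemma borel_measurable_cnj [measurable (raw)]:
  assumes "f \<in> borel_measurable M"
  shows "(\<lambda>x. cnj (f x)) \<in> borel_measurable M"
  using assms by (rule borel_measurable_continuous_on[OF continuous_on_cnj[OF continuous_on_id]])

text \<open>The step laws enter only through expectations of characters, since everything computed
  below is a product of characters of increments.\<close>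

locale circle_walk = prob_space M for M :: "'a measure" +
  fixes \<xi> :: "nat \<Rightarrow> 'a \<Rightarrow> circle" and y :: "nat \<Rightarrow> 'a \<Rightarrow> circle" and \<phi> :: "int \<Rightarrow> real"
  assumes indep: "indep_vars (\<lambda>_. borel) \<xi> {1..n}"
    and char_increment: "i \<ge> 1 \<Longrightarrow> (LINT \<omega>|M. circle_char k (\<xi> i \<omega>)) = of_real (\<phi> k)"
    and y_Suc: "y (Suc n) \<omega> = y n \<omega> + \<xi> (Suc n) \<omega>"
    and \<phi>_even: "\<phi> (- k) = \<phi> k"
begin

text \<open>Only the increments are assumed independent, so the initial position \<open>y 0\<close> has to be factored out of all
  products of characters along the path.\<close>

definition inc_char :: "nat \<Rightarrow> (nat \<Rightarrow> int) \<Rightarrow> 'a \<Rightarrow> complex" where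
  "inc_char n c \<omega> = (\<Prod>i\<in>{1..n}. circle_char (c i) (\<xi> i \<omega>))"

lemma measurable_increment [measurable]: "i \<ge> 1 \<Longrightarrow> \<xi> i \<in> M \<rightarrow>\<^sub>M borel"
  using indep[of i] by (auto simp: indep_vars_def)

lemma norm_inc_char [simp]: "norm (inc_char n c \<omega>) = 1"
  by (simp add: inc_char_def flip: prod_norm)

lemma measurable_inc_char [measurable]: "inc_char n c \<in> borel_measurable M"
  unfolding inc_char_def[abs_def] by measurable

lemma integrable_inc_char: "integrable M (inc_char n c)"
  by (intro integrable_const_bound[where B=1]) auto

lemma expectation_inc_char: "(LINT \<omega>|M. inc_char n c \<omega>) = (\<Prod>i\<in>{1..n}. of_real (\<phi> (c i)))"
proof -
  have "indep_vars (\<lambda>_. borel) (\<lambda>i \<omega>. circle_char (c i) (\<xi> i \<omega>)) {1..n}"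
    by (rule indep_vars_compose2[OF indep]) simp
  then have "(LINT \<omega>|M. inc_char n c \<omega>) = (\<Prod>i\<in>{1..n}. LINT \<omega>|M. circle_char (c i) (\<xi> i \<omega>))"
    unfolding inc_char_def
    by (intro indep_vars_lebesgue_integral) (auto intro!: integrable_const_bound[where B=1])
  then show ?thesis by (simp add: char_increment)
qed

lemma inc_char_mult: "inc_char n c \<omega> * inc_char n d \<omega> = inc_char n (\<lambda>i. c i + d i) \<omega>"
  by (simp add: inc_char_def circle_char_add_index prod.distrib)

lemma inc_char_cnj: "cnj (inc_char n c \<omega>) = inc_char n (\<lambda>i. - c i) \<omega>"
  by (simp add: inc_char_def circle_char_uminus_index)

text \<open>Padding with zero exponents lets products over different time ranges be
  multiplied.\<close>

lemma inc_char_extend: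
  assumes "n \<le> m"
  shows "inc_char n c \<omega> = inc_char m (\<lambda>i. if i \<le> n then c i else 0) \<omega>"
  unfolding inc_char_def using assms by (intro prod.mono_neutral_cong_left) auto

lemma inc_char_Suc: "inc_char (Suc n) c \<omega> = inc_char n c \<omega> * circle_char (c (Suc n)) (\<xi> (Suc n) \<omega>)"
  by (simp add: inc_char_def prod.cl_ivl_Suc mult.commute)

lemma inc_char_single:
  assumes "1 \<le> j" "j \<le> n"
  shows "circle_char k (\<xi> j \<omega>) = inc_char n (\<lambda>i. if i = j then k else 0) \<omega>"
proof -
  have "inc_char n (\<lambda>i. if i = j then k else 0) \<omega> = (\<Prod>i\<in>{1..n}. if i = j then circle_char k (\<xi> i \<omega>) else 1)"
    unfolding inc_char_def by (intro prod.cong) auto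
  also have "\<dots> = circle_char k (\<xi> j \<omega>)" using assms by (subst prod.delta) auto
  finally show ?thesis by simp
qed

text \<open>The second factor has mean zero and is independent of the first n increments; the
  product formula for characters expresses this without conditional expectations.\<close>

lemma inc_char_orthogonal:
  "(LINT \<omega>|M. inc_char n c \<omega> * (circle_char k (\<xi> (Suc n) \<omega>) - of_real (\<phi> k))) = 0"
proof -
  define d where "d = c(Suc n := k)"
  have dn: "inc_char n d \<omega> = inc_char n c \<omega>" for \<omega>
    unfolding inc_char_def d_def by (intro prod.cong) auto
  have "inc_char n c \<omega> * (circle_char k (\<xi> (Suc n) \<omega>) - of_real (\<phi> k)) =
      inc_char (Suc n) d \<omega> - of_real (\<phi> k) * inc_char n d \<omega>" for \<omega>
    unfolding inc_char_Suc dn by (simp add: d_def right_diff_distrib mult.commute)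
  then have "(LINT \<omega>|M. inc_char n c \<omega> * (circle_char k (\<xi> (Suc n) \<omega>) - of_real (\<phi> k))) =
      (LINT \<omega>|M. inc_char (Suc n) d \<omega>) - of_real (\<phi> k) * (LINT \<omega>|M. inc_char n d \<omega>)"
    by (simp add: integrable_inc_char)
  also have "\<dots> = 0"
    unfolding expectation_inc_char by (simp add: prod.cl_ivl_Suc d_def mult.commute)
  finally show ?thesis .
qed

lemma abs_\<phi>_le:
  "\<bar>\<phi> k\<bar> \<le> 1"
proof -
  have "norm (complex_of_real (\<phi> k)) \<le> (LINT \<omega>|M. norm (circle_char k (\<xi> 1 \<omega>)))"
    unfolding char_increment[OF le_refl, symmetric] by (rule integral_norm_bound)
  then show ?thesis by (simp add: prob_space)
qed

text \<open>A character of the past up to time n + r times the centred character of the next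
  increment. The exponents \<open>c n\<close> may vary with n; \<open>r\<close> will be the total
  gap of a word.\<close>

definition mart_diff :: "nat \<Rightarrow> (nat \<Rightarrow> nat \<Rightarrow> int) \<Rightarrow> int \<Rightarrow> nat \<Rightarrow> 'a \<Rightarrow> complex" where
  "mart_diff r c k n \<omega> = inc_char (n + r) (c n) \<omega> * (circle_char k (\<xi> (Suc (n + r)) \<omega>) - of_real (\<phi> k))"

lemma measurable_mart_diff [measurable]: "mart_diff r c k n \<in> borel_measurable M"
  unfolding mart_diff_def[abs_def] by measurable

lemma norm_mart_diff: "norm (mart_diff r c k n \<omega>) \<le> 2"
  using norm_triangle_ineq4[of "circle_char k (\<xi> (Suc (n + r)) \<omega>)" "of_real (\<phi> k)"] abs_\<phi>_le[of k]
  by (simp add: mart_diff_def norm_mult)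

lemma mart_diff_orthogonal:
  assumes "n < n'"
  shows "(LINT \<omega>|M. mart_diff r c k n \<omega> * cnj (mart_diff r c k n' \<omega>)) = 0"
proof -
  let ?n = "n' + r"
  define e where "e = (\<lambda>i. if i \<le> n + r then c n i else 0)"
  \<comment> \<open>\<open>z1\<close> and \<open>z2\<close> collect the exponents of everything up
    to time n' + r, with and without the character of increment n + r + 1, which belongs to this
    past because n < n'.\<close>
  define z1 where "z1 = (\<lambda>i. e i - c n' i + (if i = Suc (n + r) then k else 0))"
  define z2 where "z2 = (\<lambda>i. e i - c n' i)"
  have "mart_diff r c k n \<omega> * cnj (mart_diff r c k n' \<omega>) =
    inc_char ?n z1 \<omega> * (circle_char (- k) (\<xi> (Suc ?n) \<omega>) - of_real (\<phi> (- k))) -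
    of_real (\<phi> k) * (inc_char ?n z2 \<omega> * (circle_char (- k) (\<xi> (Suc ?n) \<omega>) - of_real (\<phi> (- k))))" for \<omega>
  proof -
    have e: "inc_char (n + r) (c n) \<omega> = inc_char ?n e \<omega>"
      unfolding e_def using assms by (intro inc_char_extend) simp
    have s: "circle_char k (\<xi> (Suc (n + r)) \<omega>) = inc_char ?n (\<lambda>i. if i = Suc (n + r) then k else 0) \<omega>"
      using assms by (intro inc_char_single) auto
    have z2: "inc_char ?n e \<omega> * cnj (inc_char ?n (c n') \<omega>) = inc_char ?n z2 \<omega>"
      by (simp add: inc_char_cnj inc_char_mult z2_def)
    have z1: "inc_char ?n z2 \<omega> * inc_char ?n (\<lambda>i. if i = Suc (n + r) then k else 0) \<omega> = inc_char ?n z1 \<omega>"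
      by (simp add: inc_char_mult z1_def z2_def)
    have cj: "cnj (circle_char k (\<xi> (Suc ?n) \<omega>) - of_real (\<phi> k)) = circle_char (- k) (\<xi> (Suc ?n) \<omega>) - of_real (\<phi> (- k))"
      by (simp add: circle_char_uminus_index \<phi>_even)
    show ?thesis
      unfolding mart_diff_def complex_cnj_mult cj e s z1[symmetric] z2[symmetric] by (simp add: algebra_simps)
  qed
  moreover have "integrable M (\<lambda>\<omega>. inc_char ?n z \<omega> * (circle_char (- k) (\<xi> (Suc ?n) \<omega>) - of_real (\<phi> (- k))))" for z
  proof (rule integrable_const_bound[where B=2])
    show "AE \<omega> in M. norm (inc_char ?n z \<omega> * (circle_char (- k) (\<xi> (Suc ?n) \<omega>) - of_real (\<phi> (- k)))) \<le> 2"
      using norm_mart_diff[of "?n" "\<lambda>_. z" "- k" 0] by (simp add: mart_diff_def)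
  qed measurable
  ultimately show ?thesis by (simp add: inc_char_orthogonal)
qed

text \<open>Pythagoras: the summands are orthogonal and each has squared modulus at most 4.\<close>

lemma mart_diff_l2:
  "(LINT \<omega>|M. (norm (\<Sum>n<N. mart_diff r c k n \<omega>))\<^sup>2) \<le> 4 * real N"
proof (induction N)
  case (Suc N)
  let ?D = "mart_diff r c k" and ?S = "\<lambda>\<omega>. \<Sum>n<N. mart_diff r c k n \<omega>"
  have bd: "norm (?S \<omega>) \<le> 2 * real N" for \<omega>
    using sum_norm_bound[of "{..<N}" "\<lambda>n. ?D n \<omega>" 2] norm_mart_diff by (simp add: mult.commute)
  have i1: "integrable M (\<lambda>\<omega>. (norm (?S \<omega>))\<^sup>2)"
    using power_mono[OF bd norm_ge_zero, where n=2]
    by (intro integrable_const_bound[where B="(2 * real N)\<^sup>2"]) auto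
  have nD: "(norm (?D N \<omega>))\<^sup>2 \<le> 4" for \<omega>
    using power_mono[OF norm_mart_diff, of r c k N \<omega> 2] by simp
  have i2: "integrable M (\<lambda>\<omega>. (norm (?D N \<omega>))\<^sup>2)"
    by (rule integrable_const_bound[where B=4]) (auto simp: nD)
  have iD: "integrable M (\<lambda>\<omega>. ?D n \<omega> * cnj (?D N \<omega>))" for n
    using mult_mono[OF norm_mart_diff norm_mart_diff]
    by (intro integrable_const_bound[where B="2 * 2"]) (auto simp: norm_mult)
  have i3: "integrable M (\<lambda>\<omega>. ?S \<omega> * cnj (?D N \<omega>))"
    unfolding sum_distrib_right by (intro Bochner_Integration.integrable_sum iD)
  have cross: "(LINT \<omega>|M. ?S \<omega> * cnj (?D N \<omega>)) = 0"
    unfolding sum_distrib_right by (simp add: iD mart_diff_orthogonal)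
  have "(norm (\<Sum>n<Suc N. ?D n \<omega>))\<^sup>2 = (norm (?S \<omega>))\<^sup>2 + 2 * Re (?S \<omega> * cnj (?D N \<omega>)) + (norm (?D N \<omega>))\<^sup>2" for \<omega>
  proof -
    have "(norm (a + b))\<^sup>2 = (norm a)\<^sup>2 + 2 * Re (a * cnj b) + (norm b)\<^sup>2" for a b :: complex
      unfolding cmod_power2 by (simp add: power2_eq_square algebra_simps)
    then show ?thesis by simp
  qed
  then have "(LINT \<omega>|M. (norm (\<Sum>n<Suc N. ?D n \<omega>))\<^sup>2) =
    (LINT \<omega>|M. (norm (?S \<omega>))\<^sup>2) + 2 * Re (LINT \<omega>|M. ?S \<omega> * cnj (?D N \<omega>)) + (LINT \<omega>|M. (norm (?D N \<omega>))\<^sup>2)"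
    using i1 i2 i3 by (simp only: Bochner_Integration.integral_add integrable_Re integral_Re integrable_mult_right
        integral_mult_right_zero Bochner_Integration.integrable_add)
  also have "\<dots> \<le> 4 * real N + 2 * 0 + (LINT \<omega>|M. 4)"
    unfolding cross using Suc nD by (intro add_mono integral_mono i2) auto
  finally show ?case by (simp add: prob_space)
qed simp

lemma mart_diff_AE:
  "AE \<omega> in M. dyadic_avg (\<lambda>n. mart_diff r c k n \<omega>) \<longlonglongrightarrow> 0"
proof -
  define Z where "Z j \<omega> = (norm (dyadic_avg (\<lambda>n. mart_diff r c k n \<omega>) j))\<^sup>2" for j \<omega>
  have Z_eq: "Z j \<omega> = (norm (\<Sum>n<2 ^ j. mart_diff r c k n \<omega>))\<^sup>2 / 4 ^ j" for j \<omega>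
  proof -
    have "((2::real) ^ j)\<^sup>2 = 4 ^ j" by (simp add: power2_eq_square flip: power_mult_distrib)
    then show ?thesis by (simp add: Z_def dyadic_avg_def norm_divide norm_power power_divide)
  qed
  have Z0: "0 \<le> Z j \<omega>" for j \<omega> by (simp add: Z_def)
  have [measurable]: "Z j \<in> borel_measurable M" for j
    unfolding Z_eq[abs_def] by measurable
  \<comment> \<open>The moments decay geometrically in \<open>j\<close>, so the expected sum of all
    \<open>Z j\<close> is finite and \<open>Z j\<close> tends to 0 almost surely.\<close>
  have EZ: "(LINT \<omega>|M. Z j \<omega>) \<le> 4 * (1 / 2) ^ j" for j
  proof -
    have "(LINT \<omega>|M. Z j \<omega>) = (LINT \<omega>|M. (norm (\<Sum>n<2 ^ j. mart_diff r c k n \<omega>))\<^sup>2) / 4 ^ j"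
      unfolding Z_eq by simp
    also have "\<dots> \<le> 4 * real (2 ^ j) / 4 ^ j"
      by (intro divide_right_mono mart_diff_l2) simp
    also have "(4::real) ^ j = 2 ^ j * 2 ^ j" by (simp flip: power_mult_distrib)
    finally show ?thesis by (simp add: power_divide)
  qed
  have iZ: "integrable M (Z j)" for j
  proof (rule integrable_const_bound[where B=4])
    have "norm (dyadic_avg (\<lambda>n. mart_diff r c k n \<omega>) j) \<le> Re (dyadic_avg (\<lambda>n. 2) j)" for \<omega>
      by (rule dyadic_avg_norm_le) (simp add: norm_mart_diff)
    then have "norm (dyadic_avg (\<lambda>n. mart_diff r c k n \<omega>) j) \<le> 2" for \<omega> by (simp add: dyadic_avg_const)
    then have "Z j \<omega> \<le> 2\<^sup>2" for \<omega> unfolding Z_def by (intro power_mono) auto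
    then show "AE \<omega> in M. norm (Z j \<omega>) \<le> 4" using Z0 by simp
  qed simp
  have "(\<integral>\<^sup>+ \<omega>. (\<Sum>j. ennreal (Z j \<omega>)) \<partial>M) = (\<Sum>j. \<integral>\<^sup>+ \<omega>. ennreal (Z j \<omega>) \<partial>M)"
    by (rule nn_integral_suminf) measurable
  also have "\<dots> \<le> (\<Sum>j. ennreal (4 * (1 / 2) ^ j))"
  proof (intro suminf_le summableI)
    show "(\<integral>\<^sup>+ \<omega>. ennreal (Z j \<omega>) \<partial>M) \<le> ennreal (4 * (1 / 2) ^ j)" for j
      using iZ Z0 EZ[of j] by (subst nn_integral_eq_integral) (auto intro: ennreal_leI)
  qed
  also have "\<dots> < top"
  proof -
    have "summable (\<lambda>j. 4 * (1 / 2) ^ j :: real)" by (intro summable_mult summable_geometric) simp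
    then have "(\<Sum>j. ennreal (4 * (1 / 2) ^ j)) = ennreal (\<Sum>j. 4 * (1 / 2) ^ j)"
      by (intro suminf_ennreal2) auto
    then show ?thesis by simp
  qed
  finally have "AE \<omega> in M. (\<Sum>j. ennreal (Z j \<omega>)) \<noteq> \<infinity>"
    by (intro nn_integral_PInf_AE) auto
  then show ?thesis
  proof eventually_elim
    case (elim \<omega>)
    then have "summable (\<lambda>j. Z j \<omega>)" using Z0 by (intro summable_suminf_not_top) auto
    then have "(\<lambda>j. Z j \<omega>) \<longlonglongrightarrow> 0" by (rule summable_LIMSEQ_zero)
    then have "(\<lambda>j. sqrt (Z j \<omega>)) \<longlonglongrightarrow> sqrt 0" by (intro tendsto_intros)
    then have "(\<lambda>j. norm (dyadic_avg (\<lambda>n. mart_diff r c k n \<omega>) j)) \<longlonglongrightarrow> 0" by (simp add: Z_def)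
    then show ?case by (rule tendsto_norm_zero_cancel)
  qed
qed

lemma char_y: "circle_char k (y n \<omega>) = circle_char k (y 0 \<omega>) * inc_char n (\<lambda>_. k) \<omega>"
proof (induction n)
  case (Suc n)
  then show ?case by (simp add: y_Suc circle_char_add inc_char_Suc)
qed (simp add: inc_char_def)

text \<open>The starting point enters only through the total frequency, the same for all n, and so
  comes out of the averages as a factor of modulus 1.\<close>

lemma path_word_char:
  "\<exists>c. \<forall>\<omega>. path_word (\<lambda>n. y n \<omega>) n (char_list L) =
    circle_char (sum_list (map snd L)) (y 0 \<omega>) * inc_char (n + sum_list (map fst L)) c \<omega>"
proof (induction L arbitrary: n)
  case Nil
  show ?case by (intro exI[of _ "\<lambda>_. 0"]) (simp add: inc_char_def)
next
  case (Cons p L)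
  let ?m = "n + fst p" and ?s = "sum_list (map fst L)"
  obtain c where c: "\<And>\<omega>. path_word (\<lambda>n. y n \<omega>) ?m (char_list L) =
    circle_char (sum_list (map snd L)) (y 0 \<omega>) * inc_char (?m + ?s) c \<omega>" using Cons.IH[of ?m] by blast
  have e: "inc_char ?m (\<lambda>_. snd p) \<omega> = inc_char (?m + ?s) (\<lambda>i. if i \<le> ?m then snd p else 0) \<omega>" for \<omega>
    by (rule inc_char_extend) simp
  show ?case
    by (intro exI[of _ "\<lambda>i. (if i \<le> ?m then snd p else 0) + c i"])
       (simp add: c char_y[of "snd p" ?m] e inc_char_mult[symmetric] circle_char_add_index add.assoc mult_ac)
qed

lemma path_word_AE:
  "AE \<omega> in M. dyadic_avg (\<lambda>n. path_word (\<lambda>n. y n \<omega>) n (char_list (L @ [(Suc m, k)])) -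
     of_real (\<phi> k) * path_word (\<lambda>n. y n \<omega>) n (char_list (L @ [(m, k)]))) \<longlonglongrightarrow> 0"
proof -
  define r where "r = sum_list (map fst L) + m"
  define K where "K = sum_list (map snd (L @ [(m, k)]))"
  have "\<forall>n. \<exists>c. \<forall>\<omega>. path_word (\<lambda>n. y n \<omega>) n (char_list (L @ [(m, k)])) = circle_char K (y 0 \<omega>) * inc_char (n + r) c \<omega>"
    using path_word_char[of _ "L @ [(m, k)]"] by (simp add: K_def r_def add.assoc)
  then obtain c where c: "\<And>n \<omega>. path_word (\<lambda>n. y n \<omega>) n (char_list (L @ [(m, k)])) =
    circle_char K (y 0 \<omega>) * inc_char (n + r) (c n) \<omega>" by metis
  have "path_word (\<lambda>n. y n \<omega>) n (char_list (L @ [(Suc m, k)])) =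
    path_word (\<lambda>n. y n \<omega>) n (char_list (L @ [(m, k)])) * circle_char k (\<xi> (Suc (n + r)) \<omega>)" for n \<omega>
    by (simp add: path_word_append y_Suc circle_char_add r_def add.assoc map_fst_char_list)
  then have eq: "path_word (\<lambda>n. y n \<omega>) n (char_list (L @ [(Suc m, k)])) -
     of_real (\<phi> k) * path_word (\<lambda>n. y n \<omega>) n (char_list (L @ [(m, k)])) =
     circle_char K (y 0 \<omega>) * mart_diff r c k n \<omega>" for n \<omega>
    unfolding mart_diff_def c by (simp add: algebra_simps)
  show ?thesis
    using mart_diff_AE[of r c k]
  proof eventually_elim
    case (elim \<omega>)
    have "(\<lambda>j. circle_char K (y 0 \<omega>) * dyadic_avg (\<lambda>n. mart_diff r c k n \<omega>) j) \<longlonglongrightarrow> circle_char K (y 0 \<omega>) * 0"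
      by (intro tendsto_intros elim)
    then show ?case unfolding eq dyadic_avg_cmult by simp
  qed
qed

lemma path_words_AE:
  "AE \<omega> in M. \<forall>L m k. dyadic_avg (\<lambda>n. path_word (\<lambda>n. y n \<omega>) n (char_list (L @ [(Suc m, k)])) -
     of_real (\<phi> k) * path_word (\<lambda>n. y n \<omega>) n (char_list (L @ [(m, k)]))) \<longlonglongrightarrow> 0"
  unfolding AE_all_countable by (intro allI path_word_AE)

end

section \<open>The increment distributions\<close>

text \<open>The mixture is prescribed on sets only; monotone induction transfers it to bounded
  nonnegative functions.\<close>

lemma integral_mixture:
  fixes u :: "'b \<Rightarrow> real"
  assumes fin: "finite_measure N" "finite_measure N1" "finite_measure N2"
    and sets: "sets N1 = sets N" "sets N2 = sets N" and space: "space N = UNIV"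
    and mix: "\<And>A. A \<in> sets N \<Longrightarrow> measure N A = a * measure N1 A + b * measure N2 A"
    and u: "u \<in> borel_measurable N" "\<And>x. 0 \<le> u x" "\<And>x. u x \<le> B"
  shows "(LINT x|N. u x) = a * (LINT x|N1. u x) + b * (LINT x|N2. u x)"
proof -
  have meas: "v \<in> borel_measurable N1" "v \<in> borel_measurable N2"
    if "v \<in> borel_measurable N" for v :: "'b \<Rightarrow> real"
    using that sets by (simp_all cong: measurable_cong_sets)
  have int: "integrable N v" "integrable N1 v" "integrable N2 v"
    if "v \<in> borel_measurable N" "\<And>x. 0 \<le> v x" "\<And>x. v x \<le> C" for v :: "'b \<Rightarrow> real" and C
    using that fin meas[OF that(1)] by (auto intro!: finite_measure.integrable_const_bound[where B=C])
  show ?thesis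
    using u
  proof (induction arbitrary: B rule: borel_measurable_induct_real)
    case (set A)
    then show ?case using mix sets by simp
  next
    case (mult u c)
    show ?case
    proof (cases "c = 0")
      case False
      then have "u x \<le> B / c" for x using mult by (simp add: field_simps)
      from mult.IH[OF this] show ?thesis by (simp add: algebra_simps)
    qed simp
  next
    case (add u v)
    have le: "u x \<le> B" "v x \<le> B" for x
      using add.prems[of x] add.hyps(2)[of x] add.hyps(4)[of x] by linarith+
    note i = int[OF add.hyps(1,2) le(1)] int[OF add.hyps(3,4) le(2)]
    show ?case using add.IH(1)[OF le(1)] add.IH(2)[OF le(2)] i by (simp add: algebra_simps)
  next
    case (seq U)
    have le: "U i x \<le> B" for i x
    proof -
      have "incseq (\<lambda>i. U i x)" using seq.hyps(3) by (auto simp: incseq_def le_fun_def)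
      from incseq_le[OF this seq.hyps(4)] have "U i x \<le> u x" by (simp add: space)
      also have "u x \<le> B" by (rule seq.prems)
      finally show ?thesis .
    qed
    have lim: "(\<lambda>i. LINT x|N'. U i x) \<longlonglongrightarrow> (LINT x|N'. u x)"
      if "finite_measure N'" "sets N' = sets N" for N'
    proof (rule integral_dominated_convergence[where w="\<lambda>_. B"])
      show "u \<in> borel_measurable N'" "U i \<in> borel_measurable N'" for i
        using u(1) seq.hyps(1)[of i] that(2) by (simp_all cong: measurable_cong_sets)
      show "integrable N' (\<lambda>_. B)" using that(1) by (simp add: finite_measure.integrable_const)
      show "AE x in N'. (\<lambda>i. U i x) \<longlonglongrightarrow> u x"
        using seq.hyps(4) by (simp add: space)
      show "AE x in N'. norm (U i x) \<le> B" for i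
        using le seq.hyps(2) by simp
    qed
    have "(\<lambda>i. a * (LINT x|N1. U i x) + b * (LINT x|N2. U i x)) \<longlonglongrightarrow> a * (LINT x|N1. u x) + b * (LINT x|N2. u x)"
      by (intro tendsto_intros lim fin sets)
    then have "(\<lambda>i. LINT x|N. U i x) \<longlonglongrightarrow> a * (LINT x|N1. u x) + b * (LINT x|N2. u x)"
      using seq.IH[OF le] by simp
    then show ?case using lim[OF fin(1) refl] by (rule LIMSEQ_unique[rotated])
  qed
qed

lemma AE_circle_lebesgue_neq_0: "AE x in \<mu>. x \<noteq> 0"
proof (rule AE_I')
  have zero: "circle_arg x = 0 \<longleftrightarrow> x = 0" for x
    using circle_arg(1)[of x] circle_arg_to_circle[of 0] by (auto simp: zero_circle.abs_eq)
  have "{x \<in> space borel. circle_arg x = 0} \<in> sets borel" by measurable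
  then have meas: "{x :: circle. x = 0} \<in> sets borel" by (simp add: zero)
  have "to_circle -` {x. x = 0} \<inter> {0..<2 * pi} \<subseteq> {0}"
    using circle_arg_to_circle zero by fastforce
  then have "emeasure lborel (to_circle -` {x. x = 0} \<inter> {0..<2 * pi}) \<le> emeasure lborel {0::real}"
    by (intro emeasure_mono) auto
  then show "{x. x = 0} \<in> null_sets \<mu>"
    using meas by (intro null_setsI) (simp_all add: emeasure_circle_lebesgue)
qed auto

section \<open>Characteristic coefficients of the increments\<close>

context circle_process begin

definition char_D :: "real \<Rightarrow> int \<Rightarrow> complex" where
  "char_D t k = (LINT x|D t. circle_char k x)"

context
  fixes t :: real
  assumes t: "t \<ge> 0"
begin

lemma measurable_\<gamma>: "\<gamma> t \<in> borel_measurable borel"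
  and \<gamma>_nonneg: "0 \<le> \<gamma> t x"
  and nn_integral_\<gamma>: "(\<integral>\<^sup>+ x. ennreal (\<gamma> t x) \<partial>\<mu>) = 1"
  using pdf_\<gamma>[OF t] by (auto simp: circle_pdf_def)

lemma prob_space_\<gamma>: "prob_space (density \<mu> (\<lambda>x. ennreal (\<gamma> t x)))"
proof
  have [measurable]: "\<gamma> t \<in> borel_measurable borel" by (rule measurable_\<gamma>)
  show "emeasure (density \<mu> (\<lambda>x. ennreal (\<gamma> t x)))
    (space (density \<mu> (\<lambda>x. ennreal (\<gamma> t x)))) = 1"
    using nn_integral_\<gamma> by (simp add: emeasure_density)
qed

lemma integrable_\<gamma>: "integrable \<mu> (\<gamma> t)"
  using measurable_\<gamma> \<gamma>_nonneg nn_integral_\<gamma> by (intro integrableI_nonneg) auto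

lemma integral_\<gamma>: "(LINT x|\<mu>. \<gamma> t x) = 1"
  using measurable_\<gamma> \<gamma>_nonneg nn_integral_\<gamma> by (subst integral_eq_nn_integral) auto

lemma integral_D_real:
  fixes u :: "circle \<Rightarrow> real"
  assumes u [measurable]: "u \<in> borel_measurable borel" and bd: "\<And>x. \<bar>u x\<bar> \<le> 1"
  shows "(LINT x|D t. u x) = \<beta> t * u 0 + (1 - \<beta> t) * (LINT x|\<mu>. \<gamma> t x * u x)"
proof -
  have [measurable]: "\<gamma> t \<in> borel_measurable borel" by (rule measurable_\<gamma>)
  let ?G = "density \<mu> (\<lambda>x. ennreal (\<gamma> t x))" and ?R = "return borel (0 :: circle)"
  interpret Dt: prob_space "D t" by (rule prob_space_D[OF t])
  interpret G: prob_space ?G by (rule prob_space_\<gamma>)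
  interpret R: prob_space ?R by (rule prob_space_return) simp
  have sets [simp, measurable_cong]: "sets (D t) = sets borel" by (rule sets_D[OF t])
  have sp: "space (D t) = UNIV" using sets_eq_imp_space_eq[OF sets] by simp
  have b: "0 \<le> \<beta> t" "\<beta> t \<le> 1" using \<beta>_range[OF t] by auto
  have mix: "measure (D t) A = \<beta> t * measure ?R A + (1 - \<beta> t) * measure ?G A" if "A \<in> sets (D t)" for A
  proof -
    have "emeasure (D t) A = ennreal (\<beta> t * measure ?R A + (1 - \<beta> t) * measure ?G A)"
      using that b mixture_D[OF t, of A]
      by (simp add: R.emeasure_eq_measure G.emeasure_eq_measure ennreal_mult ennreal_plus)
    then have "measure (D t) A = enn2real (ennreal (\<beta> t * measure ?R A + (1 - \<beta> t) * measure ?G A))"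
      by (simp only: measure_def)
    also have "\<dots> = \<beta> t * measure ?R A + (1 - \<beta> t) * measure ?G A"
      using b by (intro enn2real_ennreal add_nonneg_nonneg mult_nonneg_nonneg) auto
    finally show ?thesis .
  qed
  \<comment> \<open>Adding 1 makes the function nonnegative, as \<open>integral_mixture\<close>
    requires; the constant cancels since all three measures have mass 1.\<close>
  have bd': "0 \<le> u x + 1" "u x + 1 \<le> 2" for x using bd[of x] by linarith+
  have "(LINT x|D t. u x + 1) = \<beta> t * (LINT x|?R. u x + 1) + (1 - \<beta> t) * (LINT x|?G. u x + 1)"
    by (rule integral_mixture[where B=2])
       (simp_all add: sp mix bd' Dt.finite_measure_axioms R.finite_measure_axioms G.finite_measure_axioms)
  moreover have "(LINT x|?R. u x + 1) = u 0 + 1" by (subst integral_return) auto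
  moreover have "integrable (D t) u" "integrable ?G u"
    using bd by (auto intro!: Dt.integrable_const_bound[where B=1] G.integrable_const_bound[where B=1])
  moreover have "(LINT x|?G. u x) = (LINT x|\<mu>. \<gamma> t x * u x)"
    using \<gamma>_nonneg by (subst integral_real_density) auto
  ultimately show ?thesis
    using Dt.prob_space G.prob_space by (simp add: algebra_simps sp)
qed

text \<open>The index changes sign because \<open>fourier_coeff\<close> integrates against the
  conjugate character.\<close>

lemma char_D_eq:
  "char_D t k = of_real (\<beta> t) + of_real (1 - \<beta> t) * fourier_coeff (\<lambda>x. complex_of_real (\<gamma> t x)) (- k)"
proof -
  have [measurable]: "\<gamma> t \<in> borel_measurable borel" by (rule measurable_\<gamma>)
  interpret Dt: prob_space "D t" by (rule prob_space_D[OF t])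
  have sets [simp, measurable_cong]: "sets (D t) = sets borel" by (rule sets_D[OF t])
  have i1: "integrable (D t) (circle_char k)"
    by (rule Dt.integrable_const_bound[where B=1]) auto
  have i2: "integrable \<mu> (\<lambda>x. of_real (\<gamma> t x) * circle_char k x)"
    by (rule Bochner_Integration.integrable_bound[OF integrable_\<gamma>]) (auto simp: norm_mult)
  have "\<bar>Re (circle_char k x)\<bar> \<le> 1" "\<bar>Im (circle_char k x)\<bar> \<le> 1" for x
    using abs_Re_le_cmod[of "circle_char k x"] abs_Im_le_cmod[of "circle_char k x"] by auto
  note re = integral_D_real[OF _ this(1)] and im = integral_D_real[OF _ this(2)]
  have "Re (char_D t k) = (LINT x|D t. Re (circle_char k x))" "Im (char_D t k) = (LINT x|D t. Im (circle_char k x))"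
    using i1 by (simp_all add: char_D_def)
  moreover have "Re (LINT x|\<mu>. of_real (\<gamma> t x) * circle_char k x) = (LINT x|\<mu>. \<gamma> t x * Re (circle_char k x))"
    "Im (LINT x|\<mu>. of_real (\<gamma> t x) * circle_char k x) = (LINT x|\<mu>. \<gamma> t x * Im (circle_char k x))"
    using integral_Re[OF i2] integral_Im[OF i2] by simp_all
  ultimately show ?thesis
    by (simp add: re im fourier_coeff_def complex_eq_iff)
qed

lemma norm_char_D_le: "norm (char_D t k) \<le> 1"
proof -
  interpret Dt: prob_space "D t" by (rule prob_space_D[OF t])
  have "norm (char_D t k) \<le> (LINT x|D t. norm (circle_char k x))"
    unfolding char_D_def by (rule integral_norm_bound)
  then show ?thesis by (simp add: Dt.prob_space)
qed

text \<open>The value 1 would force the density to live where the first character equals 1, that is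
  at the single point 0, which is null.\<close>

lemma char_D_1_neq_1:
  assumes "\<beta> t \<noteq> 1"
  shows "char_D t 1 \<noteq> 1"
proof
  assume eq: "char_D t 1 = 1"
  have [measurable]: "\<gamma> t \<in> borel_measurable borel" by (rule measurable_\<gamma>)
  let ?g = "LINT x|\<mu>. of_real (\<gamma> t x) * circle_char 1 x"
  have i2: "integrable \<mu> (\<lambda>x. of_real (\<gamma> t x) * circle_char 1 x)"
    by (rule Bochner_Integration.integrable_bound[OF integrable_\<gamma>]) (auto simp: norm_mult)
  have "of_real (1 - \<beta> t) * (?g - 1) = 0"
    using eq char_D_eq[of 1] by (simp add: fourier_coeff_def algebra_simps)
  then have g: "?g = 1" using assms by simp
  have i3: "integrable \<mu> (\<lambda>x. \<gamma> t x * Re (circle_char 1 x))"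
    using integrable_Re[OF i2] by simp
  have "(LINT x|\<mu>. \<gamma> t x * (1 - Re (circle_char 1 x))) = 1 - Re ?g"
    using i3 integral_Re[OF i2] integrable_\<gamma> by (simp add: right_diff_distrib integral_\<gamma>)
  then have z: "(LINT x|\<mu>. \<gamma> t x * (1 - Re (circle_char 1 x))) = 0" by (simp add: g)
  have le: "Re (circle_char 1 x) \<le> 1" for x using complex_Re_le_cmod[of "circle_char 1 x"] by simp
  have "AE x in \<mu>. \<gamma> t x * (1 - Re (circle_char 1 x)) = 0"
    using z i3 integrable_\<gamma> le \<gamma>_nonneg
    by (subst (asm) integral_nonneg_eq_0_iff_AE) (auto simp: right_diff_distrib intro!: AE_I2 mult_left_le)
  then have "AE x in \<mu>. \<gamma> t x = 0"
    using AE_circle_lebesgue_neq_0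
  proof eventually_elim
    case (elim x)
    have "Re (circle_char 1 x) \<noteq> 1"
    proof
      assume re: "Re (circle_char 1 x) = 1"
      moreover have "(Re (circle_char 1 x))\<^sup>2 + (Im (circle_char 1 x))\<^sup>2 = 1"
        unfolding cmod_power2[symmetric] by simp
      ultimately have "Im (circle_char 1 x) = 0" by simp
      with re have "circle_char 1 x = circle_char 1 0" by (simp add: complex_eq_iff)
      then show False using elim(2) circle_char_1_inj by blast
    qed
    with elim show ?case by simp
  qed
  then have "(LINT x|\<mu>. \<gamma> t x) = (LINT x|\<mu>. 0)"
    by (intro integral_cong_AE) auto
  then show False by (simp add: integral_\<gamma>)
qed

end

lemma char_D_add:
  assumes "0 \<le> s" "0 \<le> t"
  shows "char_D (t + s) k = char_D t k * char_D s k"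
proof -
  interpret Dt: prob_space "D t" by (rule prob_space_D[OF assms(2)])
  interpret Ds: prob_space "D s" by (rule prob_space_D[OF assms(1)])
  have sets [simp, measurable_cong]: "sets (D t) = sets borel" "sets (D s) = sets borel"
    by (rule sets_D; fact)+
  interpret P: pair_prob_space "D t" "D s" ..
  have "char_D (t + s) k = (LINT z|(D t \<Otimes>\<^sub>M D s). circle_char k (case z of (x, y) \<Rightarrow> x + y))"
    unfolding char_D_def convolution_D[OF assms] circle_convolution_def by (rule integral_distr) measurable
  also have "\<dots> = (LINT x|D t. LINT y|D s. circle_char k (x + y))"
    by (subst P.integral_fst'[symmetric]) (auto intro!: P.integrable_const_bound[where B=1])
  also have "\<dots> = char_D t k * char_D s k"
    by (simp add: circle_char_add char_D_def)
  finally show ?thesis .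
qed

lemma char_D_mult:
  assumes "0 \<le> t"
  shows "char_D (real (Suc n) * t) k = char_D t k ^ Suc n"
proof (induction n)
  case (Suc n)
  have "char_D (real (Suc (Suc n)) * t) k = char_D (real (Suc n) * t + t) k" by (simp add: algebra_simps)
  also have "\<dots> = char_D (real (Suc n) * t) k * char_D t k" using assms by (intro char_D_add) auto
  also have "\<dots> = char_D t k ^ Suc (Suc n)" unfolding Suc.IH by simp
  finally show ?case .
qed simp

context
  assumes sym: "\<And>t y. t > 0 \<Longrightarrow> \<gamma> t y = \<gamma> t (- y)"
begin

lemma fourier_coeff_\<gamma>_even:
  assumes t: "t > 0"
  shows "fourier_coeff (\<lambda>x. complex_of_real (\<gamma> t x)) (- k) = fourier_coeff (\<lambda>x. complex_of_real (\<gamma> t x)) k"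
proof -
  have [measurable]: "\<gamma> t \<in> borel_measurable borel" using t by (intro measurable_\<gamma>) simp
  have "(LINT x|\<mu>. complex_of_real (\<gamma> t (- x)) * circle_char k (- x)) =
    (LINT x|\<mu>. complex_of_real (\<gamma> t x) * circle_char k x)"
    by (rule integral_circle_uminus) measurable
  then show ?thesis
    using sym[OF t] by (simp add: fourier_coeff_def circle_char_uminus circle_char_uminus_index)
qed

lemma char_D_real:
  assumes t: "t > 0"
  shows "char_D t k = of_real (Re (char_D t k))"
proof -
  have "char_D t (- k) = char_D t k"
    using t fourier_coeff_\<gamma>_even[OF t, of k] by (simp add: char_D_eq)
  moreover have "char_D t (- k) = cnj (char_D t k)"
    unfolding char_D_def circle_char_uminus_index by (rule Bochner_Integration.integral_cnj)
  ultimately show ?thesis by (metis Reals_cnj_iff complex_is_Real_iff of_real_Re)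
qed

text \<open>Each law is the convolution square of the law at half the time, so its real coefficient
  is a square.\<close>

lemma char_D_nonneg:
  assumes t: "t > 0"
  shows "0 \<le> Re (char_D t k)"
proof -
  have "char_D t k = char_D (t / 2) k * char_D (t / 2) k"
    using char_D_add[of "t / 2" "t / 2" k] t by simp
  also have "\<dots> = of_real ((Re (char_D (t / 2) k))\<^sup>2)"
    unfolding power2_eq_square of_real_mult using char_D_real[of "t / 2" k] t by simp
  finally show ?thesis by simp
qed

text \<open>If the law at \<open>t\<^sub>0\<close> were the unit mass at 0, its first coefficient
  would be 1. Factoring it at a shorter time \<open>s\<close> forces modulus 1 there, and
  nonnegativity upgrades this to the value 1; powers carry it to the time \<open>t\<close> at which
  the law is known not to be degenerate.\<close>

lemma \<beta>_neq_1:
  assumes t0: "t\<^sub>0 > 0"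
  shows "\<beta> t\<^sub>0 \<noteq> 1"
proof
  assume b: "\<beta> t\<^sub>0 = 1"
  have c0: "char_D t\<^sub>0 1 = 1" using t0 b by (simp add: char_D_eq)
  obtain t where t: "t \<ge> 0" "\<beta> t \<noteq> 1" using not_constant by blast
  obtain n :: nat where n: "t / t\<^sub>0 < real n" using reals_Archimedean2 by blast
  define s where "s = t / real (Suc n)"
  have s: "0 \<le> s" "s \<le> t\<^sub>0"
  proof -
    show "0 \<le> s" using t by (simp add: s_def)
    have "t \<le> real n * t\<^sub>0" using n t0 by (simp add: field_simps)
    also have "\<dots> \<le> real (Suc n) * t\<^sub>0" using t0 by simp
    finally show "s \<le> t\<^sub>0" by (simp add: s_def field_simps)
  qed
  have prod: "char_D s 1 * char_D (t\<^sub>0 - s) 1 = 1"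
    using char_D_add[of "t\<^sub>0 - s" s 1] s c0 by simp
  have "norm (char_D s 1) = 1"
  proof -
    have "norm (char_D s 1) * norm (char_D (t\<^sub>0 - s) 1) = 1" unfolding norm_mult[symmetric] prod by simp
    moreover have "norm (char_D s 1) * norm (char_D (t\<^sub>0 - s) 1) \<le> norm (char_D s 1) * 1"
      using s by (intro mult_left_mono norm_char_D_le) auto
    ultimately show ?thesis using norm_char_D_le[OF s(1), of 1] by simp
  qed
  moreover have "char_D s 1 = of_real \<bar>Re (char_D s 1)\<bar>"
  proof (cases "s = 0")
    case False
    then show ?thesis using char_D_real[of s 1] char_D_nonneg[of s 1] s by simp
  next
    case True
    \<comment> \<open>Symmetry is given at positive times only; at time 0 the coefficient is
      idempotent and nonzero.\<close>
    have "char_D 0 1 = char_D 0 1 * char_D 0 1" using char_D_add[of 0 0 1] by simp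
    moreover have "char_D 0 1 \<noteq> 0" using \<open>norm (char_D s 1) = 1\<close> True by auto
    ultimately show ?thesis using True by simp
  qed
  ultimately have "char_D s 1 = 1" by (metis norm_of_real abs_abs of_real_1)
  then have "char_D (real (Suc n) * s) 1 = 1" using char_D_mult[OF s(1), of n 1] by simp
  then have "char_D t 1 = 1" by (simp add: s_def del: of_nat_Suc)
  then show False using char_D_1_neq_1[OF t] by simp
qed

end

end

section \<open>Reconstruction\<close>

text \<open>Written for a bare real path, so that the reconstruction map can evaluate it without
  knowing \<open>X\<close> or \<open>f\<close>.\<close>

primrec observed_word :: "(real \<Rightarrow> real) \<Rightarrow> real \<Rightarrow> nat \<Rightarrow> nat list \<Rightarrow> complex" where
  "observed_word p t n [] = 1"
| "observed_word p t n (m # ms) = of_real (p (real (n + m) * t)) * observed_word p t (n + m) ms"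

lemma path_word_eq_observed:
  assumes "t \<ge> 0"
  shows "path_word (\<lambda>n. x (real n * t)) n (map (\<lambda>m. (m, \<lambda>x. complex_of_real (f x))) ms) =
    observed_word (\<lambda>s\<in>{0..}. f (x s)) t n ms"
  using assms by (induction ms arbitrary: n) auto

theorem theorem6:
  fixes M :: "'a measure"
    and X :: "real \<Rightarrow> 'a \<Rightarrow> circle"
    and D :: "real \<Rightarrow> circle measure"
    and \<beta> :: "real \<Rightarrow> real"
    and \<gamma> :: "real \<Rightarrow> circle \<Rightarrow> real"
    and t\<^sub>0 :: real
  assumes "circle_process M X D \<beta> \<gamma>"
    and "\<And>t y. t > 0 \<Longrightarrow> \<gamma> t y = \<gamma> t (- y)"
    and "t\<^sub>0 > 0"
    and "inj_on (fourier_coeff (\<lambda>x. complex_of_real (\<gamma> t\<^sub>0 x))) {0..}"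
    and "\<And>k::int. k \<ge> 0 \<Longrightarrow> fourier_coeff (\<lambda>x. complex_of_real (\<gamma> t\<^sub>0 x)) k \<noteq> 0"
  shows "reconstructible_up_to_reflections M X open_indicators"
proof -
  interpret circle_process M X D \<beta> \<gamma> by fact
  note sym = assms(2) and t0 = assms(3)
  define \<phi> where "\<phi> k = Re (char_D t\<^sub>0 k)" for k
  have \<phi>: "char_D t\<^sub>0 k = of_real (\<phi> k)" for k
    unfolding \<phi>_def by (rule char_D_real[OF sym t0])
  have \<phi>_even: "\<phi> (- k) = \<phi> k" for k
    unfolding \<phi>_def using t0 fourier_coeff_\<gamma>_even[OF sym t0, of k] by (simp add: char_D_eq)
  have "inj_on \<phi> {0..}"
  proof (rule inj_onI)
    fix k l :: int assume kl: "k \<in> {0..}" "l \<in> {0..}" "\<phi> k = \<phi> l"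
    \<comment> \<open>The negative index undoes the sign in \<open>char_D_eq\<close>, which leaves
      nonnegative frequencies on the side of the density.\<close>
    then have "char_D t\<^sub>0 (- k) = char_D t\<^sub>0 (- l)" by (simp add: \<phi> \<phi>_even)
    then have "complex_of_real (1 - \<beta> t\<^sub>0) * fourier_coeff (\<lambda>x. complex_of_real (\<gamma> t\<^sub>0 x)) k =
        of_real (1 - \<beta> t\<^sub>0) * fourier_coeff (\<lambda>x. complex_of_real (\<gamma> t\<^sub>0 x)) l"
      unfolding char_D_eq[OF less_imp_le[OF t0]] minus_minus by (rule add_left_imp_eq)
    moreover have "complex_of_real (1 - \<beta> t\<^sub>0) \<noteq> 0" using \<beta>_neq_1[OF sym t0] by simp
    ultimately have "fourier_coeff (\<lambda>x. complex_of_real (\<gamma> t\<^sub>0 x)) k = fourier_coeff (\<lambda>x. complex_of_real (\<gamma> t\<^sub>0 x)) l"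
      by (simp only: mult_cancel_left simp_thms)
    then show "k = l" using assms(4) kl by (auto dest: inj_onD)
  qed
  then interpret S: circle_step "D t\<^sub>0" \<phi>
    using prob_space_D[of t\<^sub>0] sets_D[of t\<^sub>0] t0 \<phi>
    by (intro circle_step.intro circle_step_axioms.intro) (auto simp: char_D_def)
  \<comment> \<open>The offset by one reconciles increments numbered from 1 with sampling from time
    0: for i \<ge> 1 this is the step from time \<open>(i - 1) * t\<^sub>0\<close> to time
    \<open>i * t\<^sub>0\<close>.\<close>
  define \<xi> where "\<xi> i \<omega> = X ((real (Suc i) - 1) * t\<^sub>0) \<omega> - X ((real i - 1) * t\<^sub>0) \<omega>" for i :: nat and \<omega>
  interpret W: circle_walk M \<xi> "\<lambda>n. X (real n * t\<^sub>0)" \<phi>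
  proof
    fix n :: nat
    have "indep_vars (\<lambda>_. borel) \<xi> {1..<Suc n}"
      unfolding \<xi>_def using t0 by (intro independent_increments[of "Suc n" "\<lambda>i. (real i - 1) * t\<^sub>0"])
        (auto intro!: mono_onI mult_right_mono)
    then show "indep_vars (\<lambda>_. borel) \<xi> {1..n}" by (simp add: atLeastLessThanSuc_atLeastAtMost)
  next
    fix i :: nat and k assume i: "1 \<le> i"
    have le: "0 \<le> (real i - 1) * t\<^sub>0" "(real i - 1) * t\<^sub>0 \<le> (real (Suc i) - 1) * t\<^sub>0"
      using i t0 by (auto intro!: mult_right_mono)
    have [measurable]: "X ((real i - 1) * t\<^sub>0) \<in> M \<rightarrow>\<^sub>M borel" "X ((real (Suc i) - 1) * t\<^sub>0) \<in> M \<rightarrow>\<^sub>M borel"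
      using le by (auto intro!: random_variable_X)
    have \<xi>_meas: "\<xi> i \<in> M \<rightarrow>\<^sub>M borel" unfolding \<xi>_def[abs_def] by measurable
    have "distr M borel (\<xi> i) = D t\<^sub>0"
      using stationary_increments[OF le] by (simp add: \<xi>_def[abs_def] algebra_simps)
    then have "of_real (\<phi> k) = (LINT x|distr M borel (\<xi> i). circle_char k x)"
      by (simp add: \<phi>[symmetric] char_D_def)
    also have "\<dots> = (LINT \<omega>|M. circle_char k (\<xi> i \<omega>))"
      by (rule integral_distr[OF \<xi>_meas]) simp
    finally show "(LINT \<omega>|M. circle_char k (\<xi> i \<omega>)) = of_real (\<phi> k)" by simp
  qed (simp_all add: \<xi>_def \<phi>_even)
  define c :: "(circle \<Rightarrow> real) \<Rightarrow> circle \<Rightarrow> complex" where "c f = (\<lambda>x. of_real (f x))" for f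
  define good :: "(circle \<Rightarrow> real) \<Rightarrow> (real \<Rightarrow> real) \<Rightarrow> bool" where
    "good f p \<longleftrightarrow> (\<forall>ms. dyadic_avg (\<lambda>n. observed_word p t\<^sub>0 n (0 # ms)) \<longlonglongrightarrow> ncoeff (op_word (c f) (S.Tpows ms) (c f)) 0)" for f p
  \<comment> \<open>Where no candidate fits, the value is arbitrary; for each f this happens only on
    a null set of paths.\<close>
  define A where "A p = (SOME g. g \<in> open_indicators \<and> good g p)" for p
  have ind: "sandwiched (c f)" "c f \<in> bborel" "\<And>x. norm (c f x) \<le> 1" "\<And>x. c f x * c f x = c f x"
    "\<And>x. cnj (c f x) = c f x" if "f \<in> open_indicators" for f
  proof -
    obtain U where U: "f = indicator U" "open U" "emeasure \<mu> (frontier U) = 0"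
      using \<open>f \<in> open_indicators\<close> by (auto simp: open_indicators_def)
    show "sandwiched (c f)" unfolding c_def U(1) by (rule sandwiched_open_indicator[OF U(2,3)])
    then show "c f \<in> bborel" by (simp add: sandwiched_def)
  qed (use that in \<open>auto simp: open_indicators_def c_def indicator_def\<close>)
  show ?thesis unfolding reconstructible_up_to_reflections_def
  proof (intro exI[of _ A] ballI)
    fix f assume f: "f \<in> open_indicators"
    show "AE \<omega> in M. \<exists>\<theta>. (AE x in \<mu>. A (\<lambda>t\<in>{0..}. f (X t \<omega>)) x = f (x + \<theta>)) \<or>
        (AE x in \<mu>. A (\<lambda>t\<in>{0..}. f (X t \<omega>)) x = f (- x + \<theta>))"
      using W.path_words_AE
    proof eventually_elim
      case (elim \<omega>)
      define p where "p = (\<lambda>t\<in>{0..}. f (X t \<omega>))"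
      have "S.generic (\<lambda>n. X (real n * t\<^sub>0) \<omega>)" using elim by (simp add: S.generic_def)
      note stat = S.generic_statistics[OF this ind(1)[OF f] ind(3)[OF f]]
      have "path_word (\<lambda>n. X (real n * t\<^sub>0) \<omega>) n (map (\<lambda>m. (m, c f)) ms) = observed_word p t\<^sub>0 n ms" for n ms
        unfolding c_def p_def using t0 by (intro path_word_eq_observed[where x="\<lambda>t. X t \<omega>"]) simp
      then have "good f p" unfolding good_def using stat by (simp only: simp_thms)
      \<comment> \<open>The observed \<open>f\<close> is itself a candidate, so the choice
        succeeds.\<close>
      then have "A p \<in> open_indicators \<and> good (A p) p"
        unfolding A_def using f by (intro someI[where P="\<lambda>g. g \<in> open_indicators \<and> good g p"]) auto
      then have g: "A p \<in> open_indicators" "good (A p) p" by auto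
      have "ncoeff (op_word (c f) (S.Tpows ms) (c f)) 0 = ncoeff (op_word (c (A p)) (S.Tpows ms) (c (A p))) 0" for ms
        using \<open>good f p\<close> g(2) unfolding good_def by (blast intro: LIMSEQ_unique)
      then have "toeplitz (ncoeff (c f)) ls 0 = toeplitz (ncoeff (c (A p))) ls 0" for ls
        by (intro S.same_statistics_toeplitz ind f g)
      \<comment> \<open>The chosen function takes the role of g, so that it is expressed as a shift
        or a reflection of \<open>f\<close> and not the other way round.\<close>
      then obtain \<theta> where "(AE x in \<mu>. c (A p) x = c f (x + \<theta>)) \<or>
          (AE x in \<mu>. c (A p) x = c f (- x + \<theta>))"
        using same_toeplitz_congruent[OF ind(2,4,5)[OF f] ind(2,5)[OF g(1)]] by blast
      then show ?case by (auto simp: c_def p_def)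
    qed
  qed
qed

end
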